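(* Suppose $U\subset\mathbb{R}^n$ is a (non-empty) bounded open set, $F:\partial U\to\mathbb{R}$ is uniformly continuous, and $f:U\to\mathbb{R}$ satisfies either $f=0$, or else $\inf f>0$ and $f$ is uniformly continuous. Then there is a unique continuous function $u:\overline U\to\mathbb{R}$ that is a viscosity solution of $\Delta_\infty u=-2f$ on $U$ and satisfies $u=F$ on $\partial U$. This unique solution is the continuum value of tug-of-war on $(\overline U,d,\partial U,F,f)$, where $d$ is the Euclidean distance.
   Context: Viscosity solutions. For a $C^2$ function $\phi$ near $x$ with $\nabla\phi(x)\neq0$, $\Delta_\infty\phi(x)=|\nabla\phi|^{-2}\sum_{i,j}\phi_{x_i}\phi_{x_ix_j}\phi_{x_j}$ (evaluated at $x$); if $\nabla\phi(x)=0$ and the limit $\lim_{x'\to x}2\frac{\phi(x')-\phi(x)}{|x'-x|^2}$ exists, $\Delta_\infty\phi(x)$ is defined to be this limit. Let $S(x)$ be the set of real functions $\phi$ that are defined and $C^2$ in a neighborhood of $x$ and for which $\Delta_\infty\phi(x)$ is defined in one of these two ways. For continuous $u$ put $$\Delta_\infty^+u(x)=\inf\{\Delta_\infty\phi(x):\phi\in S(x),\ x\text{ is a local minimum of }\phi-u\},$$ $$\Delta_\infty^-u(x)=\sup\{\Delta_\infty\phi(x):\phi\in S(x),\ x\text{ is a local maximum of }\phi-u\}.$$ $u$ is a viscosity solution of $\Delta_\infty u=g$ on $U$ if $\Delta_\infty^-u\le g\le\Delta_\infty^+u$ at every point of $U$. Continuum value of $(X,d,Y,F,f)$ (here $X=\overline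 U$, $Y=\partial U$). For $\varepsilon>0$ and $x\in X$, in $\varepsilon$-tug-of-war a token starts at $x_0=x$; at the $k$-th turn a fair coin is tossed (independently) and the winner of the toss chooses $x_k\in X$ with $d(x_k,x_{k-1})<\varepsilon$. The game ends the first time $x_k\in Y$, and player I's payoff is then $F(x_k)+\varepsilon^2\sum_{i=0}^{k-1}f(x_i)$. Player I maximizes and player II minimizes. A strategy is a map from the set of partially played games (all previous moves and coin tosses) to legal moves (or to probability distributions on legal moves). For strategies $S_{\mathrm I},S_{\mathrm{II}}$, if the game terminates with probability one and the expected total payoff exists in $[-\infty,\infty]$, then $F_-(S_{\mathrm I},S_{\mathrm{II}})=F_+(S_{\mathrm I},S_{\mathrm{II}})$ is this expectation; otherwise $F_-=-\infty$ and $F_+=+\infty$. Put $u_{\mathrm I}^\varepsilon(x)=\sup_{S_{\mathrm I}}\inf_{S_{\mathrm{II}}}F_-$ and $u_{\mathrm{II}}^\varepsilon(x)=\inf_{S_{\mathrm{II}}}\sup_{S_{\mathrm I}}F_+$; when these agree the common function is $u^\varepsilon$. The continuum value is the pointwise limit $\lim_{\varepsilon\to0}u^\varepsilon$. *)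

theory Defs
  imports "HOL-Probability.Probability"
begin

section \<open>Viscosity solutions of the infinity Laplace equation\<close>

definition grad :: "(real^'n \<Rightarrow> real) \<Rightarrow> real^'n \<Rightarrow> real^'n" where
  "grad \<phi> x = (\<chi> i. frechet_derivative \<phi> (at x) (axis i 1))"

definition hess :: "(real^'n \<Rightarrow> real) \<Rightarrow> real^'n \<Rightarrow> real^'n^'n" where
  "hess \<phi> x = (\<chi> i j. frechet_derivative (\<lambda>y. grad \<phi> y $ i) (at x) (axis j 1))"

definition C2_near :: "(real^'n \<Rightarrow> real) \<Rightarrow> real^'n \<Rightarrow> bool" where
  "C2_near \<phi> x \<longleftrightarrow> (\<exists>N. open N \<and> x \<in> N \<and>
     (\<forall>y\<in>N. \<phi> differentiable (at y)) \<and>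
     (\<forall>y\<in>N. grad \<phi> differentiable (at y)) \<and>
     continuous_on N (hess \<phi>))"

text \<open>
  For a function that is C2 near a point with vanishing gradient, the quotient
  \<^term>\<open>2 * (\<phi> x' - \<phi> x) / (dist x' x)\<^sup>2\<close> is bounded near that point, so only finite
  limits can occur.
\<close>

definition inf_lap_defined :: "(real^'n \<Rightarrow> real) \<Rightarrow> real^'n \<Rightarrow> bool" where
  "inf_lap_defined \<phi> x \<longleftrightarrow> grad \<phi> x \<noteq> 0 \<or>
     (\<exists>L::real. ((\<lambda>x'. 2 * (\<phi> x' - \<phi> x) / (dist x' x)\<^sup>2) \<longlongrightarrow> L) (at x))"

definition inf_lap :: "(real^'n \<Rightarrow> real) \<Rightarrow> real^'n \<Rightarrow> real" where
  "inf_lap \<phi> x =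
     (if grad \<phi> x \<noteq> 0
      then (\<Sum>i\<in>UNIV. \<Sum>j\<in>UNIV. grad \<phi> x $ i * hess \<phi> x $ i $ j * grad \<phi> x $ j)
             / (norm (grad \<phi> x))\<^sup>2
      else Lim (at x) (\<lambda>x'. 2 * (\<phi> x' - \<phi> x) / (dist x' x)\<^sup>2))"

text \<open>
  Only the germ at \<open>x\<close> of a test function matters, so test functions, which need only be
  defined near \<open>x\<close>, are represented by total functions.
\<close>

definition test_functions :: "real^'n \<Rightarrow> (real^'n \<Rightarrow> real) set" where
  "test_functions x = {\<phi>. C2_near \<phi> x \<and> inf_lap_defined \<phi> x}"

definition local_min_at :: "('a::topological_space \<Rightarrow> real) \<Rightarrow> 'a \<Rightarrow> bool" where
  "local_min_at g x \<longleftrightarrow> (\<forall>\<^sub>F y in nhds x. g x \<le> g y)"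

definition local_max_at :: "('a::topological_space \<Rightarrow> real) \<Rightarrow> 'a \<Rightarrow> bool" where
  "local_max_at g x \<longleftrightarrow> (\<forall>\<^sub>F y in nhds x. g y \<le> g x)"

text \<open>Extended-real infimum and supremum: \<open>\<infinity>\<close> and \<open>-\<infinity>\<close> when there is no touching test function.\<close>

definition inf_lap_plus :: "(real^'n \<Rightarrow> real) \<Rightarrow> real^'n \<Rightarrow> ereal" where
  "inf_lap_plus u x =
     (INF \<phi> \<in> {\<phi> \<in> test_functions x. local_min_at (\<lambda>y. \<phi> y - u y) x}. ereal (inf_lap \<phi> x))"

definition inf_lap_minus :: "(real^'n \<Rightarrow> real) \<Rightarrow> real^'n \<Rightarrow> ereal" where
  "inf_lap_minus u x =
     (SUP \<phi> \<in> {\<phi> \<in> test_functions x. local_max_at (\<lambda>y. \<phi> y - u y) x}. ereal (inf_lap \<phi> x))"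

definition viscosity_solution ::
  "(real^'n) set \<Rightarrow> (real^'n \<Rightarrow> real) \<Rightarrow> (real^'n \<Rightarrow> real) \<Rightarrow> bool" where
  "viscosity_solution U g u \<longleftrightarrow>
     (\<forall>x\<in>U. inf_lap_minus u x \<le> ereal (g x) \<and> ereal (g x) \<le> inf_lap_plus u x)"

definition solves_dirichlet ::
  "(real^'n) set \<Rightarrow> (real^'n \<Rightarrow> real) \<Rightarrow> (real^'n \<Rightarrow> real) \<Rightarrow> (real^'n \<Rightarrow> real) \<Rightarrow> bool" where
  "solves_dirichlet U g F u \<longleftrightarrow>
     continuous_on (closure U) u \<and> viscosity_solution U g u \<and> (\<forall>x\<in>frontier U. u x = F x)"


section \<open>Tug-of-war\<close>

text \<open>
  A partially played game: the starting point followed by the turns, each consisting of a coin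
  toss (\<^term>\<open>True\<close>: player I wins the toss) and the move made.
\<close>

datatype 'a play = Start 'a | Turn "'a play" bool 'a

primrec pos :: "'a play \<Rightarrow> 'a" where
  "pos (Start x) = x"
| "pos (Turn h c y) = y"

primrec turns :: "'a play \<Rightarrow> nat" where
  "turns (Start x) = 0"
| "turns (Turn h c y) = Suc (turns h)"

text \<open>Sum of \<open>f\<close> over all positions except the current one.\<close>

primrec running_sum :: "('a \<Rightarrow> real) \<Rightarrow> 'a play \<Rightarrow> real" where
  "running_sum f (Start x) = 0"
| "running_sum f (Turn h c y) = running_sum f h + f (pos h)"

definition payoff :: "('a \<Rightarrow> real) \<Rightarrow> ('a \<Rightarrow> real) \<Rightarrow> real \<Rightarrow> 'a play \<Rightarrow> real" where
  "payoff F f \<epsilon> h = F (pos h) + \<epsilon>\<^sup>2 * running_sum f h"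

definition legal_moves :: "'a::metric_space set \<Rightarrow> real \<Rightarrow> 'a play \<Rightarrow> 'a set" where
  "legal_moves X \<epsilon> h = {y \<in> X. dist y (pos h) < \<epsilon>}"

primrec legal_play :: "'a::metric_space set \<Rightarrow> 'a set \<Rightarrow> real \<Rightarrow> 'a play \<Rightarrow> bool" where
  "legal_play X Y \<epsilon> (Start x) \<longleftrightarrow> x \<in> X"
| "legal_play X Y \<epsilon> (Turn h c y) \<longleftrightarrow>
     legal_play X Y \<epsilon> h \<and> pos h \<notin> Y \<and> y \<in> legal_moves X \<epsilon> h"

text \<open>
  Strategies may be randomized. Distributions on moves are discrete, which makes the law of the
  game well defined for every pair of strategies with no measurability condition on the
  dependence on the history; deterministic strategies are those with values of the form
  \<^term>\<open>return_pmf y\<close>.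
\<close>

definition strategies ::
  "'a::metric_space set \<Rightarrow> 'a set \<Rightarrow> real \<Rightarrow> ('a play \<Rightarrow> 'a pmf) set" where
  "strategies X Y \<epsilon> =
     {S. \<forall>h. legal_play X Y \<epsilon> h \<and> pos h \<notin> Y \<longrightarrow> set_pmf (S h) \<subseteq> legal_moves X \<epsilon> h}"

text \<open>The law of the history after \<open>n\<close> turns; a game that has ended stays as it is.\<close>

primrec play_after ::
  "'a set \<Rightarrow> ('a play \<Rightarrow> 'a pmf) \<Rightarrow> ('a play \<Rightarrow> 'a pmf) \<Rightarrow> 'a \<Rightarrow> nat \<Rightarrow> 'a play pmf" where
  "play_after Y SI SII x 0 = return_pmf (Start x)"
| "play_after Y SI SII x (Suc n) =
     bind_pmf (play_after Y SI SII x n) (\<lambda>h.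
       if pos h \<in> Y then return_pmf h
       else bind_pmf (bernoulli_pmf (1/2)) (\<lambda>c.
         map_pmf (Turn h c) (if c then SI h else SII h)))"

text \<open>
  The law of the completed game, a measure on the plays that have reached \<open>Y\<close>. The game ends
  with history \<open>h\<close> iff its history after \<^term>\<open>turns h\<close> turns is \<open>h\<close>. The total mass is the
  probability that the game terminates.
\<close>

definition terminal_law ::
  "'a set \<Rightarrow> ('a play \<Rightarrow> 'a pmf) \<Rightarrow> ('a play \<Rightarrow> 'a pmf) \<Rightarrow> 'a \<Rightarrow> 'a play measure" where
  "terminal_law Y SI SII x =
     density (count_space {h. pos h \<in> Y}) (\<lambda>h. ennreal (pmf (play_after Y SI SII x (turns h)) h))"

definition ext_expectation_exists :: "'b measure \<Rightarrow> ('b \<Rightarrow> real) \<Rightarrow> bool" where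
  "ext_expectation_exists M g \<longleftrightarrow>
     g \<in> borel_measurable M \<and>
     ((\<integral>\<^sup>+h. ennreal (g h) \<partial>M) < \<infinity> \<or> (\<integral>\<^sup>+h. ennreal (- g h) \<partial>M) < \<infinity>)"

definition ext_expectation :: "'b measure \<Rightarrow> ('b \<Rightarrow> real) \<Rightarrow> ereal" where
  \<comment> \<open>\<^term>\<open>ennreal\<close> truncates negative numbers to 0: positive part minus negative part\<close>
  "ext_expectation M g =
     enn2ereal (\<integral>\<^sup>+h. ennreal (g h) \<partial>M) - enn2ereal (\<integral>\<^sup>+h. ennreal (- g h) \<partial>M)"

definition outcome_defined ::
  "'a set \<Rightarrow> ('a \<Rightarrow> real) \<Rightarrow> ('a \<Rightarrow> real) \<Rightarrow> real \<Rightarrow> 'a \<Rightarrow>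
     ('a play \<Rightarrow> 'a pmf) \<Rightarrow> ('a play \<Rightarrow> 'a pmf) \<Rightarrow> bool" where
  "outcome_defined Y F f \<epsilon> x SI SII \<longleftrightarrow>
     prob_space (terminal_law Y SI SII x) \<and>
     ext_expectation_exists (terminal_law Y SI SII x) (payoff F f \<epsilon>)"

definition F_minus ::
  "'a set \<Rightarrow> ('a \<Rightarrow> real) \<Rightarrow> ('a \<Rightarrow> real) \<Rightarrow> real \<Rightarrow> 'a \<Rightarrow>
     ('a play \<Rightarrow> 'a pmf) \<Rightarrow> ('a play \<Rightarrow> 'a pmf) \<Rightarrow> ereal" where
  "F_minus Y F f \<epsilon> x SI SII =
     (if outcome_defined Y F f \<epsilon> x SI SII
      then ext_expectation (terminal_law Y SI SII x) (payoff F f \<epsilon>) else -\<infinity>)"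

definition F_plus ::
  "'a set \<Rightarrow> ('a \<Rightarrow> real) \<Rightarrow> ('a \<Rightarrow> real) \<Rightarrow> real \<Rightarrow> 'a \<Rightarrow>
     ('a play \<Rightarrow> 'a pmf) \<Rightarrow> ('a play \<Rightarrow> 'a pmf) \<Rightarrow> ereal" where
  "F_plus Y F f \<epsilon> x SI SII =
     (if outcome_defined Y F f \<epsilon> x SI SII
      then ext_expectation (terminal_law Y SI SII x) (payoff F f \<epsilon>) else \<infinity>)"

definition value_I ::
  "'a::metric_space set \<Rightarrow> 'a set \<Rightarrow> ('a \<Rightarrow> real) \<Rightarrow> ('a \<Rightarrow> real) \<Rightarrow> real \<Rightarrow> 'a \<Rightarrow> ereal" where
  "value_I X Y F f \<epsilon> x =
     (SUP SI\<in>strategies X Y \<epsilon>. INF SII\<in>strategies X Y \<epsilon>. F_minus Y F f \<epsilon> x SI SII)"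

definition value_II ::
  "'a::metric_space set \<Rightarrow> 'a set \<Rightarrow> ('a \<Rightarrow> real) \<Rightarrow> ('a \<Rightarrow> real) \<Rightarrow> real \<Rightarrow> 'a \<Rightarrow> ereal" where
  "value_II X Y F f \<epsilon> x =
     (INF SII\<in>strategies X Y \<epsilon>. SUP SI\<in>strategies X Y \<epsilon>. F_plus Y F f \<epsilon> x SI SII)"

text \<open>\<open>u\<close> is the continuum value of \<open>(X, dist, Y, F, f)\<close>; only its restriction to \<open>X\<close> matters.\<close>

definition is_continuum_value ::
  "'a::metric_space set \<Rightarrow> 'a set \<Rightarrow> ('a \<Rightarrow> real) \<Rightarrow> ('a \<Rightarrow> real) \<Rightarrow> ('a \<Rightarrow> real) \<Rightarrow> bool" where
  "is_continuum_value X Y F f u \<longleftrightarrow>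
     (\<forall>\<epsilon>>0. \<forall>x\<in>X. value_I X Y F f \<epsilon> x = value_II X Y F f \<epsilon> x) \<and>
     (\<forall>x\<in>X. ((\<lambda>\<epsilon>. value_I X Y F f \<epsilon> x) \<longlongrightarrow> ereal (u x)) (at_right 0))"

end

theory Submission
  imports Defs
begin

text \<open>
  For fixed \<open>e\<close> the dynamic programming equation \<open>u x = (sup u + inf u) / 2 + e\<^sup>2 f x\<close>, with supremum and infimum
  over the moves from \<open>x\<close>, has a unique bounded solution \<open>u\<^sub>e\<close> with boundary values \<open>F\<close>, and it is
  the value of the game. If \<open>inf f > 0\<close>, uniqueness follows by scaling. If \<open>f = 0\<close>, one walks uphill from a point
  where the difference of two solutions is almost maximal: the increments do not decrease, so
  they are small, hence the difference is almost maximal at all neighbours and, after boundedly many steps, on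
  the boundary. The case \<open>f = 0\<close> of the game is reduced to small constant \<open>f\<close> of either sign, which forces termination.

  If \<open>v\<close> is a viscosity subsolution, comparison with the functions \<open>a + b r - q r\<^sup>2\<close> of the distance \<open>r\<close> to
  a point shows that \<open>sup v\<close> over the ball of radius \<open>e\<close> around \<open>x\<close> is a subsolution of the dynamic programming
  equation, up to an error that is absorbed by scaling \<open>u\<^sub>e\<close> if \<open>inf f > 0\<close> and that is absent if \<open>f = 0\<close>. Hence
  \<open>v \<le> u\<^sub>e + o(1)\<close>. This applies to every solution, which gives uniqueness and convergence, and to the relaxed upper
  and lower limits of \<open>u\<^sub>e\<close>, which are therefore equal and give existence.
\<close>

section \<open>The dynamic programming equation\<close>

text \<open>The midrange of a smooth function over a ball of radius \<open>e\<close> differs from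
  its central value by about \<open>e\<^sup>2 / 2\<close> times the infinity Laplacian, whence the
  right-hand side \<open>- 2 f\<close>. A play that never ends counts against each player's
  guarantee, so a good strategy must also force the end. A minimizing player gets this from
  \<open>f \<ge> c > 0\<close>, since delay costs. A maximizing player does not, since delay pays;
  this player maximizes up to a horizon and then heads for the boundary. A viscosity subsolution is
  turned into a discrete one by an inequality that imitates a turn: if \<open>S\<close> bounds
  \<open>v\<close> on the ball of radius \<open>2 e\<close> around \<open>x\<close> and
  \<open>f < q\<close> there, then \<open>v \<le> (S + v x) / 2 + e\<^sup>2 q\<close> on the ball of
  radius \<open>e\<close>. No equicontinuity of \<open>u\<^sub>e\<close> inside the domain is used.
  Barriers at the boundary are the only uniform control, which is why limits are taken in the
  relaxed sense.\<close>

definition nb :: "'a::metric_space set \<Rightarrow> real \<Rightarrow> 'a \<Rightarrow> 'a set" where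
  "nb X e x = {y \<in> X. dist y x < e}"

definition midrange :: "'a::metric_space set \<Rightarrow> real \<Rightarrow> ('a \<Rightarrow> real) \<Rightarrow> 'a \<Rightarrow> real" where
  "midrange X e w x = (Sup (w ` nb X e x) + Inf (w ` nb X e x)) / 2"

lemma midrange_double: "2 * midrange X e w x = Sup (w ` nb X e x) + Inf (w ` nb X e x)"
  by (simp add: midrange_def)

lemma nb_self: "0 < e \<Longrightarrow> x \<in> X \<Longrightarrow> x \<in> nb X e x"
  by (simp add: nb_def)

lemma nb_sub: "nb X e x \<subseteq> X"
  by (auto simp: nb_def)

lemma nb_sym: "y \<in> nb X e x \<Longrightarrow> x \<in> X \<Longrightarrow> x \<in> nb X e y"
  by (auto simp: nb_def dist_commute)

lemma bounded_image_realI: "(\<And>x. x \<in> X \<Longrightarrow> \<bar>w x\<bar> \<le> R) \<Longrightarrow> bounded (w ` X)" for w :: "'a \<Rightarrow> real"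
  by (auto simp: bounded_iff)

lemma bdd_nb:
  fixes w :: "'a::metric_space \<Rightarrow> real"
  assumes "bounded (w ` X)"
  shows "bdd_above (w ` nb X e x)" "bdd_below (w ` nb X e x)"
  using assms nb_sub[of X e x]
  by (meson bounded_imp_bdd_above bounded_imp_bdd_below bdd_above_mono bdd_below_mono image_mono)+

lemma Sup_nb_ge: "bounded (w ` X) \<Longrightarrow> y \<in> nb X e x \<Longrightarrow> w y \<le> Sup (w ` nb X e x)"
  for w :: "'a::metric_space \<Rightarrow> real"
  by (simp add: bdd_nb cSUP_upper)

lemma Inf_nb_le: "bounded (w ` X) \<Longrightarrow> y \<in> nb X e x \<Longrightarrow> Inf (w ` nb X e x) \<le> w y"
  for w :: "'a::metric_space \<Rightarrow> real"
  by (simp add: bdd_nb cINF_lower)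

lemma Sup_nb_le: "0 < e \<Longrightarrow> x \<in> X \<Longrightarrow> (\<And>y. y \<in> nb X e x \<Longrightarrow> w y \<le> c) \<Longrightarrow> Sup (w ` nb X e x) \<le> c"
  for w :: "'a::metric_space \<Rightarrow> real"
  by (rule cSUP_least) (use nb_self[of e x X] in auto)

lemma Inf_nb_ge: "0 < e \<Longrightarrow> x \<in> X \<Longrightarrow> (\<And>y. y \<in> nb X e x \<Longrightarrow> c \<le> w y) \<Longrightarrow> c \<le> Inf (w ` nb X e x)"
  for w :: "'a::metric_space \<Rightarrow> real"
  by (rule cINF_greatest) (use nb_self[of e x X] in auto)

lemma Sup_nb_shift:
  fixes u v :: "'a::metric_space \<Rightarrow> real"
  assumes "0 < e" "x \<in> X" "bounded (v ` X)" "\<And>y. y \<in> nb X e x \<Longrightarrow> u y \<le> v y + M"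
  shows "Sup (u ` nb X e x) \<le> Sup (v ` nb X e x) + M"
  by (rule Sup_nb_le[OF assms(1,2)]) (use assms Sup_nb_ge[OF assms(3)] in fastforce)

lemma Inf_nb_shift:
  fixes u v :: "'a::metric_space \<Rightarrow> real"
  assumes "0 < e" "x \<in> X" "bounded (u ` X)" "\<And>y. y \<in> nb X e x \<Longrightarrow> u y \<le> v y + M"
  shows "Inf (u ` nb X e x) \<le> Inf (v ` nb X e x) + M"
proof -
  have "Inf (u ` nb X e x) - M \<le> Inf (v ` nb X e x)"
    by (rule Inf_nb_ge[OF assms(1,2)]) (use assms Inf_nb_le[OF assms(3)] in fastforce)
  then show ?thesis by simp
qed

lemma midrange_shift:
  fixes u v :: "'a::metric_space \<Rightarrow> real"
  assumes "0 < e" "x \<in> X" "bounded (u ` X)" "bounded (v ` X)" "\<And>y. y \<in> nb X e x \<Longrightarrow> u y \<le> v y + M"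
  shows "midrange X e u x \<le> midrange X e v x + M"
  using Sup_nb_shift[OF assms(1,2,4,5)] Inf_nb_shift[OF assms(1,2,3,5)] by (simp add: midrange_def field_simps)

lemma midrange_uminus: "midrange X e (\<lambda>y. - w y) x = - midrange X e w x"
proof -
  have "Inf ((\<lambda>y. - w y) ` nb X e x) = - Sup (w ` nb X e x)"
    by (simp add: Inf_real_def image_image)
  moreover have "Inf (w ` nb X e x) = - Sup ((\<lambda>y. - w y) ` nb X e x)"
    by (simp add: Inf_real_def image_image)
  ultimately show ?thesis
    using midrange_double[of X e "\<lambda>y. - w y" x] midrange_double[of X e w x] by linarith
qed

lemma bounded_cmult_image: "bounded (w ` X) \<Longrightarrow> bounded ((\<lambda>y. c * w y) ` X)" for w :: "'a \<Rightarrow> real"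
  using bounded_scaling[of "w ` X" c] by (simp add: image_image)

lemma bounded_add_const_image: "bounded (w ` X) \<Longrightarrow> bounded ((\<lambda>y. w y + c) ` X)" for w :: "'a \<Rightarrow> real"
  using bounded_translation[of "w ` X" c] by (simp add: image_image add.commute)

lemma bounded_uminus_image: "bounded (w ` X) \<Longrightarrow> bounded ((\<lambda>y. - w y) ` X)" for w :: "'a \<Rightarrow> real"
  using bounded_uminus[of "w ` X"] by (simp add: image_image)

lemma midrange_cmult:
  fixes w :: "'a::metric_space \<Rightarrow> real"
  assumes "0 < e" "x \<in> X" "bounded (w ` X)" "0 < c"
  shows "midrange X e (\<lambda>y. c * w y) x = c * midrange X e w x"
proof -
  have S: "Sup ((\<lambda>y. c * w y) ` nb X e x) = c * Sup (w ` nb X e x)"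
  proof (rule antisym)
    show "Sup ((\<lambda>y. c * w y) ` nb X e x) \<le> c * Sup (w ` nb X e x)"
      by (rule Sup_nb_le) (use assms Sup_nb_ge[OF assms(3)] in auto)
    have "Sup (w ` nb X e x) \<le> Sup ((\<lambda>y. c * w y) ` nb X e x) / c"
      by (rule Sup_nb_le)
        (use assms Sup_nb_ge[OF bounded_cmult_image[OF assms(3)], of _ e x c] in \<open>auto simp: field_simps\<close>)
    then show "c * Sup (w ` nb X e x) \<le> Sup ((\<lambda>y. c * w y) ` nb X e x)"
      using assms(4) by (simp add: field_simps)
  qed
  have I: "Inf ((\<lambda>y. c * w y) ` nb X e x) = c * Inf (w ` nb X e x)"
  proof (rule antisym)
    show "c * Inf (w ` nb X e x) \<le> Inf ((\<lambda>y. c * w y) ` nb X e x)"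
      by (rule Inf_nb_ge) (use assms Inf_nb_le[OF assms(3)] in auto)
    have "Inf ((\<lambda>y. c * w y) ` nb X e x) / c \<le> Inf (w ` nb X e x)"
      by (rule Inf_nb_ge)
        (use assms Inf_nb_le[OF bounded_cmult_image[OF assms(3)], of _ e x c] in \<open>auto simp: field_simps\<close>)
    then show "Inf ((\<lambda>y. c * w y) ` nb X e x) \<le> c * Inf (w ` nb X e x)"
      using assms(4) by (simp add: field_simps)
  qed
  show ?thesis by (simp add: midrange_def S I distrib_left)
qed

lemma midrange_add_const:
  fixes w :: "'a::metric_space \<Rightarrow> real"
  assumes "0 < e" "x \<in> X" "bounded (w ` X)"
  shows "midrange X e (\<lambda>y. w y + c) x = midrange X e w x + c"
proof (rule antisym)
  show "midrange X e (\<lambda>y. w y + c) x \<le> midrange X e w x + c"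
    by (rule midrange_shift) (use assms bounded_add_const_image in auto)
  have "midrange X e w x \<le> midrange X e (\<lambda>y. w y + c) x + - c"
    by (rule midrange_shift) (use assms bounded_add_const_image in auto)
  then show "midrange X e w x + c \<le> midrange X e (\<lambda>y. w y + c) x" by simp
qed

section \<open>Comparison principles for the discrete equation\<close>

lemma strict_comparison:
  fixes u v :: "'a::metric_space \<Rightarrow> real"
  assumes e: "0 < e" and bu: "bounded (u ` X)" and bv: "bounded (v ` X)" and k: "0 < k"
    and u: "\<And>x. x \<in> X - Y \<Longrightarrow> u x \<le> midrange X e u x + g1 x"
    and v: "\<And>x. x \<in> X - Y \<Longrightarrow> midrange X e v x + g2 x \<le> v x"
    and g: "\<And>x. x \<in> X - Y \<Longrightarrow> g1 x + k \<le> g2 x"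
    and Y: "\<And>x. x \<in> Y \<inter> X \<Longrightarrow> u x \<le> v x" and x: "x \<in> X"
  shows "u x \<le> v x"
proof (rule ccontr)
  define M where "M = (SUP x\<in>X. u x - v x)"
  obtain A where A: "\<And>x. x \<in> X \<Longrightarrow> \<bar>u x\<bar> \<le> A" using bu by (auto simp: bounded_iff)
  obtain B where B: "\<And>x. x \<in> X \<Longrightarrow> \<bar>v x\<bar> \<le> B" using bv by (auto simp: bounded_iff)
  have bd: "bdd_above ((\<lambda>x. u x - v x) ` X)"
  proof (rule bdd_aboveI2)
    fix x assume "x \<in> X"
    then show "u x - v x \<le> A + B" using A[of x] B[of x] by linarith
  qed
  have le: "u y \<le> v y + M" if "y \<in> X" for y
    using cSUP_upper[OF that bd] by (simp add: M_def)
  assume "\<not> u x \<le> v x"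
  then have "M > 0" using le[OF x] by simp
  \<comment> \<open>An almost maximal point \<open>y\<close> of \<open>u - v\<close> suffices, so
    the supremum need not be attained: the two inequalities bound the difference at \<open>y\<close>
    by \<open>M - k\<close>, which contradicts \<open>d \<le> k / 2\<close>, while
    \<open>d \<le> M / 2\<close> keeps the difference positive and thus \<open>y\<close> outside
    \<open>Y\<close>.\<close>
  define d where "d = min M k / 2"
  have "M - d < M" using \<open>M > 0\<close> k by (simp add: d_def)
  then obtain y where y: "y \<in> X" "M - d < u y - v y"
    using x unfolding M_def by (subst (asm) less_cSUP_iff) (use bd in auto)
  have "y \<notin> Y" using y Y[of y] \<open>M > 0\<close> by (auto simp: d_def)
  then have yy: "y \<in> X - Y" using y by auto
  have "midrange X e u y \<le> midrange X e v y + M"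
    by (rule midrange_shift[OF e y(1) bu bv]) (use le nb_sub[of X e y] in auto)
  then show False using u[OF yy] v[OF yy] g[OF yy] y k by (auto simp: d_def min_def split: if_splits)
qed

text \<open>If \<open>u - v\<close> is within \<open>d\<close> of its bound \<open>M\<close> at
  \<open>x\<close>, it is within \<open>5 * d\<close> of it at a neighbour \<open>y\<close> where
  \<open>u\<close> nearly attains its supremum. Since \<open>x\<close> is in turn a neighbour of
  \<open>y\<close>, the subsolution inequality at \<open>y\<close> offers a next increment of at
  least \<open>a - 3 * d\<close>. A factor 10 per step covers both kinds of loss.\<close>

lemma uphill_chain:
  fixes u v :: "'a::metric_space \<Rightarrow> real"
  assumes e: "0 < e" and bu: "bounded (u ` X)" and bv: "bounded (v ` X)"
    and u: "\<And>x. x \<in> X - Y \<Longrightarrow> u x \<le> midrange X e u x + s"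
    and v: "\<And>x. x \<in> X - Y \<Longrightarrow> midrange X e v x \<le> v x"
    and Y: "\<And>x. x \<in> Y \<inter> X \<Longrightarrow> u x \<le> v x"
    and le: "\<And>x. x \<in> X \<Longrightarrow> u x \<le> v x + M"
  shows "\<lbrakk>0 < d; s \<le> d; 10 ^ k * d < M; x \<in> X; M - d \<le> u x - v x; a \<le> Sup (u ` nb X e x) - u x\<rbrakk>
    \<Longrightarrow> \<exists>y\<in>X. u x + real k * a - 10 ^ k * d \<le> u y"
proof (induction k arbitrary: d x a)
  case 0
  then show ?case by (intro bexI[of _ x]) auto
next
  case (Suc k)
  have dM: "d < M"
    using Suc.prems(1,3) one_le_power[of "10::real" "Suc k"] mult_right_mono[of 1 "10 ^ Suc k" d] by linarith
  then have xY: "x \<in> X - Y" using Suc.prems Y[of x] by auto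
  define Su where "Su = Sup (u ` nb X e x)"
  define Iu where "Iu = Inf (u ` nb X e x)"
  define Sv where "Sv = Sup (v ` nb X e x)"
  define Iv where "Iv = Inf (v ` nb X e x)"
  have S: "Su \<le> Sv + M" unfolding Su_def Sv_def
    by (rule Sup_nb_shift[OF e Suc.prems(4) bv]) (use le nb_sub in blast)
  have I: "Iu \<le> Iv + M" unfolding Iu_def Iv_def
    by (rule Inf_nb_shift[OF e Suc.prems(4) bu]) (use le nb_sub in blast)
  have ux: "2 * u x \<le> Su + Iu + 2 * s" using u[OF xY] midrange_double[of X e u x] by (simp add: Su_def Iu_def)
  have vx: "Sv + Iv \<le> 2 * v x" using v[OF xY] midrange_double[of X e v x] by (simp add: Sv_def Iv_def)
  \<comment> \<open>The suprema of \<open>u\<close> and \<open>v\<close> must differ by almost all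
    of \<open>M\<close>: a smaller gap could not be made up by the infima, whose gap is at most
    \<open>M\<close> too.\<close>
  have Sv: "Sv \<le> Su - M + 4 * d" using S I ux vx Suc.prems by linarith
  have "Su - d < Su" using Suc.prems by simp
  then obtain y where y: "y \<in> nb X e x" "Su - d < u y"
    unfolding Su_def using nb_self[OF e Suc.prems(4)] less_cSUP_iff[OF _ bdd_nb(1)[OF bu]]
    by (metis empty_iff)
  have yX: "y \<in> X" using y nb_sub by blast
  have "v y \<le> Sv" unfolding Sv_def by (rule Sup_nb_ge[OF bv y(1)])
  then have uvy: "M - 5 * d \<le> u y - v y" using Sv y by linarith
  have big: "10 ^ k * (5 * d) < M" "5 * d < M"
  proof -
    have "5 * (10 ^ k * d) \<le> 10 * (10 ^ k * d)" using Suc.prems(1) by simp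
    then show "10 ^ k * (5 * d) < M" using Suc.prems(3) by (simp add: algebra_simps)
    moreover have "5 * d \<le> 10 ^ k * (5 * d)"
      using Suc.prems(1) one_le_power[of "10::real" k] by simp
    ultimately show "5 * d < M" by linarith
  qed
  have yY: "y \<in> X - Y" using uvy big Y[of y] yX by auto
  \<comment> \<open>The infimum around \<open>y\<close> is at most the value at \<open>x\<close>, so
    the rise from \<open>x\<close> to \<open>y\<close> is nearly available again above
    \<open>y\<close>.\<close>
  have "Inf (u ` nb X e y) \<le> u x"
    by (rule Inf_nb_le[OF bu nb_sym[OF y(1) Suc.prems(4)]])
  moreover have "2 * u y \<le> Sup (u ` nb X e y) + Inf (u ` nb X e y) + 2 * s"
    using u[OF yY] midrange_double[of X e u y] by simp
  ultimately have inc: "a - 3 * d \<le> Sup (u ` nb X e y) - u y"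
    using y Suc.prems unfolding Su_def by linarith
  obtain z where z: "z \<in> X" "u y + real k * (a - 3 * d) - 10 ^ k * (5 * d) \<le> u z"
    using Suc.IH[of "5 * d" y "a - 3 * d"] Suc.prems big uvy yX inc by auto
  have "1 + 3 * real k \<le> 5 * 10 ^ k"
    by (induction k) auto
  then have "(1 + 3 * real k) * d \<le> 5 * 10 ^ k * d" using Suc.prems(1) by (intro mult_right_mono) auto
  then have "u x + real (Suc k) * a - 10 ^ Suc k * d \<le> u z"
    using z y Suc.prems unfolding Su_def by (simp add: algebra_simps)
  then show ?case using z by blast
qed

text \<open>The hypotheses get a name so that the tolerances in the following lemmas can be chosen
  before the functions, the boundary set, the error \<open>s\<close> and the bound
  \<open>M\<close>.\<close>

definition comparison_pair ::
  "'a::metric_space set \<Rightarrow> 'a set \<Rightarrow> real \<Rightarrow> real \<Rightarrow> ('a \<Rightarrow> real) \<Rightarrow> ('a \<Rightarrow> real) \<Rightarrow> real \<Rightarrow> real \<Rightarrow> bool" where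
  "comparison_pair X Y e R u v s M \<longleftrightarrow> 0 < e \<and> (\<forall>x\<in>X. \<bar>u x\<bar> \<le> R) \<and> bounded (v ` X) \<and>
     (\<forall>x\<in>X - Y. u x \<le> midrange X e u x + s) \<and> (\<forall>x\<in>X - Y. midrange X e v x \<le> v x) \<and>
     (\<forall>x\<in>Y \<inter> X. u x \<le> v x) \<and> (\<forall>x\<in>X. u x \<le> v x + M)"

text \<open>A chain of \<open>k\<close> uphill steps of size \<open>a\<close> would exceed the
  oscillation \<open>2 * R\<close> of \<open>u\<close>, so \<open>u\<close> rises by less than
  \<open>a\<close> around \<open>x\<close>. By the subsolution inequality it can then hardly fall
  either. Hence the difference is almost maximal at every neighbour, not only at the highest
  one.\<close>

lemma nearly_maximal_neighbours:
  fixes R m d' :: real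
  assumes "0 < m" "0 < d'" "d' < m" "0 \<le> R"
  shows "\<exists>d>0. d \<le> d' \<and> (\<forall>e s X Y M x y. \<forall>u v :: 'a::metric_space \<Rightarrow> real.
    comparison_pair X Y e R u v s M \<longrightarrow> m \<le> M \<longrightarrow> s \<le> d \<longrightarrow> x \<in> X \<longrightarrow> M - d \<le> u x - v x \<longrightarrow>
    y \<in> nb X e x \<longrightarrow> M - d' \<le> u y - v y)"
proof -
  \<comment> \<open>The loss at a neighbour is at most \<open>2 * a + 6 * d\<close>, so
    \<open>a\<close> and \<open>d\<close> of at most \<open>d' / 8\<close> suffice. The power of 10
    in \<open>d\<close> below is the error of a chain of length \<open>k\<close>.\<close>
  define a where "a = d' / 8"
  have a: "0 < a" using assms by (simp add: a_def)
  obtain k :: nat where k: "(2 * R + m) / a < real k" using reals_Archimedean2 by blast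
  define d where "d = d' / (8 * 10 ^ k)"
  have kd: "10 ^ k * d = d' / 8" by (simp add: d_def)
  have d: "0 < d" using assms by (simp add: d_def)
  have "d \<le> 10 ^ k * d" using d one_le_power[of "10::real" k] by simp
  then have d8: "d \<le> d' / 8" using kd by simp
  have main: "M - d' \<le> u y - v y"
    if cp: "comparison_pair X Y e R u v s M" and mM: "m \<le> M" and s: "s \<le> d"
      and x: "x \<in> X" and near: "M - d \<le> u x - v x" and y: "y \<in> nb X e x"
    for e s X Y M x y and u v :: "'a \<Rightarrow> real"
  proof -
    have e: "0 < e" and R: "\<And>x. x \<in> X \<Longrightarrow> \<bar>u x\<bar> \<le> R" and bv: "bounded (v ` X)"
      and u: "\<And>x. x \<in> X - Y \<Longrightarrow> u x \<le> midrange X e u x + s"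
      and v: "\<And>x. x \<in> X - Y \<Longrightarrow> midrange X e v x \<le> v x"
      and Y: "\<And>x. x \<in> Y \<inter> X \<Longrightarrow> u x \<le> v x"
      and le: "\<And>x. x \<in> X \<Longrightarrow> u x \<le> v x + M"
      using cp by (auto simp: comparison_pair_def)
    have bu: "bounded (u ` X)" by (rule bounded_image_realI) (rule R)
    define Su where "Su = Sup (u ` nb X e x)"
    define Iu where "Iu = Inf (u ` nb X e x)"
    define Sv where "Sv = Sup (v ` nb X e x)"
    define Iv where "Iv = Inf (v ` nb X e x)"
    have inc: "Su - u x < a"
    proof (rule ccontr)
      assume "\<not> Su - u x < a"
      then obtain z where z: "z \<in> X" "u x + real k * a - 10 ^ k * d \<le> u z"
        using uphill_chain[OF e bu bv u v Y le d s _ x near, of Y k a] kd mM assms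
        unfolding Su_def by force
      have "real k * a > 2 * R + m" using k a by (simp add: field_simps)
      then show False using R[OF x] R[OF z(1)] z(2) kd assms by linarith
    qed
    have xY: "x \<in> X - Y" using near x Y[of x] d8 mM assms by force
    have S: "Su \<le> Sv + M" unfolding Su_def Sv_def
      by (rule Sup_nb_shift[OF e x bv]) (use le nb_sub in blast)
    have I: "Iu \<le> Iv + M" unfolding Iu_def Iv_def
      by (rule Inf_nb_shift[OF e x bu]) (use le nb_sub in blast)
    have ux: "2 * u x \<le> Su + Iu + 2 * s" using u[OF xY] midrange_double[of X e u x] by (simp add: Su_def Iu_def)
    have vx: "Sv + Iv \<le> 2 * v x" using v[OF xY] midrange_double[of X e v x] by (simp add: Sv_def Iv_def)
    have "Sv \<le> Su - M + 4 * d" using S I ux vx near s by linarith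
    moreover have "v y \<le> Sv" unfolding Sv_def by (rule Sup_nb_ge[OF bv y])
    moreover have "Iu \<le> u y" unfolding Iu_def by (rule Inf_nb_le[OF bu y])
    ultimately show ?thesis using inc ux s d8 unfolding a_def by linarith
  qed
  show ?thesis using d d8 assms main by (intro exI[of _ d]) auto
qed

text \<open>The expected time to reach 0 from \<open>k\<close> for the walk that goes from
  \<open>k\<close> to \<open>k - 1\<close> or jumps to \<open>K\<close>, each with probability 1/2;
  that is, the solution of \<open>h k = (h (k - 1) + h K) / 2 + 1\<close> with
  \<open>h 0 = 0\<close>. It bounds the mean length of a game in which one player always lowers a
  hop count and the opponent does the worst.\<close>

definition hop_barrier :: "nat \<Rightarrow> nat \<Rightarrow> real" where
  "hop_barrier K k = 2 ^ (K + 1) * (1 - (1 / 2) ^ k)"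

lemma hop_barrier_mono: "i \<le> j \<Longrightarrow> hop_barrier K i \<le> hop_barrier K j"
  by (simp add: hop_barrier_def power_decreasing)

lemma hop_barrier_nonneg: "0 \<le> hop_barrier K k"
  by (simp add: hop_barrier_def power_le_one)

lemma hop_barrier_le: "hop_barrier K k \<le> 2 ^ (K + 1)"
  by (simp add: hop_barrier_def)

lemma hop_barrier_step:
  assumes "j < k" "k \<le> K"
  shows "(hop_barrier K j + hop_barrier K K) / 2 + 1 \<le> hop_barrier K k"
proof -
  have *: "hop_barrier K K = 2 ^ (K + 1) - 2"
    by (simp add: hop_barrier_def right_diff_distrib power_one_over)
  obtain i where i: "k = Suc i" using assms by (cases k) auto
  have "hop_barrier K j \<le> hop_barrier K i" using assms i by (intro hop_barrier_mono) auto
  moreover have "hop_barrier K i / 2 + 2 ^ K = hop_barrier K k"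
    by (simp add: hop_barrier_def i field_simps)
  ultimately show ?thesis unfolding * by (simp add: field_simps)
qed

text \<open>\<open>N\<close> stands for the geometry of the space: it counts moves towards
  \<open>Y\<close>, so that a player who wins \<open>K\<close> tosses in a row can end the game from
  anywhere. A point of \<open>X\<close> with \<open>N x = 0\<close> lies in
  \<open>Y\<close>.\<close>

locale tug_of_war =
  fixes X Y :: "'a::metric_space set" and e :: real and N :: "'a \<Rightarrow> nat" and K :: nat
  assumes e_pos: "0 < e" and Y_sub: "Y \<subseteq> X" and N_le: "\<And>x. x \<in> X \<Longrightarrow> N x \<le> K"
    and N_descent: "\<And>x. x \<in> X - Y \<Longrightarrow> \<exists>y\<in>nb X e x. N y < N x"
begin

text \<open>Induction on the hop count: on \<open>Y\<close> the difference is not positive, and if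
  it were almost maximal at \<open>x\<close>, it would be so at the neighbour with smaller count.
  Each level gets its own, smaller tolerance. The larger boundary set \<open>Y'\<close> leaves room
  for a boundary layer.\<close>

lemma weak_comparison_aux:
  fixes R m :: real
  assumes m: "0 < m" and R: "0 \<le> R"
  shows "\<exists>d>0. d < m \<and> (\<forall>s Y' M x. \<forall>u v :: 'a \<Rightarrow> real.
       comparison_pair X Y' e R u v s M \<longrightarrow> Y \<subseteq> Y' \<longrightarrow> m \<le> M \<longrightarrow> s \<le> d \<longrightarrow>
        x \<in> X \<longrightarrow> N x \<le> j \<longrightarrow> u x - v x < M - d)"
proof (induction j)
  case 0
  have Y: "x \<in> Y" if "x \<in> X" "N x \<le> 0" for x
    using N_descent[of x] that by force
  have "u x - v x < M - m / 2" if "comparison_pair X Y' e R u v s M" "Y \<subseteq> Y'" "m \<le> M"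
    "x \<in> X" "N x \<le> 0" for x Y' s M and u v :: "'a \<Rightarrow> real"
  proof -
    have "u x \<le> v x" using Y[OF that(4,5)] that(1,2,4) by (auto simp: comparison_pair_def)
    then show ?thesis using m that(3) by simp
  qed
  then show ?case by (intro exI[of _ "m / 2"]) (use m in auto)
next
  case (Suc j)
  then obtain d' where d': "0 < d'" "d' < m" and IH: "\<And>s Y' M x. \<And>u v :: 'a \<Rightarrow> real.
     \<lbrakk>comparison_pair X Y' e R u v s M; Y \<subseteq> Y'; m \<le> M; s \<le> d'; x \<in> X; N x \<le> j\<rbrakk> \<Longrightarrow> u x - v x < M - d'"
    by blast
  obtain d where d: "0 < d" "d \<le> d'" and step: "\<And>e s X Y M x y. \<And>u v :: 'a \<Rightarrow> real.
     \<lbrakk>comparison_pair X Y e R u v s M; m \<le> M; s \<le> d; x \<in> X; M - d \<le> u x - v x; y \<in> nb X e x\<rbrakk>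
       \<Longrightarrow> M - d' \<le> u y - v y"
    using nearly_maximal_neighbours[OF m d' R, where 'a = 'a] by blast
  show ?case
  proof (intro exI[of _ d] conjI allI impI)
    fix s Y' M x and u v :: "'a \<Rightarrow> real"
    assume H: "comparison_pair X Y' e R u v s M" "Y \<subseteq> Y'" "m \<le> M" "s \<le> d"
      and x: "x \<in> X" "N x \<le> Suc j"
    show "u x - v x < M - d"
    proof (rule ccontr)
      assume n: "\<not> u x - v x < M - d"
      have "u x \<le> v x" if "x \<in> Y" using H(1,2) that x(1) by (auto simp: comparison_pair_def)
      then have "x \<notin> Y" using n H(3) d d' by auto
      then obtain y where y: "y \<in> nb X e x" "N y < N x" using N_descent x by blast
      have "M - d' \<le> u y - v y"
        by (rule step[OF H(1,3,4) x(1) _ y(1)]) (use n in auto)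
      moreover have "u y - v y < M - d'"
        by (rule IH[OF H(1-3)]) (use H d y x nb_sub[of X e x] in auto)
      ultimately show False by simp
    qed
  qed (use d d' in auto)
qed

text \<open>Level \<open>K\<close> of the induction covers all of \<open>X\<close>, so a supremum
  \<open>M \<ge> m\<close> of the difference would be at most \<open>M - d\<close>. The error
  \<open>s\<close> up to \<open>d\<close> lets a small running payoff enter the equation of
  \<open>u\<close>.\<close>

lemma weak_comparison:
  fixes R m :: real
  assumes m: "0 < m" and R: "0 \<le> R"
  obtains d where "0 < d"
    "\<And>s Y' x. \<And>u v :: 'a \<Rightarrow> real.
       \<lbrakk>\<And>x. x \<in> X \<Longrightarrow> \<bar>u x\<bar> \<le> R; bounded (v ` X); Y \<subseteq> Y';
        \<And>x. x \<in> X - Y' \<Longrightarrow> u x \<le> midrange X e u x + s; \<And>x. x \<in> X - Y' \<Longrightarrow> midrange X e v x \<le> v x;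
        \<And>x. x \<in> Y' \<inter> X \<Longrightarrow> u x \<le> v x; s \<le> d; x \<in> X\<rbrakk> \<Longrightarrow> u x \<le> v x + m"
proof -
  obtain d where d: "0 < d" and c: "\<And>s Y' M x. \<And>u v :: 'a \<Rightarrow> real.
       \<lbrakk>comparison_pair X Y' e R u v s M; Y \<subseteq> Y'; m \<le> M; s \<le> d; x \<in> X\<rbrakk> \<Longrightarrow> u x - v x < M - d"
    using weak_comparison_aux[OF assms, of K] N_le by blast
  have "u x \<le> v x + m" if R: "\<And>x. x \<in> X \<Longrightarrow> \<bar>u x\<bar> \<le> R" and bv: "bounded (v ` X)" and Y': "Y \<subseteq> Y'"
      and u: "\<And>x. x \<in> X - Y' \<Longrightarrow> u x \<le> midrange X e u x + s"
      and v: "\<And>x. x \<in> X - Y' \<Longrightarrow> midrange X e v x \<le> v x"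
      and Y: "\<And>x. x \<in> Y' \<inter> X \<Longrightarrow> u x \<le> v x" and s: "s \<le> d" and x: "x \<in> X"
    for s Y' x and u v :: "'a \<Rightarrow> real"
  proof (rule ccontr)
    define M where "M = (SUP x\<in>X. u x - v x)"
    obtain B where B: "\<And>x. x \<in> X \<Longrightarrow> \<bar>v x\<bar> \<le> B" using bv by (auto simp: bounded_iff)
    have bd: "bdd_above ((\<lambda>x. u x - v x) ` X)"
    proof (rule bdd_aboveI2)
      fix x assume "x \<in> X"
      then show "u x - v x \<le> R + B" using R[of x] B[of x] by linarith
    qed
    have le: "u y - v y \<le> M" if "y \<in> X" for y
      using cSUP_upper[OF that bd] by (simp add: M_def)
    assume n: "\<not> u x \<le> v x + m"
    have "u y \<le> v y + M" if "y \<in> X" for y using le[OF that] by simp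
    then have cp: "comparison_pair X Y' e R u v s M"
      using R bv u v Y e_pos by (simp add: comparison_pair_def)
    have "m \<le> M" using le[OF x] n by simp
    have "M \<le> M - d"
      unfolding M_def
    proof (rule cSUP_least)
      show "X \<noteq> {}" using x by auto
      fix y assume "y \<in> X"
      have "u y - v y < M - d"
        by (rule c[OF cp Y' \<open>m \<le> M\<close> s \<open>y \<in> X\<close>])
      then show "u y - v y \<le> (SUP x\<in>X. u x - v x) - d" by (simp add: M_def)
    qed
    then show False using d by simp
  qed
  then show thesis by (rule that[OF d])
qed

text \<open>Perron's method: the monotone operator \<open>T\<close> maps the functions between
  \<open>- B\<close> and \<open>B\<close> into themselves, and the pointwise supremum of those with
  \<open>w \<le> T w\<close> is a fixed point.\<close>

lemma dpp_exists:
  assumes F: "\<And>x. x \<in> Y \<Longrightarrow> \<bar>F x\<bar> \<le> R" and f: "\<And>x. x \<in> X - Y \<Longrightarrow> \<bar>f x\<bar> \<le> G" and "0 \<le> R" "0 \<le> G"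
  obtains u where "\<And>x. x \<in> X \<Longrightarrow> \<bar>u x\<bar> \<le> R + G * 2 ^ (K + 1)" "\<And>x. x \<in> Y \<Longrightarrow> u x = F x"
    "\<And>x. x \<in> X - Y \<Longrightarrow> u x = midrange X e u x + f x"
proof -
  \<comment> \<open>The boundary bound plus \<open>G\<close> per turn over the mean duration of a
    game steered along \<open>N\<close>; \<open>hop_barrier_step\<close> makes \<open>B\<close> a
    supersolution.\<close>
  define B where "B x = R + G * hop_barrier K (N x)" for x
  define T where "T w x = (if x \<in> Y then F x else midrange X e w x + f x)" for w x
  have B0: "0 \<le> B x" for x using assms hop_barrier_nonneg by (simp add: B_def)
  have RB: "R \<le> B x" for x using assms hop_barrier_nonneg by (simp add: B_def)
  have BK: "B x \<le> R + G * hop_barrier K K" if "x \<in> X" for x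
    using assms hop_barrier_mono[OF N_le[OF that], of K] by (simp add: B_def mult_left_mono)
  have B_le: "B x \<le> R + G * 2 ^ (K + 1)" for x
    using assms hop_barrier_le[of K "N x"] unfolding B_def by (intro add_left_mono mult_left_mono) auto
  have bdB: "bounded (B ` X)"
    using B0 B_le by (intro bounded_image_realI[of _ _ "R + G * 2 ^ (K + 1)"]) (simp add: abs_of_nonneg)
  have B_super: "midrange X e B x + G \<le> B x" if x: "x \<in> X - Y" for x
  proof -
    obtain y where y: "y \<in> nb X e x" "N y < N x" using N_descent x by blast
    have "Sup (B ` nb X e x) \<le> R + G * hop_barrier K K"
      by (rule Sup_nb_le[OF e_pos]) (use x BK nb_sub in blast)+
    moreover have "Inf (B ` nb X e x) \<le> R + G * hop_barrier K (N y)"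
      using Inf_nb_le[OF bdB y(1)] by (simp add: B_def)
    moreover have "G * ((hop_barrier K (N y) + hop_barrier K K) / 2 + 1) \<le> G * hop_barrier K (N x)"
      by (intro mult_left_mono hop_barrier_step y assms) (use N_le x in auto)
    ultimately show ?thesis by (simp add: midrange_def B_def field_simps)
  qed
  have bd: "bounded (w ` X)" if "\<forall>x\<in>X. \<bar>w x\<bar> \<le> B x" for w
    by (rule bounded_image_realI[of _ _ "R + G * 2 ^ (K + 1)"]) (use that B_le order_trans in blast)
  have T_mono: "T w x \<le> T w' x" if "\<forall>x\<in>X. \<bar>w x\<bar> \<le> B x" "\<forall>x\<in>X. \<bar>w' x\<bar> \<le> B x" "\<forall>x\<in>X. w x \<le> w' x" "x \<in> X" for w w' x
    using midrange_shift[OF e_pos that(4) bd[OF that(1)] bd[OF that(2)], of 0] that nb_sub[of X e x]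
    by (auto simp: T_def)
  have TB: "T w x \<le> B x" if "\<forall>x\<in>X. \<bar>w x\<bar> \<le> B x" "x \<in> X" for w x
  proof -
    have "T w x \<le> T B x" by (rule T_mono[OF that(1)]) (use that B0 in auto)
    also have "\<dots> \<le> B x"
      using B_super[of x] F[of x] f[of x] RB[of x] that by (auto simp: T_def)
    finally show ?thesis .
  qed
  have TB': "- B x \<le> T w x" if "\<forall>x\<in>X. \<bar>w x\<bar> \<le> B x" "x \<in> X" for w x
  proof -
    have "- B x \<le> T (\<lambda>y. - B y) x"
      using B_super[of x] F[of x] f[of x] RB[of x] that by (auto simp: T_def midrange_uminus)
    also have "\<dots> \<le> T w x" by (rule T_mono) (use that B0 in \<open>auto simp: abs_le_iff minus_le_iff\<close>)
    finally show ?thesis .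
  qed
  define P where "P = {w. \<forall>x\<in>X. \<bar>w x\<bar> \<le> B x \<and> w x \<le> T w x}"
  have P0: "(\<lambda>y. - B y) \<in> P" using TB'[of "\<lambda>y. - B y"] B0 by (auto simp: P_def)
  define u where "u x = (SUP w\<in>P. w x)" for x
  have bda: "bdd_above ((\<lambda>w. w x) ` P)" if "x \<in> X" for x
    by (rule bdd_aboveI2[of _ _ "B x"]) (use that in \<open>auto simp: P_def abs_le_iff\<close>)
  have u_ge: "w x \<le> u x" if "w \<in> P" "x \<in> X" for w x
    unfolding u_def by (rule cSUP_upper2[OF bda[OF that(2)] that(1)]) simp
  have u_le: "u x \<le> c" if "\<And>w. w \<in> P \<Longrightarrow> w x \<le> c" for x c
    unfolding u_def by (rule cSUP_least) (use P0 that in auto)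
  have uB: "\<forall>x\<in>X. \<bar>u x\<bar> \<le> B x"
  proof
    fix x assume "x \<in> X"
    have "u x \<le> B x" by (rule u_le) (use \<open>x \<in> X\<close> in \<open>auto simp: P_def abs_le_iff\<close>)
    then show "\<bar>u x\<bar> \<le> B x" using u_ge[OF P0 \<open>x \<in> X\<close>] by auto
  qed
  have uT: "u x \<le> T u x" if "x \<in> X" for x
  proof (rule u_le)
    fix w assume w: "w \<in> P"
    then have "w x \<le> T w x" using that by (auto simp: P_def)
    also have "\<dots> \<le> T u x" by (rule T_mono) (use w uB u_ge that in \<open>auto simp: P_def\<close>)
    finally show "w x \<le> T u x" .
  qed
  \<comment> \<open>By monotonicity \<open>u \<le> T u\<close> gives
    \<open>T u \<le> T (T u)\<close>. So \<open>T u\<close> competes in the supremum that defines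
    \<open>u\<close>, and \<open>T u \<le> u\<close>.\<close>
  have "T u \<in> P"
  proof -
    have a: "\<forall>x\<in>X. \<bar>T u x\<bar> \<le> B x" using TB[OF uB] TB'[OF uB] by (fastforce simp: abs_le_iff)
    then show ?thesis using T_mono[OF uB a] uT by (auto simp: P_def)
  qed
  then have eq: "u x = T u x" if "x \<in> X" for x
    using u_ge uT that by (meson order_antisym)
  show thesis
  proof (rule that)
    show "\<bar>u x\<bar> \<le> R + G * 2 ^ (K + 1)" if "x \<in> X" for x
      using uB B_le that order_trans by blast
    show "u x = F x" if "x \<in> Y" for x
      using eq[of x] that Y_sub by (auto simp: T_def)
    show "u x = midrange X e u x + f x" if "x \<in> X - Y" for x
      using eq[of x] that by (simp add: T_def)
  qed
qed

end

section \<open>Games\<close>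

lemma legal_moves_eq_nb: "legal_moves X e h = nb X e (pos h)"
  by (simp add: legal_moves_def nb_def)

section \<open>The play as a stochastic process\<close>

lemma turns_play_after: "h \<in> set_pmf (play_after Y SI SII x n) \<Longrightarrow> turns h \<le> n \<and> (pos h \<notin> Y \<longrightarrow> turns h = n)"
proof (induction n arbitrary: h)
  case (Suc n)
  then obtain h' where h': "h' \<in> set_pmf (play_after Y SI SII x n)"
    and h: "h \<in> set_pmf (if pos h' \<in> Y then return_pmf h' else bind_pmf (bernoulli_pmf (1/2)) (\<lambda>c.
         map_pmf (Turn h' c) (if c then SI h' else SII h')))"
    by auto
  show ?case using Suc.IH[OF h'] h by (auto split: if_splits)
qed auto

lemma legal_play_after:
  assumes "SI \<in> strategies X Y e" "SII \<in> strategies X Y e" "x \<in> X"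
  shows "h \<in> set_pmf (play_after Y SI SII x n) \<Longrightarrow> legal_play X Y e h"
proof (induction n arbitrary: h)
  case (Suc n)
  then obtain h' where h': "h' \<in> set_pmf (play_after Y SI SII x n)"
    and h: "h \<in> set_pmf (if pos h' \<in> Y then return_pmf h' else bind_pmf (bernoulli_pmf (1/2)) (\<lambda>c.
         map_pmf (Turn h' c) (if c then SI h' else SII h')))"
    by auto
  have *: "legal_play X Y e h'" by (rule Suc.IH[OF h'])
  show ?case
  proof (cases "pos h' \<in> Y")
    case True
    then show ?thesis using h * by simp
  next
    case False
    then have "set_pmf (SI h') \<subseteq> legal_moves X e h'" "set_pmf (SII h') \<subseteq> legal_moves X e h'"
      using assms * by (auto simp: strategies_def)
    then show ?thesis using h False * by (auto split: if_splits)
  qed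
qed (use assms in auto)

text \<open>The conditional expectation of \<open>L\<close> after one more turn from
  \<open>h\<close>. Values in \<open>ennreal\<close> make it defined without integrability
  conditions; real potentials are first shifted to be nonnegative.\<close>

definition turn_avg :: "('a play \<Rightarrow> 'a pmf) \<Rightarrow> ('a play \<Rightarrow> 'a pmf) \<Rightarrow> ('a play \<Rightarrow> ennreal) \<Rightarrow> 'a play \<Rightarrow> ennreal" where
  "turn_avg SI SII L h = (\<integral>\<^sup>+y. L (Turn h True y) \<partial>SI h) * ennreal (1/2) + (\<integral>\<^sup>+y. L (Turn h False y) \<partial>SII h) * ennreal (1/2)"

lemma nn_integral_play_after_Suc:
  "(\<integral>\<^sup>+h. L h \<partial>play_after Y SI SII x (Suc n)) =
     (\<integral>\<^sup>+h. (if pos h \<in> Y then L h else turn_avg SI SII L h) \<partial>play_after Y SI SII x n)"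
  unfolding play_after.simps nn_integral_bind_pmf
  by (intro nn_integral_cong) (simp add: turn_avg_def nn_integral_bind_pmf)

text \<open>The supermartingale inequality: finished plays are frozen and keep their value of
  \<open>L\<close>, unfinished ones lose on average.\<close>

lemma nn_integral_play_after_le:
  assumes "SI \<in> strategies X Y e" "SII \<in> strategies X Y e" "x \<in> X"
    and "\<And>h. legal_play X Y e h \<Longrightarrow> pos h \<notin> Y \<Longrightarrow> turn_avg SI SII L h \<le> L h"
  shows "(\<integral>\<^sup>+h. L h \<partial>play_after Y SI SII x n) \<le> L (Start x)"
proof (induction n)
  case (Suc n)
  have "(\<integral>\<^sup>+h. L h \<partial>play_after Y SI SII x (Suc n)) \<le> (\<integral>\<^sup>+h. L h \<partial>play_after Y SI SII x n)"
    unfolding nn_integral_play_after_Suc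
    by (intro nn_integral_mono_AE) (use assms legal_play_after[OF assms(1-3)] in \<open>auto simp: AE_measure_pmf_iff\<close>)
  then show ?case using Suc by (rule order_trans)
qed simp

lemma nn_integral_play_after_ge:
  assumes "SI \<in> strategies X Y e" "SII \<in> strategies X Y e" "x \<in> X"
    and "\<And>h. legal_play X Y e h \<Longrightarrow> pos h \<notin> Y \<Longrightarrow> L h \<le> turn_avg SI SII L h"
  shows "L (Start x) \<le> (\<integral>\<^sup>+h. L h \<partial>play_after Y SI SII x n)"
proof (induction n)
  case (Suc n)
  have "(\<integral>\<^sup>+h. L h \<partial>play_after Y SI SII x n) \<le> (\<integral>\<^sup>+h. L h \<partial>play_after Y SI SII x (Suc n))"
    unfolding nn_integral_play_after_Suc
    by (intro nn_integral_mono_AE) (use assms legal_play_after[OF assms(1-3)] in \<open>auto simp: AE_measure_pmf_iff\<close>)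
  then show ?case using Suc by (rule order_trans[rotated])
qed simp

lemma ennreal_halves: "0 \<le> a \<Longrightarrow> 0 \<le> b \<Longrightarrow> ennreal a * ennreal (1/2) + ennreal b * ennreal (1/2) = ennreal ((a + b) / 2)"
  using ennreal_mult[of a "1/2"] ennreal_mult[of b "1/2"] ennreal_plus[of "a * (1/2)" "b * (1/2)"]
  by (simp only: divide_simps mult_1_right) (simp add: add_divide_distrib)

lemma nn_integral_pmf_le_const:
  assumes "\<And>y. y \<in> set_pmf p \<Longrightarrow> L y \<le> (c::ennreal)"
  shows "(\<integral>\<^sup>+y. L y \<partial>measure_pmf p) \<le> c"
proof -
  have "(\<integral>\<^sup>+y. L y \<partial>measure_pmf p) \<le> (\<integral>\<^sup>+y. c \<partial>measure_pmf p)"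
    by (intro nn_integral_mono_AE) (use assms in \<open>auto simp: AE_measure_pmf_iff\<close>)
  then show ?thesis by simp
qed

lemma nn_integral_pmf_ge_const:
  assumes "\<And>y. y \<in> set_pmf p \<Longrightarrow> (c::ennreal) \<le> L y"
  shows "c \<le> (\<integral>\<^sup>+y. L y \<partial>measure_pmf p)"
proof -
  have "(\<integral>\<^sup>+y. c \<partial>measure_pmf p) \<le> (\<integral>\<^sup>+y. L y \<partial>measure_pmf p)"
    by (intro nn_integral_mono_AE) (use assms in \<open>auto simp: AE_measure_pmf_iff\<close>)
  then show ?thesis by simp
qed

lemma turn_avg_le:
  assumes "\<And>y. y \<in> set_pmf (SI h) \<Longrightarrow> L (Turn h True y) \<le> ennreal a"
    "\<And>y. y \<in> set_pmf (SII h) \<Longrightarrow> L (Turn h False y) \<le> ennreal b" "0 \<le> a" "0 \<le> b" "a + b \<le> 2 * c"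
  shows "turn_avg SI SII L h \<le> ennreal c"
proof -
  have "turn_avg SI SII L h \<le> ennreal a * ennreal (1/2) + ennreal b * ennreal (1/2)"
    unfolding turn_avg_def by (intro add_mono mult_right_mono nn_integral_pmf_le_const assms) auto
  also have "\<dots> \<le> ennreal c" using assms by (simp add: ennreal_halves ennreal_leI del: ennreal_half)
  finally show ?thesis .
qed

lemma turn_avg_ge:
  assumes "\<And>y. y \<in> set_pmf (SI h) \<Longrightarrow> ennreal a \<le> L (Turn h True y)"
    "\<And>y. y \<in> set_pmf (SII h) \<Longrightarrow> ennreal b \<le> L (Turn h False y)" "0 \<le> a" "0 \<le> b" "2 * c \<le> a + b"
  shows "ennreal c \<le> turn_avg SI SII L h"
proof -
  have "ennreal c \<le> ennreal a * ennreal (1/2) + ennreal b * ennreal (1/2)"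
    using assms by (simp add: ennreal_halves ennreal_leI del: ennreal_half)
  also have "\<dots> \<le> turn_avg SI SII L h"
    unfolding turn_avg_def by (intro add_mono mult_right_mono nn_integral_pmf_ge_const assms) auto
  finally show ?thesis .
qed

text \<open>Turns are appended to unfinished histories only, and after \<open>n\<close> turns these
  have length exactly \<open>n\<close>. A finished history of length at most \<open>n\<close>
  therefore neither gains nor loses mass later on.\<close>

lemma pmf_play_after_terminal:
  assumes h: "pos h \<in> Y"
  shows "pmf (play_after Y SI SII x n) h = (if turns h \<le> n then pmf (play_after Y SI SII x (turns h)) h else 0)"
proof (induction n)
  case 0
  then show ?case by (cases h) (auto simp: indicator_def)
next
  case (Suc n)
  show ?case
  proof (cases "turns h \<le> n")
    case True
    have "pmf (play_after Y SI SII x (Suc n)) h = measure_pmf.expectation (play_after Y SI SII x n) (indicator {h})"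
      unfolding play_after.simps pmf_bind
    proof (rule integral_cong_AE)
      show "AE h' in play_after Y SI SII x n. pmf (if pos h' \<in> Y then return_pmf h' else
          bind_pmf (bernoulli_pmf (1 / 2)) (\<lambda>c. map_pmf (Turn h' c) (if c then SI h' else SII h'))) h
          = indicator {h} h'"
        unfolding AE_measure_pmf_iff
      proof
        fix h' assume h': "h' \<in> set_pmf (play_after Y SI SII x n)"
        show "pmf (if pos h' \<in> Y then return_pmf h' else
          bind_pmf (bernoulli_pmf (1 / 2)) (\<lambda>c. map_pmf (Turn h' c) (if c then SI h' else SII h'))) h
          = indicator {h} h'"
        proof (cases "pos h' \<in> Y")
          case False
          then have "turns h' = n" using turns_play_after[OF h'] by simp
          then have "h \<notin> set_pmf (bind_pmf (bernoulli_pmf (1 / 2)) (\<lambda>c. map_pmf (Turn h' c) (if c then SI h' else SII h')))"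
            using True by auto
          then show ?thesis using False h by (auto simp: pmf_eq_0_set_pmf indicator_def)
        qed (auto simp: indicator_def)
      qed
    qed auto
    also have "\<dots> = pmf (play_after Y SI SII x n) h" by (simp add: pmf.rep_eq)
    finally show ?thesis using Suc True by simp
  next
    case False
    then show ?thesis
      using turns_play_after[of h Y SI SII x "Suc n"]
      by (cases "turns h = Suc n") (auto simp del: play_after.simps simp: pmf_eq_0_set_pmf)
  qed
qed

text \<open>By the preceding lemma the finished part of the law after \<open>n\<close> turns
  increases with \<open>n\<close> to the terminal law. Monotone convergence then carries estimates
  at fixed times over to the end of the game.\<close>

lemma nn_integral_terminal_law:
  "(\<integral>\<^sup>+h. g h \<partial>terminal_law Y SI SII x) =
     (SUP n. \<integral>\<^sup>+h. g h * indicator {h. pos h \<in> Y} h \<partial>play_after Y SI SII x n)"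
proof -
  let ?P = "play_after Y SI SII x" and ?T = "{h. pos h \<in> Y}"
  let ?p = "\<lambda>n h. (if turns h \<le> n then ennreal (pmf (?P (turns h)) h) * g h else 0)"
  have 1: "(\<integral>\<^sup>+h. g h * indicator ?T h \<partial>?P n) = (\<integral>\<^sup>+h. ?p n h \<partial>count_space ?T)" for n
  proof -
    have "(\<integral>\<^sup>+h. g h * indicator ?T h \<partial>?P n) = (\<integral>\<^sup>+h. ennreal (pmf (?P n) h) * (g h * indicator ?T h) \<partial>count_space UNIV)"
      by (rule nn_integral_measure_pmf)
    also have "\<dots> = (\<integral>\<^sup>+h. ennreal (pmf (?P n) h) * g h * indicator ?T h \<partial>count_space UNIV)"
      by (simp add: mult.assoc)
    also have "\<dots> = (\<integral>\<^sup>+h. ennreal (pmf (?P n) h) * g h \<partial>count_space ?T)"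
      by (rule nn_integral_count_space_indicator[symmetric]) auto
    also have "\<dots> = (\<integral>\<^sup>+h. ?p n h \<partial>count_space ?T)"
      by (intro nn_integral_cong) (simp add: pmf_play_after_terminal[of _ Y SI SII x n])
    finally show ?thesis .
  qed
  have "(\<integral>\<^sup>+h. g h \<partial>terminal_law Y SI SII x) = (\<integral>\<^sup>+h. ennreal (pmf (?P (turns h)) h) * g h \<partial>count_space ?T)"
    unfolding terminal_law_def by (subst nn_integral_density) auto
  also have "\<dots> = (\<integral>\<^sup>+h. (SUP n. ?p n h) \<partial>count_space ?T)"
  proof (intro nn_integral_cong)
    fix h
    show "ennreal (pmf (?P (turns h)) h) * g h = (SUP n. ?p n h)"
      by (intro antisym SUP_least SUP_upper2[of "turns h"]) auto
  qed
  also have "\<dots> = (SUP n. \<integral>\<^sup>+h. ?p n h \<partial>count_space ?T)"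
    by (rule nn_integral_monotone_convergence_SUP) (auto simp: incseq_def le_fun_def)
  finally show ?thesis by (simp add: 1)
qed

text \<open>Markov's inequality: a play unfinished after \<open>n\<close> turns has length
  \<open>n\<close>, so \<open>L + d\<close> is at least \<open>c * n\<close> on it, while the mean
  of \<open>L + d\<close> stays below \<open>C + d\<close>. The probability of being unfinished is
  thus at most of order \<open>1 / n\<close>.\<close>

lemma prob_space_terminal_law:
  assumes S: "SI \<in> strategies X Y e" "SII \<in> strategies X Y e" "x \<in> X"
    and step: "\<And>h. legal_play X Y e h \<Longrightarrow> pos h \<notin> Y \<Longrightarrow> turn_avg SI SII L h \<le> L h"
    and c: "0 < c" "\<And>h. legal_play X Y e h \<Longrightarrow> ennreal (c * real (turns h)) \<le> L h + ennreal d" and d: "0 \<le> d"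
    and fin: "L (Start x) \<le> ennreal C" "0 \<le> C"
  shows "prob_space (terminal_law Y SI SII x)"
    and "(\<lambda>n. measure_pmf.prob (play_after Y SI SII x n) {h. pos h \<notin> Y}) \<longlonglongrightarrow> 0"
proof -
  let ?P = "play_after Y SI SII x"
  have bound: "measure_pmf.prob (?P n) {h. pos h \<notin> Y} \<le> ((C + d) / c) * inverse (real n)" if "0 < n" for n
  proof -
    have "ennreal (c * real n) * emeasure (?P n) {h. pos h \<notin> Y}
        = (\<integral>\<^sup>+h. ennreal (c * real n) * indicator {h. pos h \<notin> Y} h \<partial>?P n)"
      by (simp add: nn_integral_cmult_indicator)
    also have "\<dots> \<le> (\<integral>\<^sup>+h. L h + ennreal d \<partial>?P n)"
    proof (intro nn_integral_mono_AE, unfold AE_measure_pmf_iff, intro ballI)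
      fix h assume h: "h \<in> set_pmf (?P n)"
      show "ennreal (c * real n) * indicator {h. pos h \<notin> Y} h \<le> L h + ennreal d"
        using c(2)[OF legal_play_after[OF S h]] turns_play_after[OF h] by (cases "pos h \<in> Y") auto
    qed
    also have "\<dots> = (\<integral>\<^sup>+h. L h \<partial>?P n) + ennreal d"
      by (subst nn_integral_add) auto
    also have "\<dots> \<le> ennreal C + ennreal d"
      by (intro add_right_mono order_trans[OF nn_integral_play_after_le[OF S step] fin(1)])
    also have "\<dots> = ennreal (C + d)" using fin d by simp
    finally have "ennreal (c * real n * measure_pmf.prob (?P n) {h. pos h \<notin> Y}) \<le> ennreal (C + d)"
      using c by (simp add: measure_pmf.emeasure_eq_measure ennreal_mult'[symmetric])
    then have "c * real n * measure_pmf.prob (?P n) {h. pos h \<notin> Y} \<le> C + d"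
      using fin d by (simp add: ennreal_le_iff del: ennreal_plus)
    then show ?thesis using c that by (simp add: field_simps)
  qed
  show lim: "(\<lambda>n. measure_pmf.prob (?P n) {h. pos h \<notin> Y}) \<longlonglongrightarrow> 0"
  proof (rule tendsto_sandwich[OF _ _ tendsto_const])
    show "(\<lambda>n. ((C + d) / c) * inverse (real n)) \<longlonglongrightarrow> 0"
      by (rule tendsto_mult_right_zero[OF lim_inverse_n])
    show "\<forall>\<^sub>F n in sequentially. measure_pmf.prob (?P n) {h. pos h \<notin> Y} \<le> ((C + d) / c) * inverse (real n)"
      using eventually_gt_at_top[of 0] by eventually_elim (rule bound)
  qed auto
  have "emeasure (terminal_law Y SI SII x) (space (terminal_law Y SI SII x)) = (\<integral>\<^sup>+h. 1 \<partial>terminal_law Y SI SII x)"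
    by simp
  also have "\<dots> = (SUP n. emeasure (?P n) {h. pos h \<in> Y})"
    unfolding nn_integral_terminal_law by (simp)
  also have "\<dots> = 1"
  proof (rule antisym)
    show "(SUP n. emeasure (?P n) {h. pos h \<in> Y}) \<le> 1"
      by (intro SUP_least measure_pmf.emeasure_le_1)
    have eq: "measure_pmf.prob (?P n) {h. pos h \<in> Y} = 1 - measure_pmf.prob (?P n) {h. pos h \<notin> Y}" for n
      using measure_pmf.prob_compl[of "{h. pos h \<notin> Y}" "?P n"] by (simp add: Compl_eq_Diff_UNIV[symmetric] Collect_neg_eq)
    have "(\<lambda>n. ennreal (1 - measure_pmf.prob (?P n) {h. pos h \<notin> Y})) \<longlonglongrightarrow> ennreal (1 - 0)"
      by (intro tendsto_ennrealI tendsto_diff tendsto_const lim)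
    then have "(\<lambda>n. emeasure (?P n) {h. pos h \<in> Y}) \<longlonglongrightarrow> 1"
      by (simp add: measure_pmf.emeasure_eq_measure eq)
    then show "1 \<le> (SUP n. emeasure (?P n) {h. pos h \<in> Y})"
      by (rule LIMSEQ_le_const2) (auto intro!: SUP_upper)
  qed
  finally show "prob_space (terminal_law Y SI SII x)" by (rule prob_spaceI)
qed

lemma AE_terminal_law:
  assumes S: "SI \<in> strategies X Y e" "SII \<in> strategies X Y e" "x \<in> X"
  shows "AE h in terminal_law Y SI SII x. legal_play X Y e h \<and> pos h \<in> Y"
  unfolding terminal_law_def
proof (subst AE_density)
  show "AE h in count_space {h. pos h \<in> Y}. 0 < ennreal (pmf (play_after Y SI SII x (turns h)) h) \<longrightarrow> legal_play X Y e h \<and> pos h \<in> Y"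
    using legal_play_after[OF S] by (auto simp: AE_count_space ennreal_less_zero_iff pmf_positive_iff)
qed simp

lemma terminal_law_borel [measurable]: "g \<in> borel_measurable (terminal_law Y SI SII x)" for g :: "'a play \<Rightarrow> 'b::topological_space"
  by (simp add: terminal_law_def)

section \<open>Expectations of payoffs bounded below\<close>

lemma ext_expectation_integrable:
  assumes "integrable M g"
  shows "ext_expectation_exists M g" "ext_expectation M g = ereal (\<integral>h. g h \<partial>M)"
proof -
  have a: "(\<integral>\<^sup>+h. ennreal (g h) \<partial>M) < \<infinity>" "(\<integral>\<^sup>+h. ennreal (- g h) \<partial>M) < \<infinity>"
    using assms by (auto simp: real_integrable_def less_top)
  then show "ext_expectation_exists M g" using assms by (auto simp: ext_expectation_exists_def)
  obtain r where r: "(\<integral>\<^sup>+h. ennreal (g h) \<partial>M) = ennreal r" "0 \<le> r" using a(1) by (cases "\<integral>\<^sup>+h. ennreal (g h) \<partial>M") auto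
  obtain s where s: "(\<integral>\<^sup>+h. ennreal (- g h) \<partial>M) = ennreal s" "0 \<le> s" using a(2) by (cases "\<integral>\<^sup>+h. ennreal (- g h) \<partial>M") auto
  show "ext_expectation M g = ereal (\<integral>h. g h \<partial>M)"
    using r s by (simp add: ext_expectation_def real_lebesgue_integral_def[OF assms] enn2ereal_ennreal)
qed

lemma (in prob_space) integrable_bounded_below:
  fixes g :: "'a \<Rightarrow> real"
  assumes [measurable]: "g \<in> borel_measurable M" and ae: "AE h in M. - R \<le> g h"
    and le: "(\<integral>\<^sup>+h. ennreal (g h + R) \<partial>M) \<le> ennreal (C + R)" and "0 \<le> C + R"
  shows "integrable M g" "(\<integral>h. g h \<partial>M) \<le> C"
proof -
  have ae': "AE h in M. 0 \<le> g h + R" using ae by eventually_elim simp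
  have "integrable M (\<lambda>h. g h + R)"
    by (rule integrableI_nonneg[OF _ ae']) (use le in \<open>auto intro: le_less_trans\<close>)
  then have "integrable M (\<lambda>h. (g h + R) - R)" by (rule Bochner_Integration.integrable_diff) simp
  then show i: "integrable M g" by simp
  have "ennreal (\<integral>h. g h + R \<partial>M) \<le> ennreal (C + R)"
    using nn_integral_eq_integral[OF \<open>integrable M (\<lambda>h. g h + R)\<close> ae'] le by simp
  then have "(\<integral>h. g h + R \<partial>M) \<le> C + R" using assms(4) by (simp add: ennreal_le_iff)
  moreover have "(\<integral>h. g h + R \<partial>M) = (\<integral>h. g h \<partial>M) + R" using i by (simp add: prob_space)
  ultimately show "(\<integral>h. g h \<partial>M) \<le> C" by simp
qed

text \<open>Integrability is not assumed: if the positive part has infinite integral, the extended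
  expectation is \<open>\<infinity>\<close> and the bound is trivial. So no estimate of the
  accumulated running payoff from above has to be supplied.\<close>

lemma (in prob_space) ext_expectation_ge:
  fixes g :: "'a \<Rightarrow> real"
  assumes [measurable]: "g \<in> borel_measurable M" and ae: "AE h in M. - R \<le> g h"
    and ge: "ennreal (C + R) \<le> (\<integral>\<^sup>+h. ennreal (g h + R) \<partial>M)"
  shows "ext_expectation_exists M g" "ereal C \<le> ext_expectation M g"
proof -
  have "(\<integral>\<^sup>+h. ennreal (- g h) \<partial>M) \<le> (\<integral>\<^sup>+h. ennreal R \<partial>M)"
    by (rule nn_integral_mono_AE) (use ae in \<open>eventually_elim, simp add: ennreal_leI\<close>)
  also have "\<dots> < \<infinity>" by (simp add: emeasure_space_1)
  finally have fin: "(\<integral>\<^sup>+h. ennreal (- g h) \<partial>M) < \<infinity>" .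
  then show "ext_expectation_exists M g" by (simp add: ext_expectation_exists_def)
  obtain s where s: "(\<integral>\<^sup>+h. ennreal (- g h) \<partial>M) = ennreal s" "0 \<le> s" using fin by (cases "\<integral>\<^sup>+h. ennreal (- g h) \<partial>M") auto
  show "ereal C \<le> ext_expectation M g"
  proof (cases "(\<integral>\<^sup>+h. ennreal (g h) \<partial>M) = \<infinity>")
    case True
    then show ?thesis using s by (simp add: ext_expectation_def enn2ereal_ennreal)
  next
    case False
    then have i: "integrable M g" using fin by (simp add: real_integrable_def)
    have ae': "AE h in M. 0 \<le> g h + R" using ae by eventually_elim simp
    have "(\<integral>\<^sup>+h. ennreal (g h + R) \<partial>M) = ennreal (\<integral>h. g h + R \<partial>M)"
      by (rule nn_integral_eq_integral[OF _ ae']) (use i in simp)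
    moreover have "(\<integral>h. g h + R \<partial>M) = (\<integral>h. g h \<partial>M) + R" using i by (simp add: prob_space)
    moreover have "0 \<le> (\<integral>h. g h + R \<partial>M)" by (rule integral_nonneg_AE[OF ae'])
    ultimately have "C + R \<le> (\<integral>h. g h \<partial>M) + R" using ge by (simp add: ennreal_le_iff)
    then show ?thesis using ext_expectation_integrable[OF i] by simp
  qed
qed

lemma legal_play_in: "legal_play X Y e h \<Longrightarrow> pos h \<in> X"
  by (cases h) (auto simp: legal_moves_def)

lemma running_sum_ge:
  assumes "legal_play X Y e h" "\<And>x. x \<in> X - Y \<Longrightarrow> c \<le> f x"
  shows "c * real (turns h) \<le> running_sum f h"
  using assms(1)
proof (induction h)
  case (Turn h b y)
  then have "c \<le> f (pos h)" using legal_play_in[of X Y e h] assms(2) by auto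
  then show ?case using Turn by (simp add: algebra_simps)
qed simp

lemma running_sum_mono:
  assumes "legal_play X Y e h" "\<And>x. x \<in> X - Y \<Longrightarrow> f x \<le> g x"
  shows "running_sum f h \<le> running_sum g h"
  using assms(1)
proof (induction h)
  case (Turn h b y)
  then have "f (pos h) \<le> g (pos h)" using legal_play_in[of X Y e h] assms(2) by auto
  then show ?case using Turn by simp
qed simp

lemma running_sum_nonneg:
  assumes "legal_play X Y e h" "\<And>x. x \<in> X - Y \<Longrightarrow> 0 \<le> f x"
  shows "0 \<le> running_sum f h"
  using running_sum_ge[OF assms] by simp

lemma running_sum_zero:
  assumes "legal_play X Y e h" "\<And>x. x \<in> X - Y \<Longrightarrow> f x = 0"
  shows "running_sum f h = 0"
  using assms(1)
proof (induction h)
  case (Turn h b y)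
  then show ?case using legal_play_in[of X Y e h] assms(2) by simp
qed simp

lemma strategies_moves:
  assumes "S \<in> strategies X Y e" "legal_play X Y e h" "pos h \<notin> Y" "y \<in> set_pmf (S h)"
  shows "y \<in> nb X e (pos h)"
  using assms by (auto simp: strategies_def legal_moves_eq_nb)

section \<open>Strategies and values for a fixed step size\<close>

context tug_of_war
begin

text \<open>The strategy moves to near-minimizers of \<open>v\<close>. Since \<open>f \<ge> c > 0\<close>, the supermartingale
  \<open>v(x\<^sub>t) + e\<^sup>2 \<Sum> f\<close> forces termination. The strategy may be used by either player.\<close>

lemma minimizing_strategy:
  assumes v: "\<And>x. x \<in> X \<Longrightarrow> \<bar>v x\<bar> \<le> R" and F: "\<And>x. x \<in> Y \<Longrightarrow> \<bar>F x\<bar> \<le> R"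
    and Fv: "\<And>x. x \<in> Y \<Longrightarrow> F x \<le> v x"
    and super: "\<And>x. x \<in> X - Y \<Longrightarrow> midrange X e v x + e\<^sup>2 * f x \<le> v x"
    and c: "0 < c" "\<And>x. x \<in> X - Y \<Longrightarrow> c \<le> f x" and \<eta>: "0 < \<eta>"
  shows "\<exists>S\<in>strategies X Y e. \<forall>SI\<in>strategies X Y e. \<forall>SII\<in>strategies X Y e. \<forall>x\<in>X. SI = S \<or> SII = S \<longrightarrow>
       prob_space (terminal_law Y SI SII x) \<and> integrable (terminal_law Y SI SII x) (payoff F f e) \<and>
       (\<integral>h. payoff F f e h \<partial>terminal_law Y SI SII x) \<le> v x + \<eta>"
proof -
  have bv: "bounded (v ` X)" by (rule bounded_image_realI) (rule v)
  define ok where "ok h y \<longleftrightarrow> y \<in> nb X e (pos h) \<and> v y \<le> Inf (v ` nb X e (pos h)) + \<eta> * (1/2) ^ turns h" for h y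
  have ex: "\<exists>y. ok h y" if px: "pos h \<in> X" for h
  proof -
    have "Inf (v ` nb X e (pos h)) < Inf (v ` nb X e (pos h)) + \<eta> * (1/2) ^ turns h" using \<eta> by simp
    then obtain y where "y \<in> nb X e (pos h)" "v y < Inf (v ` nb X e (pos h)) + \<eta> * (1/2) ^ turns h"
      using nb_self[OF e_pos px] by (subst (asm) cINF_less_iff) (use bdd_nb[OF bv] in auto)
    then show ?thesis unfolding ok_def by (auto intro: less_imp_le)
  qed
  define S where "S h = return_pmf (SOME y. ok h y)" for h
  have S_ok: "ok h y" if "pos h \<in> X" "y \<in> set_pmf (S h)" for h y
    using someI_ex[OF ex[OF that(1)]] that(2) by (simp add: S_def)
  have S: "S \<in> strategies X Y e"
    using S_ok legal_play_in by (fastforce simp: strategies_def ok_def legal_moves_eq_nb)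
  \<comment> \<open>Choosing within \<open>\<eta> * (1/2) ^ turns h\<close> of the infimum costs
    half of this on average, as the toss is won half the time; the last summand drops by exactly
    that much in the turn. \<open>R\<close> makes the potential nonnegative.\<close>
  define L where "L h = ennreal (R + v (pos h) + e\<^sup>2 * running_sum f h + \<eta> * (1/2) ^ turns h)" for h
  have "prob_space (terminal_law Y SI SII x) \<and> integrable (terminal_law Y SI SII x) (payoff F f e) \<and>
       (\<integral>h. payoff F f e h \<partial>terminal_law Y SI SII x) \<le> v x + \<eta>"
    if SI: "SI \<in> strategies X Y e" and SII: "SII \<in> strategies X Y e" and or: "SI = S \<or> SII = S" and x: "x \<in> X"
    for SI SII x
  proof -
    have step: "turn_avg SI SII L h \<le> L h" if h: "legal_play X Y e h" "pos h \<notin> Y" for h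
    proof -
      have px: "pos h \<in> X" using legal_play_in[OF h(1)] .
      have rs: "0 \<le> running_sum f h" "0 \<le> f (pos h)"
        using order_trans[OF _ running_sum_ge[OF h(1) c(2)], of 0] c(1) c(2)[of "pos h"] px h(2) by auto
      define s where "s = Sup (v ` nb X e (pos h))"
      define i where "i = Inf (v ` nb X e (pos h))"
      define p where "p = \<eta> * (1/2) ^ turns h"
      define r g where "r = e\<^sup>2 * running_sum f h" and "g = e\<^sup>2 * f (pos h)"
      define b where "b = R + r + g + p / 2"
      have "- R \<le> i" unfolding i_def
        by (rule Inf_nb_ge[OF e_pos px]) (use v nb_sub abs_le_iff minus_le_iff in blast)
      moreover have "i \<le> v (pos h)" "v (pos h) \<le> s"
        unfolding i_def s_def by (intro Inf_nb_le Sup_nb_ge bv nb_self e_pos px)+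
      moreover have "0 \<le> r" "0 \<le> g" "0 \<le> p"
        using rs \<eta> by (auto simp: p_def r_def g_def)
      ultimately have pos: "0 \<le> b + i + p" "0 \<le> b + s" unfolding b_def by linarith+
      have L: "L (Turn h d y) = ennreal (b + v y)" for d y by (simp add: L_def b_def p_def r_def g_def algebra_simps)
      have any: "L (Turn h d y) \<le> ennreal (b + s)" if "y \<in> set_pmf (SI h) \<or> y \<in> set_pmf (SII h)" for d y
        unfolding L s_def
        using strategies_moves[OF SI h] strategies_moves[OF SII h] that Sup_nb_ge[OF bv, of y e "pos h"]
        by (intro ennreal_leI) auto
      have mine: "L (Turn h d y) \<le> ennreal (b + i + p)" if "y \<in> set_pmf (S h)" for d y
        unfolding L i_def p_def using S_ok[OF px that] by (intro ennreal_leI) (simp add: ok_def)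
      have "2 * midrange X e v (pos h) = s + i" unfolding s_def i_def by (rule midrange_double)
      moreover have "midrange X e v (pos h) + g \<le> v (pos h)" using super px h by (simp add: g_def)
      ultimately have sum: "(b + i + p) + (b + s) \<le> 2 * (R + v (pos h) + r + p)"
        unfolding b_def by (simp add: distrib_left)
      have Lh: "L h = ennreal (R + v (pos h) + r + p)" by (simp add: L_def p_def r_def)
      show ?thesis
      proof (cases "SI = S")
        case True
        show ?thesis
          unfolding Lh by (rule turn_avg_le[OF _ _ pos sum]) (use mine any True in auto)
      next
        case False
        then have S': "SII = S" using or by simp
        have sum': "(b + s) + (b + i + p) \<le> 2 * (R + v (pos h) + r + p)"
          using sum by (simp only: add.commute)
        show ?thesis
          unfolding Lh by (rule turn_avg_le[OF _ _ pos(2,1) sum']) (use mine any S' in auto)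
      qed
    qed
    have big: "ennreal (e\<^sup>2 * c * real (turns h)) \<le> L h + ennreal 0" if h: "legal_play X Y e h" for h
    proof -
      have "e\<^sup>2 * (c * real (turns h)) \<le> e\<^sup>2 * running_sum f h"
        by (intro mult_left_mono running_sum_ge[OF h c(2)]) auto
      moreover have "0 \<le> \<eta> * (1/2) ^ turns h" using \<eta> by simp
      moreover have "0 \<le> R + v (pos h)" using v[OF legal_play_in[OF h]] by (simp add: abs_le_iff)
      ultimately have "e\<^sup>2 * c * real (turns h) \<le> R + v (pos h) + e\<^sup>2 * running_sum f h + \<eta> * (1/2) ^ turns h"
        unfolding mult.assoc by linarith
      then show ?thesis unfolding L_def ennreal_0 add_0_right by (rule ennreal_leI)
    qed
    have Lx: "L (Start x) = ennreal (R + v x + \<eta>)" by (simp add: L_def)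
    have C: "0 \<le> R + v x + \<eta>" using v[OF x] \<eta> by (simp add: abs_le_iff)
    interpret T: prob_space "terminal_law Y SI SII x"
      by (rule prob_space_terminal_law(1)[OF SI SII x step _ big _ _ C]) (use c e_pos Lx in auto)
    have lower: "- R \<le> payoff F f e h" "ennreal (payoff F f e h + R) \<le> L h" if h: "legal_play X Y e h" "pos h \<in> Y" for h
    proof -
      have "0 \<le> running_sum f h" using running_sum_nonneg[OF h(1)] c order_trans[OF less_imp_le] by metis
      then have "0 \<le> e\<^sup>2 * running_sum f h" by simp
      then show "- R \<le> payoff F f e h" using F[OF h(2)] by (simp add: payoff_def abs_le_iff)
      show "ennreal (payoff F f e h + R) \<le> L h"
        unfolding L_def payoff_def using Fv[OF h(2)] \<eta>
        by (intro ennreal_leI) (simp add: algebra_simps add_increasing2)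
    qed
    have ae: "AE h in terminal_law Y SI SII x. - R \<le> payoff F f e h"
      using AE_terminal_law[OF SI SII x] by eventually_elim (use lower in auto)
    have "(\<integral>\<^sup>+h. ennreal (payoff F f e h + R) \<partial>terminal_law Y SI SII x) \<le> ennreal ((v x + \<eta>) + R)"
      unfolding nn_integral_terminal_law
    proof (rule SUP_least)
      fix n
      have "(\<integral>\<^sup>+h. ennreal (payoff F f e h + R) * indicator {h. pos h \<in> Y} h \<partial>play_after Y SI SII x n)
          \<le> (\<integral>\<^sup>+h. L h \<partial>play_after Y SI SII x n)"
        by (intro nn_integral_mono_AE, unfold AE_measure_pmf_iff, intro ballI)
          (use lower legal_play_after[OF SI SII x] in \<open>auto simp: indicator_def\<close>)
      also have "\<dots> \<le> L (Start x)" by (rule nn_integral_play_after_le[OF SI SII x step])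
      finally show "(\<integral>\<^sup>+h. ennreal (payoff F f e h + R) * indicator {h. pos h \<in> Y} h \<partial>play_after Y SI SII x n)
          \<le> ennreal ((v x + \<eta>) + R)" by (simp add: Lx add_ac)
    qed
    then show ?thesis
      using T.integrable_bounded_below[OF terminal_law_borel ae, of "v x + \<eta>"] C T.prob_space_axioms
      by (simp add: add_ac)
  qed
  with S show ?thesis by blast
qed

text \<open>Two running payoffs: \<open>g \<ge> c > 0\<close> forces the end of the game through
  \<open>minimizing_strategy\<close>, whereas the payoff \<open>f\<close> that is really paid only
  has to lie between 0 and \<open>g\<close>. So \<open>f = 0\<close> can be treated with a small
  positive \<open>g\<close>.\<close>

lemma value_II_le:
  assumes v: "\<And>x. x \<in> X \<Longrightarrow> \<bar>v x\<bar> \<le> R" and F: "\<And>x. x \<in> Y \<Longrightarrow> \<bar>F x\<bar> \<le> R"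
    and Fv: "\<And>x. x \<in> Y \<Longrightarrow> F x \<le> v x"
    and super: "\<And>x. x \<in> X - Y \<Longrightarrow> midrange X e v x + e\<^sup>2 * g x \<le> v x"
    and c: "0 < c" "\<And>x. x \<in> X - Y \<Longrightarrow> c \<le> g x"
    and f: "\<And>x. x \<in> X - Y \<Longrightarrow> 0 \<le> f x \<and> f x \<le> g x" and x: "x \<in> X"
  shows "value_II X Y F f e x \<le> ereal (v x)"
proof (rule ereal_le_epsilon2)
  fix \<eta> :: real assume "0 < \<eta>"
  obtain S where S: "S \<in> strategies X Y e" and SS:
    "\<forall>SI\<in>strategies X Y e. \<forall>SII\<in>strategies X Y e. \<forall>x\<in>X. SI = S \<or> SII = S \<longrightarrow>
       prob_space (terminal_law Y SI SII x) \<and> integrable (terminal_law Y SI SII x) (payoff F g e) \<and>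
       (\<integral>h. payoff F g e h \<partial>terminal_law Y SI SII x) \<le> v x + \<eta>"
    using minimizing_strategy[OF v F Fv super c \<open>0 < \<eta>\<close>] by blast
  have "F_plus Y F f e x SI S \<le> ereal (v x) + ereal \<eta>" if SI: "SI \<in> strategies X Y e" for SI
  proof -
    let ?M = "terminal_law Y SI S x"
    have p: "prob_space ?M" and i: "integrable ?M (payoff F g e)" and le: "(\<integral>h. payoff F g e h \<partial>?M) \<le> v x + \<eta>"
      using SS SI S x by blast+
    interpret prob_space ?M by (rule p)
    have b: "- R \<le> payoff F f e h" "payoff F f e h \<le> payoff F g e h" if h: "legal_play X Y e h" "pos h \<in> Y" for h
    proof -
      have "0 \<le> running_sum f h" using running_sum_nonneg[OF h(1)] f by blast
      then have "0 \<le> e\<^sup>2 * running_sum f h" by simp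
      then show "- R \<le> payoff F f e h" using F[OF h(2)] by (simp add: payoff_def abs_le_iff)
      show "payoff F f e h \<le> payoff F g e h"
        unfolding payoff_def by (intro add_left_mono mult_left_mono running_sum_mono[OF h(1)]) (use f in auto)
    qed
    have ae: "AE h in ?M. payoff F f e h \<le> payoff F g e h"
      using AE_terminal_law[OF SI S x] by eventually_elim (use b in auto)
    have i': "integrable ?M (payoff F f e)"
    proof (rule Bochner_Integration.integrable_bound)
      show "integrable ?M (\<lambda>h. \<bar>payoff F g e h\<bar> + R)" using i by simp
      show "AE h in ?M. norm (payoff F f e h) \<le> norm (\<bar>payoff F g e h\<bar> + R)"
        using AE_terminal_law[OF SI S x]
      proof eventually_elim
        case (elim h)
        then show ?case using b[of h] order_trans[OF abs_ge_zero F[of "pos h"]] by (auto simp: abs_if)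
      qed
    qed simp
    have "(\<integral>h. payoff F f e h \<partial>?M) \<le> v x + \<eta>"
      using integral_mono_AE[OF i' i ae] le by simp
    then show ?thesis
      using ext_expectation_integrable[OF i'] p by (simp add: F_plus_def outcome_defined_def)
  qed
  then show "value_II X Y F f e x \<le> ereal (v x) + ereal \<eta>"
    unfolding value_II_def by (intro INF_lower2[OF S] SUP_least)
qed

text \<open>Without running payoff the players can exchange roles: player I plays the minimizing
  strategy for \<open>- F\<close>. Again \<open>g\<close> only serves termination; the actual payoff
  is bounded by \<open>R\<close> and hence integrable.\<close>

lemma value_I_ge_zero_payoff:
  assumes v: "\<And>x. x \<in> X \<Longrightarrow> \<bar>v x\<bar> \<le> R" and F: "\<And>x. x \<in> Y \<Longrightarrow> \<bar>F x\<bar> \<le> R"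
    and Fv: "\<And>x. x \<in> Y \<Longrightarrow> - F x \<le> v x"
    and super: "\<And>x. x \<in> X - Y \<Longrightarrow> midrange X e v x + e\<^sup>2 * g x \<le> v x"
    and c: "0 < c" "\<And>x. x \<in> X - Y \<Longrightarrow> c \<le> g x"
    and f: "\<And>x. x \<in> X - Y \<Longrightarrow> f x = 0" and x: "x \<in> X"
  shows "ereal (- v x) \<le> value_I X Y F f e x"
proof (rule ereal_le_epsilon2)
  fix \<eta> :: real assume "0 < \<eta>"
  define F' where "F' = (\<lambda>x. - F x)"
  have F': "\<bar>F' x\<bar> \<le> R" "F' x \<le> v x" if "x \<in> Y" for x using F Fv that by (auto simp: F'_def)
  obtain S where S: "S \<in> strategies X Y e" and SS:
    "\<forall>SI\<in>strategies X Y e. \<forall>SII\<in>strategies X Y e. \<forall>x\<in>X. SI = S \<or> SII = S \<longrightarrow>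
       prob_space (terminal_law Y SI SII x) \<and> integrable (terminal_law Y SI SII x) (payoff F' g e) \<and>
       (\<integral>h. payoff F' g e h \<partial>terminal_law Y SI SII x) \<le> v x + \<eta>"
    using minimizing_strategy[of v R F' g, OF v F' super c \<open>0 < \<eta>\<close>] by blast
  have "ereal (- v x - \<eta>) \<le> F_minus Y F f e x S SII" if SII: "SII \<in> strategies X Y e" for SII
  proof -
    let ?M = "terminal_law Y S SII x"
    have p: "prob_space ?M" and i: "integrable ?M (payoff F' g e)" and le: "(\<integral>h. payoff F' g e h \<partial>?M) \<le> v x + \<eta>"
      using SS SII S x by blast+
    interpret prob_space ?M by (rule p)
    have b: "\<bar>payoff F f e h\<bar> \<le> R" "- payoff F f e h \<le> payoff F' g e h" if h: "legal_play X Y e h" "pos h \<in> Y" for h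
    proof -
      have rs: "running_sum f h = 0"
        by (rule running_sum_zero[OF h(1) f])
      then show "\<bar>payoff F f e h\<bar> \<le> R" using F[OF h(2)] by (simp add: payoff_def)
      have "0 \<le> running_sum g h" using running_sum_nonneg[OF h(1)] c order_trans[OF less_imp_le] by metis
      then show "- payoff F f e h \<le> payoff F' g e h" by (simp add: payoff_def rs F'_def)
    qed
    have ae: "AE h in ?M. - payoff F f e h \<le> payoff F' g e h"
      using AE_terminal_law[OF S SII x] by eventually_elim (use b in auto)
    have "AE h in ?M. norm (payoff F f e h) \<le> R"
      using AE_terminal_law[OF S SII x] by eventually_elim (use b in auto)
    then have i': "integrable ?M (payoff F f e)"
      by (rule integrable_const_bound) simp
    have "(\<integral>h. - payoff F f e h \<partial>?M) \<le> v x + \<eta>"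
      using integral_mono_AE[OF _ i ae] i' le by simp
    then have "- v x - \<eta> \<le> (\<integral>h. payoff F f e h \<partial>?M)" by simp
    then show ?thesis
      using ext_expectation_integrable[OF i'] p by (simp add: F_minus_def outcome_defined_def)
  qed
  then have "ereal (- v x - \<eta>) \<le> value_I X Y F f e x"
    unfolding value_I_def by (intro SUP_upper2[OF S] INF_greatest)
  then have "ereal (- v x - \<eta>) + ereal \<eta> \<le> value_I X Y F f e x + ereal \<eta>" by (rule add_right_mono)
  then show "ereal (- v x) \<le> value_I X Y F f e x + ereal \<eta>" by simp
qed

lemma value_I_le_value_II: "value_I X Y F f e x \<le> value_II X Y F f e x"
  unfolding value_I_def value_II_def
proof (intro SUP_least INF_greatest)
  fix SI SII assume S: "SI \<in> strategies X Y e" "SII \<in> strategies X Y e"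
  have "(INF SII\<in>strategies X Y e. F_minus Y F f e x SI SII) \<le> F_minus Y F f e x SI SII"
    by (rule INF_lower[OF S(2)])
  also have "\<dots> \<le> F_plus Y F f e x SI SII" by (simp add: F_minus_def F_plus_def)
  also have "\<dots> \<le> (SUP SI\<in>strategies X Y e. F_plus Y F f e x SI SII)"
    by (rule SUP_upper[OF S(1)])
  finally show "(INF SII\<in>strategies X Y e. F_minus Y F f e x SI SII) \<le> (SUP SI\<in>strategies X Y e. F_plus Y F f e x SI SII)" .
qed

text \<open>A player who maximizes forever might never end the game, which counts as
  \<open>- \<infinity>\<close> for player I. After \<open>n\<close> turns the strategy therefore
  descends along \<open>N\<close>, and this ends the game almost surely against every
  opponent.\<close>

definition horizon_strategy :: "('a \<Rightarrow> real) \<Rightarrow> real \<Rightarrow> nat \<Rightarrow> 'a play \<Rightarrow> 'a pmf" where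
  "horizon_strategy u \<eta> n h = return_pmf (SOME y. y \<in> nb X e (pos h) \<and>
     (if turns h < n then Sup (u ` nb X e (pos h)) - \<eta> * (1/2) ^ turns h \<le> u y else N y < N (pos h)))"

lemma horizon_strategy:
  assumes bu: "bounded (u ` X)" and \<eta>: "0 < \<eta>" and h: "pos h \<in> X - Y" and y: "y \<in> set_pmf (horizon_strategy u \<eta> n h)"
  shows "y \<in> nb X e (pos h)" "turns h < n \<Longrightarrow> Sup (u ` nb X e (pos h)) - \<eta> * (1/2) ^ turns h \<le> u y"
    "n \<le> turns h \<Longrightarrow> N y < N (pos h)"
proof -
  have "\<exists>y. y \<in> nb X e (pos h) \<and>
     (if turns h < n then Sup (u ` nb X e (pos h)) - \<eta> * (1/2) ^ turns h \<le> u y else N y < N (pos h))"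
  proof (cases "turns h < n")
    case True
    have "Sup (u ` nb X e (pos h)) - \<eta> * (1/2) ^ turns h < Sup (u ` nb X e (pos h))" using \<eta> by simp
    then obtain y where "y \<in> nb X e (pos h)" "Sup (u ` nb X e (pos h)) - \<eta> * (1/2) ^ turns h < u y"
      using nb_self[OF e_pos, of "pos h" X] h by (subst (asm) less_cSUP_iff) (use bdd_nb[OF bu] in auto)
    then show ?thesis using True by (auto intro: less_imp_le)
  qed (use N_descent[OF h] in auto)
  from someI_ex[OF this] y
  show "y \<in> nb X e (pos h)" "turns h < n \<Longrightarrow> Sup (u ` nb X e (pos h)) - \<eta> * (1/2) ^ turns h \<le> u y"
    "n \<le> turns h \<Longrightarrow> N y < N (pos h)"
    by (auto simp: horizon_strategy_def)
qed

lemma horizon_strategy_in: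
  assumes "bounded (u ` X)" "0 < \<eta>"
  shows "horizon_strategy u \<eta> n \<in> strategies X Y e"
  using horizon_strategy(1)[OF assms(1,2)] legal_play_in[of X Y e]
  by (fastforce simp: strategies_def legal_moves_eq_nb)

lemma horizon_strategy_terminates:
  assumes bu: "bounded (u ` X)" and \<eta>: "0 < \<eta>" and SII: "SII \<in> strategies X Y e" and x: "x \<in> X"
  shows "prob_space (terminal_law Y (horizon_strategy u \<eta> n) SII x)"
    "(\<lambda>m. measure_pmf.prob (play_after Y (horizon_strategy u \<eta> n) SII x m) {h. pos h \<notin> Y}) \<longlonglongrightarrow> 0"
proof -
  let ?S = "horizon_strategy u \<eta> n"
  have S: "?S \<in> strategies X Y e" by (rule horizon_strategy_in[OF bu \<eta>])
  \<comment> \<open>Before the horizon the last summand falls by \<open>2 ^ (K + 1)\<close> per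
    turn, enough for any rise of the hop barrier. Afterwards the barrier falls by at least 1 on
    average and the middle summand rises by 1. Both differences of natural numbers are truncated at
    0.\<close>
  define l where "l h = hop_barrier K (N (pos h)) + real (turns h - n) + 2 ^ (K + 1) * real (n - turns h)" for h
  have l0: "0 \<le> l h" for h by (simp add: l_def hop_barrier_nonneg)
  have step: "turn_avg ?S SII (\<lambda>h. ennreal (l h)) h \<le> ennreal (l h)" if h: "legal_play X Y e h" "pos h \<notin> Y" for h
  proof (cases "turns h < n")
    case True
    have "l (Turn h d y) \<le> l h" for d y
    proof -
      have "real (n - turns h) = real (n - Suc (turns h)) + 1" using True by auto
      then have "(2::real) ^ (K + 1) * real (n - turns h) = 2 ^ (K + 1) * real (n - Suc (turns h)) + 2 ^ (K + 1)"
        by (simp only: distrib_left mult_1_right)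
      moreover have "real (Suc (turns h) - n) = 0" "real (turns h - n) = 0" using True by auto
      ultimately show ?thesis
        using hop_barrier_le[of K "N y"] hop_barrier_nonneg[of K "N (pos h)"] unfolding l_def pos.simps turns.simps by linarith
    qed
    then show ?thesis by (intro turn_avg_le[where a = "l h" and b = "l h"] ennreal_leI l0) auto
  next
    case False
    have px: "pos h \<in> X - Y" using legal_play_in[OF h(1)] h(2) by auto
    define r where "r = real (turns h - n) + 1"
    have tt: "real (Suc (turns h) - n) = r" "real (n - Suc (turns h)) = 0" "real (n - turns h) = 0" "real (turns h - n) = r - 1" "0 \<le> r"
      using False by (auto simp: r_def of_nat_diff)
    have hN: "0 < N (pos h)" using N_descent[OF px] by auto
    have any: "l (Turn h d y) \<le> hop_barrier K K + r" if "y \<in> set_pmf (SII h)" for d y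
      using hop_barrier_mono[OF N_le, of y K] strategies_moves[OF SII h that] nb_sub[of X e "pos h"]
      by (auto simp: l_def tt)
    have mine: "l (Turn h d y) \<le> hop_barrier K (N (pos h) - 1) + r" if "y \<in> set_pmf (?S h)" for d y
      using hop_barrier_mono[of "N y" "N (pos h) - 1" K] horizon_strategy(3)[OF bu \<eta> px that] False
      by (auto simp: l_def tt)
    have "hop_barrier K (N (pos h) - 1) / 2 + hop_barrier K K / 2 + 1 \<le> hop_barrier K (N (pos h))"
      using hop_barrier_step[of "N (pos h) - 1" "N (pos h)" K] hN N_le[of "pos h"] px by (simp add: add_divide_distrib)
    moreover have "l h = hop_barrier K (N (pos h)) + r - 1" by (simp add: l_def tt)
    ultimately have sum: "(hop_barrier K (N (pos h) - 1) + r) + (hop_barrier K K + r) \<le> 2 * l h" by simp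
    show ?thesis
    proof (rule turn_avg_le[OF _ _ _ _ sum])
      show "ennreal (l (Turn h True y)) \<le> ennreal (hop_barrier K (N (pos h) - 1) + r)" if "y \<in> set_pmf (?S h)" for y
        by (rule ennreal_leI[OF mine[OF that]])
      show "ennreal (l (Turn h False y)) \<le> ennreal (hop_barrier K K + r)" if "y \<in> set_pmf (SII h)" for y
        by (rule ennreal_leI[OF any[OF that]])
    qed (use hop_barrier_nonneg tt in \<open>auto intro!: add_nonneg_nonneg\<close>)
  qed
  have big: "ennreal (1 * real (turns h)) \<le> ennreal (l h) + ennreal (real n)" for h
  proof -
    have "0 \<le> (2::real) ^ (K + 1) * real (n - turns h)" "real (turns h) \<le> real (turns h - n) + real n" by auto
    then have "1 * real (turns h) \<le> l h + real n"
      using hop_barrier_nonneg[of K "N (pos h)"] unfolding l_def by linarith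
    then show ?thesis using l0[of h] by (simp add: ennreal_leI ennreal_plus[symmetric] del: ennreal_plus)
  qed
  show "prob_space (terminal_law Y ?S SII x)"
    by (rule prob_space_terminal_law(1)[OF S SII x step _ big _ order_refl l0]) auto
  show "(\<lambda>m. measure_pmf.prob (play_after Y ?S SII x m) {h. pos h \<notin> Y}) \<longlonglongrightarrow> 0"
    by (rule prob_space_terminal_law(2)[OF S SII x step _ big _ order_refl l0]) auto
qed

text \<open>Discounting \<open>u + R\<close> by \<open>1 - q\<^sup>k\<close>, where \<open>k\<close> is the number of turns left before the horizon,
  keeps it a subsolution, because the running payoff is bounded below. At the horizon nothing is
  left to be collected, so that player I can afford to end the game in any way.\<close>

lemma horizon_potential:
  assumes u: "\<And>x. x \<in> X \<Longrightarrow> \<bar>u x\<bar> \<le> R" and R: "0 < R" and F: "\<And>x. x \<in> Y \<Longrightarrow> \<bar>F x\<bar> \<le> R"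
    and uF: "\<And>x. x \<in> Y \<Longrightarrow> u x \<le> F x"
    and sub: "\<And>x. x \<in> X - Y \<Longrightarrow> u x \<le> midrange X e u x + e\<^sup>2 * f x"
    and c: "0 < c" "\<And>x. x \<in> X - Y \<Longrightarrow> c \<le> f x" and G: "\<And>x. x \<in> X - Y \<Longrightarrow> f x \<le> G" and \<eta>: "0 < \<eta>"
    and q: "q = 2 * R / (2 * R + e\<^sup>2 * c)" 
    and SII: "SII \<in> strategies X Y e"
    and \<Psi>: "\<And>h. \<Psi> h = (if pos h \<in> Y then F (pos h) + R else (1 - q ^ (n - turns h)) * (u (pos h) + R))
        + min (e\<^sup>2 * running_sum f h) (e\<^sup>2 * (real n * G)) + \<eta> * (2 - (1/2) ^ turns h)"
    and h: "legal_play X Y e h" "pos h \<notin> Y"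
  shows "ennreal (\<Psi> h) \<le> turn_avg (horizon_strategy u \<eta> n) SII (\<lambda>h. ennreal (\<Psi> h)) h"
proof -
  let ?S = "horizon_strategy u \<eta> n"
  have bu: "bounded (u ` X)" by (rule bounded_image_realI) (rule u)
  have S: "?S \<in> strategies X Y e" by (rule horizon_strategy_in[OF bu \<eta>])
  have px: "pos h \<in> X - Y" "pos h \<in> X" using legal_play_in[OF h(1)] h(2) by auto
  have ec: "0 < e\<^sup>2 * c" using e_pos c by simp
  have q01: "0 < q" "q < 1" using R ec by (auto simp: q field_simps)
  have u0: "0 \<le> u y + R" if "y \<in> X" for y using u[OF that] by (simp add: abs_le_iff)
  have G0: "0 \<le> G" using c(1) c(2)[OF px(1)] G[OF px(1)] by linarith
  have rs: "0 \<le> running_sum f h" "running_sum f h \<le> real (turns h) * G"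
  proof -
    show "0 \<le> running_sum f h" by (rule running_sum_nonneg[OF h(1)]) (use c in force)
    have "running_sum f h \<le> running_sum (\<lambda>_. G) h" by (rule running_sum_mono[OF h(1) G])
    moreover have "running_sum (\<lambda>_. G) h' = real (turns h') * G" for h' :: "'a play"
      by (induction h') (auto simp: algebra_simps)
    ultimately show "running_sum f h \<le> real (turns h) * G" by simp
  qed
  define p where "p = \<eta> * (1/2) ^ turns h"
  have p: "0 \<le> p" "p \<le> \<eta>" using \<eta> by (auto simp: p_def power_le_one)
  define r where "r = e\<^sup>2 * running_sum f h"
  define g where "g = e\<^sup>2 * f (pos h)"
  define l where "l = e\<^sup>2 * (real n * G)"
  have r0: "0 \<le> r" and g0: "0 \<le> g" and l0: "0 \<le> l" using rs c(1) c(2)[OF px(1)] G0 by (auto simp: r_def g_def l_def)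
  have mv: "y \<in> nb X e (pos h) \<and> y \<in> X" if "y \<in> set_pmf (?S h) \<or> y \<in> set_pmf (SII h)" for y
    using strategies_moves[OF S h] strategies_moves[OF SII h] that nb_sub[of X e "pos h"] by blast
  show ?thesis
  proof (cases "turns h < n")
    case True
    define k where "k = n - Suc (turns h)"
    have k: "n - turns h = Suc k" "n - Suc (turns h) = k" using True by (auto simp: k_def)
    define \<theta> where "\<theta> = 1 - q ^ k"
    have \<theta>: "0 \<le> \<theta>" "\<theta> \<le> 1" using q01 by (auto simp: \<theta>_def power_le_one)
    define s where "s = Sup (u ` nb X e (pos h))"
    define i where "i = Inf (u ` nb X e (pos h))"
    \<comment> \<open>Before the horizon the cap \<open>e\<^sup>2 * (real n * G)\<close> in
      \<open>\<Psi>\<close> is inactive, even after the coming turn. Its purpose is to keep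
      \<open>\<Psi>\<close> bounded later on.\<close>
    have "(1 + real (turns h)) * G \<le> real n * G" using True G0 by (intro mult_right_mono) auto
    then have "running_sum f h + f (pos h) \<le> real n * G"
      using rs G[OF px(1)] by (simp add: algebra_simps)
    then have "e\<^sup>2 * (running_sum f h + f (pos h)) \<le> l"
      unfolding l_def by (rule mult_left_mono) simp
    then have rgl: "r + g \<le> l" by (simp add: r_def g_def distrib_left)
    have next': "\<theta> * (u y + R) + r + g + 2 * \<eta> - p / 2 \<le> \<Psi> (Turn h d y)" if "y \<in> X" for d y
    proof -
      have "\<theta> * (u y + R) \<le> (if y \<in> Y then F y + R else \<theta> * (u y + R))"
      proof (cases "y \<in> Y")
        case True
        have "\<theta> * (u y + R) \<le> 1 * (u y + R)" using \<theta> u0[OF that] by (intro mult_right_mono)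
        then show ?thesis using uF[OF True] True by simp
      qed simp
      moreover have "min (e\<^sup>2 * running_sum f (Turn h d y)) (e\<^sup>2 * (real n * G)) = r + g"
        using rgl by (simp add: r_def g_def l_def distrib_left)
      moreover have "\<eta> * (2 - (1/2) ^ turns (Turn h d y)) = 2 * \<eta> - p / 2"
        by (simp add: p_def algebra_simps)
      ultimately show ?thesis unfolding \<Psi> by (cases "y \<in> Y") (simp_all add: \<theta>_def k)
    qed
    have Ru: "- R \<le> i" unfolding i_def
      by (rule Inf_nb_ge[OF e_pos px(2)]) (use u nb_sub abs_le_iff minus_le_iff in blast)
    have i_le_s: "i \<le> s" unfolding i_def s_def
      using Inf_nb_le[OF bu nb_self[OF e_pos px(2)]] Sup_nb_ge[OF bu nb_self[OF e_pos px(2)]] by linarith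
    define A where "A = \<theta> * (s + R) - p + r + g + 2 * \<eta> - p / 2"
    define B where "B = \<theta> * (i + R) + r + g + 2 * \<eta> - p / 2"
    have AB0: "0 \<le> A" "0 \<le> B"
      using mult_nonneg_nonneg[OF \<theta>(1), of "s + R"] mult_nonneg_nonneg[OF \<theta>(1), of "i + R"] Ru i_le_s p r0 g0
      unfolding A_def B_def by linarith+
    have mine: "A \<le> \<Psi> (Turn h d y)" if y: "y \<in> set_pmf (?S h)" for d y
    proof -
      have "s - p \<le> u y" unfolding s_def p_def by (rule horizon_strategy(2)[OF bu \<eta> px(1) y True])
      then have "\<theta> * (s + R) - \<theta> * p \<le> \<theta> * (u y + R)"
        using mult_left_mono[OF _ \<theta>(1), of "s + R - p" "u y + R"] by (simp add: algebra_simps)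
      moreover have "\<theta> * p \<le> p" using mult_right_mono[OF \<theta>(2) p(1)] by simp
      ultimately show ?thesis using next'[of y d] mv y unfolding A_def by force
    qed
    have any: "B \<le> \<Psi> (Turn h d y)" if y: "y \<in> set_pmf (SII h)" for d y
    proof -
      have "i \<le> u y" unfolding i_def using mv y by (intro Inf_nb_le[OF bu]) auto
      then have "\<theta> * (i + R) \<le> \<theta> * (u y + R)" by (intro mult_left_mono \<theta>) simp
      then show ?thesis using next'[of y d] mv y unfolding B_def by force
    qed
    have "2 * u (pos h) \<le> s + i + 2 * g"
      using sub[OF px(1)] midrange_double[of X e u "pos h"] unfolding s_def i_def g_def by simp
    then have "\<theta> * (2 * (u (pos h) + R)) \<le> \<theta> * ((s + R) + (i + R) + 2 * g)"
      by (intro mult_left_mono \<theta>) simp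
    then have 1: "2 * (\<theta> * (u (pos h) + R)) \<le> \<theta> * (s + R) + \<theta> * (i + R) + 2 * (\<theta> * g)"
      by (simp add: algebra_simps)
    have "(1 - q) * (u (pos h) + R) \<le> (1 - q) * (2 * R)"
      using q01 u[OF px(2)] by (intro mult_left_mono) (auto simp: abs_le_iff)
    also have "(1 - q) * (2 * R) = q * (e\<^sup>2 * c)" using R ec by (simp add: q field_simps)
    also have "\<dots> \<le> 1 * (e\<^sup>2 * c)" using q01 ec by (intro mult_right_mono) auto
    also have "\<dots> \<le> g" unfolding g_def mult_1 using c(2)[OF px(1)] by (intro mult_left_mono) auto
    finally have "q ^ k * ((1 - q) * (u (pos h) + R)) \<le> q ^ k * g"
      using q01 by (intro mult_left_mono) auto
    then have 2: "(1 - q ^ Suc k) * (u (pos h) + R) - \<theta> * (u (pos h) + R) \<le> g - \<theta> * g"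
      by (simp add: \<theta>_def algebra_simps)
    have "min r l = r" using rgl g0 by simp
    then have "\<Psi> h = (1 - q ^ Suc k) * (u (pos h) + R) + r + 2 * \<eta> - p"
      using h(2) unfolding \<Psi>[of h] k by (simp add: r_def l_def p_def algebra_simps)
    then have sum: "2 * \<Psi> h \<le> A + B" using 1 2 unfolding A_def B_def by linarith
    show ?thesis
      by (rule turn_avg_ge[OF _ _ AB0 sum]) (auto intro!: ennreal_leI mine any)
  next
    case False
    \<comment> \<open>From the horizon on the exponent is 0 and the term in \<open>u\<close> has
      vanished. Any legal move is good enough, because a boundary term \<open>F y + R\<close> is
      nonnegative.\<close>
    have \<Psi>h: "\<Psi> h = min r l + (2 * \<eta> - p)"
      using h(2) False unfolding \<Psi>[of h] by (simp add: r_def l_def p_def algebra_simps)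
    have next': "\<Psi> h \<le> \<Psi> (Turn h d y)" if "y \<in> X" for d y
    proof -
      define T where "T = (if y \<in> Y then F y + R else (1 - q ^ (n - Suc (turns h))) * (u y + R))"
      have "0 \<le> T" unfolding T_def
        using u0[OF that] F[of y] False by (auto simp: abs_le_iff)
      have "\<Psi> (Turn h d y) = T + min (r + g) l + (2 * \<eta> - p / 2)"
        unfolding \<Psi> T_def by (simp add: r_def g_def l_def p_def distrib_left right_diff_distrib)
      moreover have "min r l \<le> min (r + g) l" using g0 by simp
      ultimately show ?thesis using \<open>0 \<le> T\<close> p unfolding \<Psi>h by simp
    qed
    have "0 \<le> \<Psi> h" unfolding \<Psi>h using p r0 l0 by simp
    then show ?thesis
      by (intro turn_avg_ge[where a = "\<Psi> h" and b = "\<Psi> h"]) (use mv next' in \<open>auto intro!: ennreal_leI\<close>)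
  qed
qed

text \<open>The submartingale \<open>\<Psi>\<close> is bounded by \<open>D\<close>, so unfinished
  plays contribute at most \<open>D\<close> times a probability that tends to 0, and the starting
  value of \<open>\<Psi>\<close> passes to the mean payoff in the limit.\<close>

lemma value_I_ge:
  assumes u: "\<And>x. x \<in> X \<Longrightarrow> \<bar>u x\<bar> \<le> R" and R: "0 < R" and F: "\<And>x. x \<in> Y \<Longrightarrow> \<bar>F x\<bar> \<le> R"
    and uF: "\<And>x. x \<in> Y \<Longrightarrow> u x \<le> F x"
    and sub: "\<And>x. x \<in> X - Y \<Longrightarrow> u x \<le> midrange X e u x + e\<^sup>2 * f x"
    and c: "0 < c" "\<And>x. x \<in> X - Y \<Longrightarrow> c \<le> f x" and G: "\<And>x. x \<in> X - Y \<Longrightarrow> f x \<le> G" and x: "x \<in> X"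
  shows "ereal (u x) \<le> value_I X Y F f e x"
proof (rule ereal_le_epsilon2)
  fix d :: real assume d: "0 < d"
  \<comment> \<open>Half of the tolerance \<open>d\<close> goes to the initial discount
    \<open>q ^ n * (2 * R)\<close>, the other half to the total error \<open>2 * \<eta>\<close> of
    the near-maximizing moves.\<close>
  define \<eta> where "\<eta> = d / 4"
  have \<eta>: "0 < \<eta>" using d by (simp add: \<eta>_def)
  define q where "q = 2 * R / (2 * R + e\<^sup>2 * c)"
  have ec: "0 < e\<^sup>2 * c" using e_pos c by simp
  have q01: "0 < q" "q < 1" using R ec by (auto simp: q_def field_simps)
  have "(\<lambda>n. q ^ n * (2 * R)) \<longlonglongrightarrow> 0 * (2 * R)"
    by (intro tendsto_mult tendsto_const LIMSEQ_power_zero) (use q01 in auto)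
  then have "\<forall>\<^sub>F n in sequentially. q ^ n * (2 * R) < d / 2"
    using d by (intro order_tendstoD) auto
  then have "\<forall>\<^sub>F n in sequentially. 0 < n \<and> q ^ n * (2 * R) < d / 2"
    using eventually_gt_at_top[of 0] by eventually_elim simp
  then obtain n where n: "0 < n" "q ^ n * (2 * R) < d / 2" by (auto simp: eventually_sequentially)
  have bu: "bounded (u ` X)" by (rule bounded_image_realI) (rule u)
  let ?S = "horizon_strategy u \<eta> n"
  have S: "?S \<in> strategies X Y e" by (rule horizon_strategy_in[OF bu \<eta>])
  define \<Psi> where "\<Psi> h = (if pos h \<in> Y then F (pos h) + R else (1 - q ^ (n - turns h)) * (u (pos h) + R))
        + min (e\<^sup>2 * running_sum f h) (e\<^sup>2 * (real n * \<bar>G\<bar>)) + \<eta> * (2 - (1/2) ^ turns h)" for h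
  \<comment> \<open>The absolute value keeps the cap nonnegative: nothing is known about the sign of
    \<open>G\<close> if \<open>X - Y\<close> is empty.\<close>
  have G': "f x \<le> \<bar>G\<bar>" if "x \<in> X - Y" for x using G[OF that] by simp
  have u0: "0 \<le> u y + R" if "y \<in> X" for y using u[OF that] by (simp add: abs_le_iff)
  have "ereal (u x - d) \<le> F_minus Y F f e x ?S SII" if SII: "SII \<in> strategies X Y e" for SII
  proof -
    let ?P = "play_after Y ?S SII x"
    interpret T: prob_space "terminal_law Y ?S SII x"
      by (rule horizon_strategy_terminates(1)[OF bu \<eta> SII x])
    have nt: "(\<lambda>m. measure_pmf.prob (?P m) {h. pos h \<notin> Y}) \<longlonglongrightarrow> 0"
      by (rule horizon_strategy_terminates(2)[OF bu \<eta> SII x])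
    define D where "D = 2 * R + e\<^sup>2 * (real n * \<bar>G\<bar>) + 2 * \<eta>"
    have D0: "0 \<le> D" using R \<eta> by (simp add: D_def)
    have D: "\<Psi> h \<le> D" if h: "legal_play X Y e h" for h
    proof -
      have "(if pos h \<in> Y then F (pos h) + R else (1 - q ^ (n - turns h)) * (u (pos h) + R)) \<le> 2 * R"
      proof (cases "pos h \<in> Y")
        case False
        have "(1 - q ^ (n - turns h)) * (u (pos h) + R) \<le> 1 * (u (pos h) + R)"
          using q01 u0[OF legal_play_in[OF h]] by (intro mult_right_mono) auto
        then show ?thesis using u[OF legal_play_in[OF h]] False by (simp add: abs_le_iff)
      qed (use F in \<open>auto simp: abs_le_iff\<close>)
      moreover have "\<eta> * (2 - (1/2) ^ turns h) \<le> \<eta> * 2" using \<eta> by (intro mult_left_mono) auto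
      ultimately show ?thesis unfolding \<Psi>_def D_def by (simp add: min_le_iff_disj)
    qed
    have pay: "- R \<le> payoff F f e h" "\<Psi> h \<le> payoff F f e h + (R + 2 * \<eta>)" if h: "legal_play X Y e h" "pos h \<in> Y" for h
    proof -
      have "0 \<le> running_sum f h" by (rule running_sum_nonneg[OF h(1)]) (use c in force)
      then have "0 \<le> e\<^sup>2 * running_sum f h" by simp
      then show "- R \<le> payoff F f e h" using F[OF h(2)] by (simp add: payoff_def abs_le_iff)
      have "\<eta> * (2 - (1/2) ^ turns h) \<le> \<eta> * 2" using \<eta> by (intro mult_left_mono) auto
      then show "\<Psi> h \<le> payoff F f e h + (R + 2 * \<eta>)" using h(2) unfolding \<Psi>_def payoff_def by simp
    qed
    let ?I = "\<integral>\<^sup>+h. ennreal (payoff F f e h + (R + 2 * \<eta>)) \<partial>terminal_law Y ?S SII x"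
    have I: "ennreal (\<Psi> (Start x)) \<le> ?I + ennreal (D * measure_pmf.prob (?P m) {h. pos h \<notin> Y})" for m
    proof -
      have "ennreal (\<Psi> (Start x)) \<le> (\<integral>\<^sup>+h. ennreal (\<Psi> h) \<partial>?P m)"
        by (rule nn_integral_play_after_ge[OF S SII x])
          (rule horizon_potential[OF u R F uF sub c G' \<eta> q_def SII \<Psi>_def])
      also have "\<dots> \<le> (\<integral>\<^sup>+h. ennreal (payoff F f e h + (R + 2 * \<eta>)) * indicator {h. pos h \<in> Y} h
          + ennreal D * indicator {h. pos h \<notin> Y} h \<partial>?P m)"
        by (intro nn_integral_mono_AE, unfold AE_measure_pmf_iff, intro ballI)
          (use pay D legal_play_after[OF S SII x] in \<open>auto simp: indicator_def intro!: ennreal_leI\<close>)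
      also have "\<dots> = (\<integral>\<^sup>+h. ennreal (payoff F f e h + (R + 2 * \<eta>)) * indicator {h. pos h \<in> Y} h \<partial>?P m)
          + ennreal D * emeasure (?P m) {h. pos h \<notin> Y}"
        by (subst nn_integral_add) (auto simp: nn_integral_cmult_indicator)
      also have "\<dots> \<le> ?I + ennreal D * emeasure (?P m) {h. pos h \<notin> Y}"
        unfolding nn_integral_terminal_law by (intro add_right_mono SUP_upper) simp
      finally show ?thesis using D0 by (simp add: measure_pmf.emeasure_eq_measure ennreal_mult')
    qed
    have I': "ennreal (\<Psi> (Start x)) \<le> ?I"
    proof (rule ennreal_le_epsilon)
      fix s :: real assume s: "0 < s"
      have "(\<lambda>m. D * measure_pmf.prob (?P m) {h. pos h \<notin> Y}) \<longlonglongrightarrow> D * 0"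
        by (intro tendsto_mult tendsto_const nt)
      then have "\<forall>\<^sub>F m in sequentially. D * measure_pmf.prob (?P m) {h. pos h \<notin> Y} < s"
        using s by (intro order_tendstoD) auto
      then obtain m where m: "D * measure_pmf.prob (?P m) {h. pos h \<notin> Y} < s"
        by (auto simp: eventually_sequentially)
      have "ennreal (D * measure_pmf.prob (?P m) {h. pos h \<notin> Y}) \<le> ennreal s"
        using m by (intro ennreal_leI) simp
      then show "ennreal (\<Psi> (Start x)) \<le> ?I + ennreal s"
        using I[of m] add_left_mono order_trans by blast
    qed
    have "(u x - d) + (R + 2 * \<eta>) \<le> \<Psi> (Start x)"
    proof -
      have "q ^ n * (u x + R) \<le> q ^ n * (2 * R)" using q01 u[OF x] by (intro mult_left_mono) (auto simp: abs_le_iff)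
      then have 1: "u x + R - d / 2 \<le> (1 - q ^ n) * (u x + R)" using n(2) by (simp add: algebra_simps)
      have "(1 - q ^ n) * (u x + R) \<le> (if x \<in> Y then F x + R else (1 - q ^ n) * (u x + R))"
      proof (cases "x \<in> Y")
        case True
        have "(1 - q ^ n) * (u x + R) \<le> 1 * (u x + R)" using q01 u0[OF x] by (intro mult_right_mono) auto
        then show ?thesis using uF[OF True] True by simp
      qed simp
      then show ?thesis using 1 d by (cases "x \<in> Y") (simp_all add: \<Psi>_def \<eta>_def)
    qed
    then have le: "ennreal ((u x - d) + (R + 2 * \<eta>)) \<le> ?I" using I' ennreal_leI order_trans by blast
    have ae: "AE h in terminal_law Y ?S SII x. - (R + 2 * \<eta>) \<le> payoff F f e h"
      using AE_terminal_law[OF S SII x] by eventually_elim (use pay \<eta> in force)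
    show ?thesis
      using T.ext_expectation_ge[OF terminal_law_borel ae le] T.prob_space_axioms
      by (simp add: F_minus_def outcome_defined_def)
  qed
  then have "ereal (u x - d) \<le> value_I X Y F f e x"
    unfolding value_I_def by (intro SUP_upper2[OF S] INF_greatest)
  then have "ereal (u x - d) + ereal d \<le> value_I X Y F f e x + ereal d" by (rule add_right_mono)
  then show "ereal (u x) \<le> value_I X Y F f e x + ereal d" by simp
qed

text \<open>A constant running payoff \<open>s > 0\<close> moves the solution up by at most
  \<open>m\<close> if \<open>s\<close> is small: \<open>weak_comparison\<close> applies with the new
  solution as subsolution and \<open>u\<close> as supersolution.\<close>

lemma dpp_small_payoff:
  assumes u: "\<And>x. x \<in> X \<Longrightarrow> \<bar>u x\<bar> \<le> R" and F: "\<And>x. x \<in> Y \<Longrightarrow> \<bar>F x\<bar> \<le> R" and R: "0 \<le> R"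
    and uF: "\<And>x. x \<in> Y \<Longrightarrow> u x = F x" and dpp: "\<And>x. x \<in> X - Y \<Longrightarrow> u x = midrange X e u x" and m: "0 < m"
  shows "\<exists>v s S. 0 < s \<and> R \<le> S \<and> (\<forall>x\<in>X. \<bar>v x\<bar> \<le> S \<and> v x \<le> u x + m) \<and>
    (\<forall>x\<in>Y. v x = F x) \<and> (\<forall>x\<in>X - Y. v x = midrange X e v x + e\<^sup>2 * s)"
proof -
  define S where "S = R + e\<^sup>2 * 2 ^ (K + 1)"
  have S: "0 \<le> S" "R \<le> S" using R by (simp_all add: S_def)
  obtain d where d: "0 < d" and comp: "\<And>s Y' x. \<And>u v :: 'a \<Rightarrow> real.
       \<lbrakk>\<And>x. x \<in> X \<Longrightarrow> \<bar>u x\<bar> \<le> S; bounded (v ` X); Y \<subseteq> Y';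
        \<And>x. x \<in> X - Y' \<Longrightarrow> u x \<le> midrange X e u x + s; \<And>x. x \<in> X - Y' \<Longrightarrow> midrange X e v x \<le> v x;
        \<And>x. x \<in> Y' \<inter> X \<Longrightarrow> u x \<le> v x; s \<le> d; x \<in> X\<rbrakk> \<Longrightarrow> u x \<le> v x + m"
    using weak_comparison[OF m S(1)] by blast
  \<comment> \<open>The tolerance \<open>d\<close> depends on the bound \<open>S\<close>; with
    \<open>s \<le> 1\<close> that bound could be fixed before \<open>s\<close>.\<close>
  define s where "s = min 1 (d / e\<^sup>2)"
  have s: "0 < s" "s \<le> 1" "e\<^sup>2 * s \<le> d" using d e_pos by (auto simp: s_def min_def field_simps)
  obtain v where v: "\<And>x. x \<in> X \<Longrightarrow> \<bar>v x\<bar> \<le> R + e\<^sup>2 * 2 ^ (K + 1)" "\<And>x. x \<in> Y \<Longrightarrow> v x = F x"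
    "\<And>x. x \<in> X - Y \<Longrightarrow> v x = midrange X e v x + e\<^sup>2 * s"
    using dpp_exists[of F R "\<lambda>_. e\<^sup>2 * s" "e\<^sup>2"] F R s by (auto simp: mult_left_le)
  have bu: "bounded (u ` X)" by (rule bounded_image_realI) (rule u)
  have "v x \<le> u x + m" if "x \<in> X" for x
    by (rule comp[of v u Y "e\<^sup>2 * s"]) (use v bu dpp uF s that in \<open>auto simp: S_def\<close>)
  then show ?thesis using s v S by (intro exI[of _ v] exI[of _ s] exI[of _ S]) (simp add: S_def)
qed

theorem game_value:
  assumes u: "\<And>x. x \<in> X \<Longrightarrow> \<bar>u x\<bar> \<le> R" and F: "\<And>x. x \<in> Y \<Longrightarrow> \<bar>F x\<bar> \<le> R" and R: "0 \<le> R"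
    and uF: "\<And>x. x \<in> Y \<Longrightarrow> u x = F x" and dpp: "\<And>x. x \<in> X - Y \<Longrightarrow> u x = midrange X e u x + e\<^sup>2 * f x"
    and f: "(\<forall>x\<in>X - Y. f x = 0) \<or> (\<exists>c>0. \<forall>x\<in>X - Y. c \<le> f x \<and> f x \<le> G)" and x: "x \<in> X"
  shows "value_I X Y F f e x = ereal (u x)" "value_II X Y F f e x = ereal (u x)"
proof -
  have "ereal (u x) \<le> value_I X Y F f e x \<and> value_II X Y F f e x \<le> ereal (u x)"
    using f
  proof
    assume "\<exists>c>0. \<forall>x\<in>X - Y. c \<le> f x \<and> f x \<le> G"
    then obtain c where c: "0 < c" "\<And>x. x \<in> X - Y \<Longrightarrow> c \<le> f x" "\<And>x. x \<in> X - Y \<Longrightarrow> f x \<le> G" by blast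
    have f0: "\<And>x. x \<in> X - Y \<Longrightarrow> 0 \<le> f x \<and> f x \<le> f x" using c(1,2) by force
    have "value_II X Y F f e x \<le> ereal (u x)"
      by (rule value_II_le[OF u F _ _ c(1,2) f0 x]) (simp_all add: uF dpp[symmetric])
    moreover have "ereal (u x) \<le> value_I X Y F f e x"
    \<comment> \<open>The bound is raised to \<open>R + 1\<close> because the discount factor needs
      a positive one.\<close>
    proof (rule value_I_ge[of u "R + 1", OF _ _ _ _ _ c x])
      show "\<bar>u y\<bar> \<le> R + 1" if "y \<in> X" for y using u[OF that] by simp
      show "\<bar>F y\<bar> \<le> R + 1" if "y \<in> Y" for y using F[OF that] by simp
      show "u y \<le> midrange X e u y + e\<^sup>2 * f y" if "y \<in> X - Y" for y using dpp[OF that] by simp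
    qed (use R uF in auto)
    ultimately show ?thesis by simp
  next
    assume f0: "\<forall>x\<in>X - Y. f x = 0"
    have dpp0: "\<And>x. x \<in> X - Y \<Longrightarrow> u x = midrange X e u x" using dpp f0 by simp
    have "value_II X Y F f e x \<le> ereal (u x) + ereal m" if m: "0 < m" for m
    proof -
      obtain v s S where v: "0 < s" "R \<le> S" "\<forall>x\<in>X. \<bar>v x\<bar> \<le> S \<and> v x \<le> u x + m"
        "\<forall>x\<in>Y. v x = F x" "\<forall>x\<in>X - Y. v x = midrange X e v x + e\<^sup>2 * s"
        using dpp_small_payoff[OF u F R uF dpp0 m] by metis
      have "value_II X Y F f e x \<le> ereal (v x)"
      proof (rule value_II_le[of v S F "\<lambda>_. s" s f])
        show "\<bar>F y\<bar> \<le> S" if "y \<in> Y" for y using F[OF that] v(2) by simp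
        show "midrange X e v y + e\<^sup>2 * s \<le> v y" if "y \<in> X - Y" for y using v(5) that by auto
      qed (use v(1,3,4) f0 x in auto)
      also have "\<dots> \<le> ereal (u x) + ereal m" using v(3) x by auto
      finally show ?thesis .
    qed
    then have "value_II X Y F f e x \<le> ereal (u x)" by (rule ereal_le_epsilon2)
    moreover have "ereal (u x) \<le> value_I X Y F f e x + ereal m" if m: "0 < m" for m
    proof -
      have d: "- u x = midrange X e (\<lambda>y. - u y) x" if "x \<in> X - Y" for x
        using dpp0[OF that] by (simp add: midrange_uminus)
      have "\<exists>v s S. 0 < s \<and> R \<le> S \<and> (\<forall>x\<in>X. \<bar>v x\<bar> \<le> S \<and> v x \<le> - u x + m) \<and>
          (\<forall>x\<in>Y. v x = - F x) \<and> (\<forall>x\<in>X - Y. v x = midrange X e v x + e\<^sup>2 * s)"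
        by (rule dpp_small_payoff[of "\<lambda>y. - u y" R "\<lambda>y. - F y" m]) (use u F R uF d m in auto)
      then obtain v s S where v: "0 < s" "R \<le> S" "\<forall>x\<in>X. \<bar>v x\<bar> \<le> S \<and> v x \<le> - u x + m"
        "\<forall>x\<in>Y. v x = - F x" "\<forall>x\<in>X - Y. v x = midrange X e v x + e\<^sup>2 * s"
        by metis
      have "ereal (- v x) \<le> value_I X Y F f e x"
      proof (rule value_I_ge_zero_payoff[of v S F "\<lambda>_. s" s f])
        show "\<bar>F y\<bar> \<le> S" if "y \<in> Y" for y using F[OF that] v(2) by simp
        show "midrange X e v y + e\<^sup>2 * s \<le> v y" if "y \<in> X - Y" for y using v(5) that by auto
      qed (use v(1,3,4) f0 x in auto)
      then have "ereal (- v x) + ereal m \<le> value_I X Y F f e x + ereal m" by (rule add_right_mono)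
      moreover have "ereal (u x) \<le> ereal (- v x) + ereal m" using v(3) x by auto
      ultimately show ?thesis by (rule order_trans[rotated])
    qed
    then have "ereal (u x) \<le> value_I X Y F f e x" by (rule ereal_le_epsilon2)
    ultimately show ?thesis by simp
  qed
  then show "value_I X Y F f e x = ereal (u x)" "value_II X Y F f e x = ereal (u x)"
    using value_I_le_value_II[of F f x] by (meson order_antisym order_trans)+
qed

end

section \<open>Boundary values\<close>

lemma segment_meets_frontier:
  fixes U :: "'a::real_normed_vector set"
  assumes "x \<in> U" "y \<notin> U"
  obtains z where "z \<in> closed_segment x y" "z \<in> frontier U"
proof -
  have "closed_segment x y \<inter> frontier U \<noteq> {}"
    by (rule connected_Int_frontier) (use assms in auto)
  then show thesis using that by blast
qed

lemma closed_segment_dist: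
  fixes x y z :: "'a::real_normed_vector"
  assumes "z \<in> closed_segment x y"
  shows "dist x z + dist z y = dist x y"
proof -
  obtain t where t: "0 \<le> t" "t \<le> 1" "z = (1 - t) *\<^sub>R x + t *\<^sub>R y" using assms by (auto simp: closed_segment_def)
  have eq: "x - z = t *\<^sub>R (x - y)" "z - y = (1 - t) *\<^sub>R (x - y)" by (simp_all add: t algebra_simps)
  show ?thesis unfolding dist_norm eq norm_scaleR using t(1,2) by (simp add: left_diff_distrib)
qed

lemma point_towards:
  fixes x z :: "'a::real_normed_vector"
  assumes "0 \<le> s" "s \<le> dist x z"
  obtains y where "dist y x = s" "dist y z = dist x z - s" "y \<in> closed_segment x z"
proof (cases "x = z")
  case True
  then show thesis using assms that[of x] by auto
next
  case False
  define t where "t = s / dist x z"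
  have t: "0 \<le> t" "t \<le> 1" using assms False by (auto simp: t_def divide_simps)
  define y where "y = (1 - t) *\<^sub>R x + t *\<^sub>R z"
  have y: "y \<in> closed_segment x z" using t by (auto simp: closed_segment_def y_def)
  have "y - x = t *\<^sub>R (z - x)" by (simp add: y_def algebra_simps)
  then have "dist y x = s" using assms(1) False by (simp add: dist_norm t_def norm_minus_commute)
  then show thesis using that[OF _ _ y] closed_segment_dist[OF y] by (simp add: dist_commute)
qed

section \<open>Hop counts and barriers in a bounded domain\<close>

locale bounded_domain =
  fixes U :: "'a::euclidean_space set"
  assumes open_U: "open U" and bounded_U: "bounded U" and nonempty_U: "U \<noteq> {}"
begin

lemma closure_minus_frontier: "closure U - frontier U = U"
  using open_U by (auto simp: frontier_def interior_open closure_subset[THEN subsetD])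

lemma frontier_sub: "frontier U \<subseteq> closure U"
  by (simp add: frontier_def)

lemma U_sub: "U \<subseteq> closure U"
  by (rule closure_subset)

lemma U_frontier_disjoint: "x \<in> U \<Longrightarrow> x \<notin> frontier U"
  using closure_minus_frontier by blast

lemma frontier_nonempty: "frontier U \<noteq> {}"
  using frontier_eq_empty[of U] nonempty_U bounded_U not_bounded_UNIV by auto

lemma compact_frontier': "compact (frontier U)"
  using bounded_U by (rule compact_frontier_bounded)

lemma diameter_bound:
  obtains D where "1 \<le> D" "\<And>x y. x \<in> closure U \<Longrightarrow> y \<in> closure U \<Longrightarrow> dist x y \<le> D"
proof -
  have "bounded (closure U)" using bounded_U by (rule bounded_closure)
  then obtain B where B: "\<And>x. x \<in> closure U \<Longrightarrow> norm x \<le> B" by (auto simp: bounded_iff)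
  have "dist x y \<le> max 1 (2 * B)" if "x \<in> closure U" "y \<in> closure U" for x y
    using norm_triangle_ineq4[of x y] B[OF that(1)] B[OF that(2)] by (simp add: dist_norm)
  then show thesis using that[of "max 1 (2 * B)"] by auto
qed

lemma tug_instance:
  assumes e: "0 < e"
  obtains N K where "tug_of_war (closure U) (frontier U) e N K"
proof -
  \<comment> \<open>Counts half steps: a move of length \<open>e / 2\<close> towards the nearest
    boundary point is legal, moves being shorter than \<open>e\<close>, and lowers the argument of
    the ceiling by at least 1.\<close>
  define N where "N x = nat \<lceil>2 * infdist x (frontier U) / e\<rceil>" for x
  obtain D where D: "1 \<le> D" "\<And>x y. x \<in> closure U \<Longrightarrow> y \<in> closure U \<Longrightarrow> dist x y \<le> D"
    using diameter_bound by blast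
  have "tug_of_war (closure U) (frontier U) e N (nat \<lceil>2 * D / e\<rceil>)"
  proof
    show "N x \<le> nat \<lceil>2 * D / e\<rceil>" if x: "x \<in> closure U" for x
    proof -
      obtain z where z: "z \<in> frontier U" using frontier_nonempty by blast
      have "infdist x (frontier U) \<le> D" using infdist_le[OF z, of x] D(2)[OF x, of z] frontier_sub z by auto
      then show ?thesis unfolding N_def using e by (intro nat_mono ceiling_mono divide_right_mono) auto
    qed
    fix x assume "x \<in> closure U - frontier U"
    then have x: "x \<in> U" using closure_minus_frontier by simp
    obtain z where z: "z \<in> frontier U" "infdist x (frontier U) = dist x z"
      using infdist_attains_inf[OF frontier_closed frontier_nonempty] by blast
    have d0: "0 < dist x z" using x z U_frontier_disjoint by auto
    show "\<exists>y\<in>nb (closure U) e x. N y < N x"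
    proof (cases "dist x z \<le> e / 2")
      case True
      have "N z < N x" unfolding N_def using z d0 e by simp
      moreover have "z \<in> nb (closure U) e x" using True e z frontier_sub by (auto simp: nb_def dist_commute)
      ultimately show ?thesis by blast
    next
      case False
      then obtain y where y: "dist y x = e / 2" "dist y z = dist x z - e / 2"
        using point_towards[of "e / 2" x z] e by auto
      \<comment> \<open>Leaving \<open>U\<close> on the way would produce a boundary point within
        \<open>e / 2\<close> of \<open>x\<close>, closer than the nearest one.\<close>
      have "y \<in> U"
      proof (rule ccontr)
        assume "y \<notin> U"
        then obtain w where w: "w \<in> closed_segment x y" "w \<in> frontier U"
          using segment_meets_frontier[OF x] by blast
        have "dist x w + dist w y = e / 2" using closed_segment_dist[OF w(1)] y(1) by (simp add: dist_commute)
        then have "dist x w \<le> e / 2" using zero_le_dist[of w y] by linarith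
        then show False using infdist_le[OF w(2), of x] z False by simp
      qed
      have "infdist y (frontier U) \<le> dist x z - e / 2" using infdist_le[OF z(1), of y] y by simp
      then have "2 * infdist y (frontier U) / e \<le> 2 * dist x z / e - 1"
        using e by (simp add: field_simps)
      then have "\<lceil>2 * infdist y (frontier U) / e\<rceil> \<le> \<lceil>2 * dist x z / e\<rceil> - 1"
        by linarith
      moreover have "0 < \<lceil>2 * dist x z / e\<rceil>" using d0 e by simp
      ultimately have "N y < N x" unfolding N_def z by linarith
      moreover have "y \<in> nb (closure U) e x" using y e U_sub \<open>y \<in> U\<close> by (auto simp: nb_def)
      ultimately show ?thesis by blast
    qed
  qed (use e frontier_sub in auto)
  then show thesis by (rule that)
qed

text \<open>Close pairs fall under uniform continuity; at distance at least \<open>d\<close> the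
  linear term alone exceeds the oscillation \<open>2 * R\<close>.\<close>

lemma modulus_of_continuity:
  assumes F: "uniformly_continuous_on (frontier U) F" and R: "\<And>y. y \<in> frontier U \<Longrightarrow> \<bar>F y :: real\<bar> \<le> R"
    and \<eta>: "0 < \<eta>"
  obtains C where "0 \<le> C" "\<And>y z. y \<in> frontier U \<Longrightarrow> z \<in> frontier U \<Longrightarrow> F y \<le> F z + \<eta> + C * dist y z"
proof -
  obtain d where d: "0 < d" "\<And>y z. y \<in> frontier U \<Longrightarrow> z \<in> frontier U \<Longrightarrow> dist y z < d \<Longrightarrow> dist (F y) (F z) < \<eta>"
    using F \<eta> unfolding uniformly_continuous_on_def by metis
  have R0: "0 \<le> R" using frontier_nonempty R by force
  have "F y \<le> F z + \<eta> + (2 * R / d) * dist y z" if yz: "y \<in> frontier U" "z \<in> frontier U" for y z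
  proof (cases "dist y z < d")
    case True
    have "0 \<le> (2 * R / d) * dist y z" using R0 d by simp
    then show ?thesis using d(2)[OF yz True] by (simp add: dist_real_def)
  next
    case False
    then have "2 * R \<le> (2 * R / d) * dist y z" using R0 d
      by (simp add: field_simps mult_left_mono)
    then show ?thesis using R[OF yz(1)] R[OF yz(2)] \<eta> by linarith
  qed
  then show thesis using that[of "2 * R / d"] R0 d by simp
qed

text \<open>The concave function \<open>F z + \<eta> + a r - b r\<^sup>2\<close> of the distance \<open>r\<close> to a boundary point \<open>z\<close>, replaced by
  \<open>F\<close> on the boundary, is a strict supersolution: if the step towards \<open>z\<close> is cut off by the boundary,
  then the boundary value found there is small enough.\<close>

lemma boundary_barrier:
  fixes F :: "'a \<Rightarrow> real"
  assumes F: "uniformly_continuous_on (frontier U) F" and R: "\<And>y. y \<in> frontier U \<Longrightarrow> \<bar>F y\<bar> \<le> R"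
    and \<eta>: "0 < \<eta>" and G: "0 \<le> G"
  shows "\<exists>a>0. \<exists>e0>0. \<forall>e w. 0 < e \<longrightarrow> e < e0 \<longrightarrow> bounded (w ` closure U) \<longrightarrow> (\<forall>y\<in>frontier U. w y \<le> F y) \<longrightarrow>
    (\<forall>x\<in>U. w x \<le> midrange (closure U) e w x + e\<^sup>2 * G) \<longrightarrow>
    (\<forall>z\<in>frontier U. \<forall>x\<in>closure U. w x \<le> F z + \<eta> + a * dist x z)"
proof -
  obtain C where C: "0 \<le> C" "\<And>y z. y \<in> frontier U \<Longrightarrow> z \<in> frontier U \<Longrightarrow> F y \<le> F z + \<eta> / 2 + C * dist y z"
    using modulus_of_continuity[OF F R, of "\<eta> / 2"] \<eta> by auto
  obtain D where D: "1 \<le> D" "\<And>x y. x \<in> closure U \<Longrightarrow> y \<in> closure U \<Longrightarrow> dist x y \<le> D"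
    using diameter_bound by blast
  \<comment> \<open>The curvature supplies at least \<open>b * (5 / 4 * e\<^sup>2)\<close>, which
    has to cover \<open>2 * (e\<^sup>2 * G)\<close>, the strictness \<open>2 * e\<^sup>2\<close> and
    the loss \<open>e\<^sup>2 / 2\<close> due to a shortened step.\<close>
  define b where "b = 2 * G + 2"
  have b: "2 \<le> b" using G by (simp add: b_def)
  \<comment> \<open>With this slope \<open>g\<close> has derivative at least \<open>C\<close> on
    \<open>[0, D + 1]\<close>, an interval that contains \<open>r + e\<close>: it is monotone there
    and at least as steep as the modulus of \<open>F\<close>.\<close>
  define a where "a = C + 2 * b * (D + 1)"
  have a: "0 < a" "C \<le> a" using C b D by (auto simp: a_def intro!: add_nonneg_pos)
  \<comment> \<open>If \<open>z\<close> itself is within reach,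
    \<open>(a + b) * e0 \<le> \<eta>\<close> gives \<open>F z \<le> g (r - s)\<close> although the
    argument is not positive; if the step meets the frontier early,
    \<open>C * e0 \<le> \<eta> / 2\<close> pays for the missing part.\<close>
  define e0 where "e0 = min 1 (min (\<eta> / (a + b)) (\<eta> / (2 * (C + 1))))"
  have e0: "0 < e0" "e0 \<le> 1" "(a + b) * e0 \<le> \<eta>" "C * e0 \<le> \<eta> / 2"
  proof -
    show "0 < e0" "e0 \<le> 1" using \<eta> a b C by (auto simp: e0_def)
    have "e0 \<le> \<eta> / (a + b)" by (simp add: e0_def)
    then show "(a + b) * e0 \<le> \<eta>" using a b by (simp add: field_simps)
    have "e0 \<le> \<eta> / (2 * (C + 1))" by (simp add: e0_def)
    then have "(C + 1) * e0 \<le> \<eta> / 2" using C by (simp add: field_simps)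
    then show "C * e0 \<le> \<eta> / 2" using \<open>0 < e0\<close> by (simp add: distrib_right)
  qed
  have main: "w x \<le> F z + \<eta> + a * dist x z"
    if e: "0 < e" "e < e0" and bw: "bounded (w ` closure U)" and wF: "\<forall>y\<in>frontier U. w y \<le> F y"
      and sub: "\<forall>x\<in>U. w x \<le> midrange (closure U) e w x + e\<^sup>2 * G"
      and z: "z \<in> frontier U" and x: "x \<in> closure U" for e w z x
  proof -
    define g where "g r = F z + \<eta> + a * r - b * r\<^sup>2" for r
    have e1: "e \<le> 1" "a * e + b * e\<^sup>2 \<le> \<eta>" "C * e \<le> \<eta> / 2"
    proof -
      show "e \<le> 1" using e e0 by simp
      then have "b * e\<^sup>2 \<le> b * e" using e(1) b by (simp add: power2_eq_square mult_left_le)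
      moreover have "(a + b) * e \<le> (a + b) * e0" using e a b by (intro mult_left_mono) auto
      ultimately show "a * e + b * e\<^sup>2 \<le> \<eta>" using e0(3) by (simp add: distrib_right)
      have "C * e \<le> C * e0" using e C by (intro mult_left_mono) auto
      then show "C * e \<le> \<eta> / 2" using e0(4) by simp
    qed
    have g_mono: "g r \<le> g s" if "r \<le> s" "s \<le> D + 1" for r s
    proof -
      have "b * (s + r) \<le> b * (2 * (D + 1))" using b that by (intro mult_left_mono) auto
      then have "0 \<le> a - b * (s + r)" using C(1) by (simp add: a_def algebra_simps)
      then have "0 \<le> (a - b * (s + r)) * (s - r)" using that by simp
      then show ?thesis by (simp add: g_def power2_eq_square algebra_simps)
    qed
    have g_ge: "F z + \<eta> + C * r \<le> g r" if "0 \<le> r" "r \<le> D" for r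
    proof -
      have "b * r \<le> b * (2 * (D + 1))" using b that by (intro mult_left_mono) auto
      then have "0 \<le> a - C - b * r" by (simp add: a_def algebra_simps)
      then have "0 \<le> (a - C - b * r) * r" using that by simp
      then show ?thesis by (simp add: g_def power2_eq_square algebra_simps)
    qed
    have zX: "z \<in> closure U" using z frontier_sub by blast
    have dD: "dist y z \<le> D" if "y \<in> closure U" for y using D(2)[OF that zX] .
    define v where "v y = (if y \<in> frontier U then F y else g (dist y z))" for y
    have Fg: "F y \<le> g (dist y z)" if "y \<in> frontier U" for y
      using C(2)[OF that z] g_ge[of "dist y z"] dD frontier_sub that \<eta> by fastforce
    have v_le: "v y \<le> g (dist y z)" for y using Fg by (auto simp: v_def)
    have bv: "bounded (v ` closure U)"
    proof (rule bounded_image_realI)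
      fix y assume y: "y \<in> closure U"
      have "\<bar>F z\<bar> \<le> R" by (rule R[OF z])
      moreover have "\<bar>g (dist y z)\<bar> \<le> \<bar>F z\<bar> + \<eta> + a * D + b * D\<^sup>2"
      proof -
        have "a * dist y z \<le> a * D" "b * (dist y z)\<^sup>2 \<le> b * D\<^sup>2" "0 \<le> a * dist y z" "0 \<le> b * (dist y z)\<^sup>2"
          using a b dD[OF y] by (auto intro!: mult_left_mono power_mono)
        then show ?thesis using \<eta> unfolding g_def by linarith
      qed
      moreover have "0 \<le> a * D" "0 \<le> b * D\<^sup>2" using a b D by auto
      ultimately show "\<bar>v y\<bar> \<le> R + \<eta> + a * D + b * D\<^sup>2"
        using R[of y] \<eta> by (auto simp: v_def)
    qed
    have super: "midrange (closure U) e v y + (e\<^sup>2 * G + e\<^sup>2) \<le> v y" if y: "y \<in> closure U - frontier U" for y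
    proof -
      have yU: "y \<in> U" "y \<in> closure U" using y closure_minus_frontier by auto
      define r where "r = dist y z"
      have r: "0 \<le> r" "r \<le> D" using dD[OF yU(2)] by (auto simp: r_def)
      have S: "Sup (v ` nb (closure U) e y) \<le> g (r + e)"
      proof (rule Sup_nb_le[OF e(1) yU(2)])
        fix t assume t: "t \<in> nb (closure U) e y"
        then have "dist t z \<le> r + e" using dist_triangle[of t z y] by (auto simp: nb_def r_def)
        then have "g (dist t z) \<le> g (r + e)" using r e1 by (intro g_mono) auto
        then show "v t \<le> g (r + e)" using v_le[of t] by simp
      qed
      \<comment> \<open>Moves are strictly shorter than \<open>e\<close>, so the step towards
        \<open>z\<close> has length \<open>e - \<sigma>\<close>. The first order term
        \<open>a * \<sigma>\<close> that fails to cancel is at most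
        \<open>e\<^sup>2 / 2\<close>.\<close>
      define \<sigma> where "\<sigma> = min (e / 2) (e\<^sup>2 / (2 * a))"
      define s where "s = e - \<sigma>"
      have \<sigma>: "0 < \<sigma>" "\<sigma> \<le> e / 2" "a * \<sigma> \<le> e\<^sup>2 / 2"
      proof -
        have "\<sigma> \<le> e\<^sup>2 / (2 * a)" by (simp add: \<sigma>_def)
        then show "a * \<sigma> \<le> e\<^sup>2 / 2" using a by (simp add: field_simps)
      qed (use e a in \<open>auto simp: \<sigma>_def\<close>)
      have s: "0 < s" "s < e" "e / 2 \<le> s" using \<sigma> e by (auto simp: s_def)
      have I: "Inf (v ` nb (closure U) e y) \<le> g (r - s)"
      proof (cases "r \<le> s")
        case True
        have zn: "z \<in> nb (closure U) e y" using True s zX by (auto simp: nb_def r_def dist_commute)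
        have "(s - r)\<^sup>2 \<le> e\<^sup>2" using True s r by (intro power_mono) auto
        then have "b * (r - s)\<^sup>2 \<le> b * e\<^sup>2" using b by (simp add: power2_commute)
        moreover have "a * (s - r) \<le> a * e" using a s r by (intro mult_left_mono) auto
        ultimately have "F z \<le> g (r - s)" using e1(2) unfolding g_def by (simp add: algebra_simps)
        then show ?thesis using Inf_nb_le[OF bv zn] z by (simp add: v_def)
      next
        case False
        then obtain t where t: "dist t y = s" "dist t z = r - s"
          using point_towards[of s y z] s unfolding r_def by auto
        show ?thesis
        proof (cases "t \<in> U")
          case True
          then have tn: "t \<in> nb (closure U) e y" using t s U_sub by (auto simp: nb_def)
          show ?thesis using Inf_nb_le[OF bv tn] U_frontier_disjoint[OF True] t by (simp add: v_def)
        next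
          case False
          then obtain q where q: "q \<in> closed_segment y t" "q \<in> frontier U"
            using segment_meets_frontier[OF yU(1)] by blast
          have qs: "dist y q + dist q t = s" using closed_segment_dist[OF q(1)] t by (simp add: dist_commute)
          then have "dist y q \<le> s" using zero_le_dist[of q t] by linarith
          then have qn: "q \<in> nb (closure U) e y" using s q frontier_sub by (auto simp: nb_def dist_commute)
          have "dist q z \<le> dist q t + dist t z" by (rule dist_triangle)
          then have "dist q z \<le> r" using qs t zero_le_dist[of y q] by linarith
          then have "C * dist q z \<le> C * r" using C by (intro mult_left_mono)
          moreover have "C * s \<le> C * e" using C s by (intro mult_left_mono) auto
          moreover have "F z + \<eta> + C * (r - s) \<le> g (r - s)" using \<open>\<not> r \<le> s\<close> r s by (intro g_ge) auto
          ultimately have "F q \<le> g (r - s)"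
            using C(2)[OF q(2) z] e1(3) by (simp add: right_diff_distrib)
          then show ?thesis using Inf_nb_le[OF bv qn] q by (simp add: v_def)
        qed
      qed
      have "b * (5 / 4 * e\<^sup>2) \<le> b * (e\<^sup>2 + s\<^sup>2)"
      proof (intro mult_left_mono)
        have "(e / 2)\<^sup>2 \<le> s\<^sup>2" using s e by (intro power_mono) auto
        then show "5 / 4 * e\<^sup>2 \<le> e\<^sup>2 + s\<^sup>2" by (simp add: power2_eq_square)
      qed (use b in simp)
      moreover have "0 \<le> b * r * \<sigma>" using b r \<sigma> by simp
      moreover have "g (r + e) + g (r - s) = 2 * g r + a * \<sigma> - 2 * (b * r * \<sigma>) - b * (e\<^sup>2 + s\<^sup>2)"
        by (simp add: g_def s_def power2_eq_square algebra_simps)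
      moreover have "b * (5 / 4 * e\<^sup>2) = 5 / 2 * (e\<^sup>2 * G) + 5 / 2 * e\<^sup>2"
        by (simp add: b_def algebra_simps)
      moreover have "0 \<le> e\<^sup>2 * G" using G by simp
      ultimately have "g (r + e) + g (r - s) + 2 * (e\<^sup>2 * G) + 2 * e\<^sup>2 \<le> 2 * g r"
        using \<sigma>(3) by linarith
      moreover have "v y = g r" using y by (simp add: v_def r_def)
      ultimately show ?thesis using S I midrange_double[of "closure U" e v y] by linarith
    qed
    have "w x \<le> v x"
    proof (rule strict_comparison[OF e(1) bw bv, where Y = "frontier U" and k = "e\<^sup>2"])
      show "midrange (closure U) e v y + (e\<^sup>2 * G + e\<^sup>2) \<le> v y" if "y \<in> closure U - frontier U" for y
        by (rule super[OF that])
      show "w y \<le> midrange (closure U) e w y + e\<^sup>2 * G" if "y \<in> closure U - frontier U" for y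
        using sub that closure_minus_frontier by auto
      show "w y \<le> v y" if "y \<in> frontier U \<inter> closure U" for y
        using wF that by (simp add: v_def)
    qed (use e x in auto)
    also have "\<dots> \<le> g (dist x z)" by (rule v_le)
    also have "\<dots> \<le> F z + \<eta> + a * dist x z" using b by (simp add: g_def)
    finally show ?thesis .
  qed
  show ?thesis using a(1) e0(1) main by blast
qed

end

section \<open>Relaxed limits\<close>

lemma nb_UNIV: "nb UNIV e x = ball x e"
  by (auto simp: nb_def dist_commute)

lemma nb_eq_ball: "ball x e \<subseteq> X \<Longrightarrow> nb X e x = ball x e"
  by (auto simp: nb_def dist_commute)

lemma midrange_cong: "nb X e x = nb X' e' x' \<Longrightarrow> (\<And>y. y \<in> nb X e x \<Longrightarrow> u y = v y) \<Longrightarrow> midrange X e u x = midrange X' e' v x'"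
  unfolding midrange_def by (metis (mono_tags, lifting) image_cong)

text \<open>The half-relaxed limit: \<open>v x\<close> is the limit superior of \<open>V e y\<close>
  as \<open>y\<close> tends to \<open>x\<close> within \<open>X\<close> and \<open>e\<close> to 0
  from the right, jointly. This makes \<open>v\<close> upper semicontinuous without any continuity
  of \<open>V\<close>. The lower limit is handled as the negative of this one for
  \<open>- V\<close>.\<close>

definition relaxed_limsup :: "'a::metric_space set \<Rightarrow> (real \<Rightarrow> 'a \<Rightarrow> real) \<Rightarrow> ('a \<Rightarrow> real) \<Rightarrow> bool" where
  "relaxed_limsup X V v \<longleftrightarrow>
     (\<forall>x\<in>X. \<forall>c>v x. \<exists>\<rho>>0. \<forall>y\<in>X. \<forall>e. dist y x < \<rho> \<longrightarrow> 0 < e \<longrightarrow> e < \<rho> \<longrightarrow> V e y < c) \<and>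
     (\<forall>x\<in>X. \<forall>c<v x. \<forall>\<rho>>0. \<exists>y\<in>X. \<exists>e. dist y x < \<rho> \<and> 0 < e \<and> e < \<rho> \<and> c < V e y)"

lemma relaxed_limsup_less:
  assumes "relaxed_limsup X V v" "x \<in> X" "v x < c"
  shows "\<exists>\<rho>>0. \<forall>y\<in>X. \<forall>e. dist y x < \<rho> \<longrightarrow> 0 < e \<longrightarrow> e < \<rho> \<longrightarrow> V e y < c"
  using assms unfolding relaxed_limsup_def by blast

lemma relaxed_limsup_greater:
  assumes "relaxed_limsup X V v" "x \<in> X" "c < v x" "0 < \<rho>"
  shows "\<exists>y\<in>X. \<exists>e. dist y x < \<rho> \<and> 0 < e \<and> e < \<rho> \<and> c < V e y"
  using assms unfolding relaxed_limsup_def by blast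

lemma relaxed_limsup_exists:
  fixes V :: "real \<Rightarrow> 'a::metric_space \<Rightarrow> real"
  assumes e0: "0 < e0" and V: "\<And>e x. 0 < e \<Longrightarrow> e < e0 \<Longrightarrow> x \<in> X \<Longrightarrow> \<bar>V e x\<bar> \<le> R"
  shows "\<exists>v. relaxed_limsup X V v \<and> (\<forall>x\<in>X. \<bar>v x\<bar> \<le> R)"
proof -
  define S where "S x \<rho> = {V e y |e y. y \<in> X \<and> dist y x < \<rho> \<and> 0 < e \<and> e < \<rho>}" for x \<rho>
  have ne: "S x \<rho> \<noteq> {}" if "x \<in> X" "0 < \<rho>" for x \<rho>
  proof -
    have "V (\<rho> / 2) x \<in> S x \<rho>" using that unfolding S_def by force
    then show ?thesis by blast
  qed
  have bd: "\<bar>t\<bar> \<le> R" if "t \<in> S x \<rho>" "\<rho> \<le> e0" for t x \<rho>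
    using that V unfolding S_def by force
  have bda: "bdd_above (S x \<rho>)" if "\<rho> \<le> e0" for x \<rho>
    using bd[OF _ that] by (intro bdd_aboveI[of _ R]) (auto simp: abs_le_iff)
  have Sb: "- R \<le> Sup (S x \<rho>)" "Sup (S x \<rho>) \<le> R" if x: "x \<in> X" "0 < \<rho>" "\<rho> \<le> e0" for x \<rho>
  proof -
    obtain t where t: "t \<in> S x \<rho>" using ne[OF x(1,2)] by blast
    show "- R \<le> Sup (S x \<rho>)"
      using cSup_upper[OF t bda[OF x(3)]] bd[OF t x(3)] by linarith
    show "Sup (S x \<rho>) \<le> R"
      by (rule cSup_least[OF ne[OF x(1,2)]]) (use bd[OF _ x(3)] in \<open>auto simp: abs_le_iff\<close>)
  qed
  define v where "v x = (INF \<rho>\<in>{0<..e0}. Sup (S x \<rho>))" for x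
  have bdb: "bdd_below ((\<lambda>\<rho>. Sup (S x \<rho>)) ` {0<..e0})" if "x \<in> X" for x
    using Sb[OF that] by (intro bdd_belowI2[of _ "- R"]) auto
  have ne0: "{0<..e0} \<noteq> {}" using e0 by auto
  have "\<exists>\<rho>>0. \<forall>y\<in>X. \<forall>e. dist y x < \<rho> \<longrightarrow> 0 < e \<longrightarrow> e < \<rho> \<longrightarrow> V e y < c" if x: "x \<in> X" and c: "v x < c" for x c
  proof -
    obtain \<rho> where \<rho>: "0 < \<rho>" "\<rho> \<le> e0" "Sup (S x \<rho>) < c"
      using c unfolding v_def by (subst (asm) cINF_less_iff) (use ne0 bdb[OF x] in auto)
    have "V e y < c" if "y \<in> X" "dist y x < \<rho>" "0 < e" "e < \<rho>" for y e
    proof -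
      have "V e y \<in> S x \<rho>" using that unfolding S_def by blast
      then show ?thesis using cSup_upper[OF _ bda[OF \<rho>(2)]] \<rho>(3) by fastforce
    qed
    then show ?thesis using \<rho>(1) by blast
  qed
  moreover have "\<exists>y\<in>X. \<exists>e. dist y x < \<rho> \<and> 0 < e \<and> e < \<rho> \<and> c < V e y" if x: "x \<in> X" and c: "c < v x" and \<rho>: "0 < \<rho>" for x c \<rho>
  proof -
    define \<rho>' where "\<rho>' = min \<rho> e0"
    have \<rho>': "0 < \<rho>'" "\<rho>' \<le> e0" "\<rho>' \<le> \<rho>" using \<rho> e0 by (auto simp: \<rho>'_def)
    have "v x \<le> Sup (S x \<rho>')" unfolding v_def by (rule cINF_lower[OF bdb[OF x]]) (use \<rho>' in auto)
    then have "c < Sup (S x \<rho>')" using c by simp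
    then obtain t where "t \<in> S x \<rho>'" "c < t"
      using less_cSup_iff[OF ne[OF x \<rho>'(1)] bda[OF \<rho>'(2)]] by blast
    then show ?thesis using \<rho>'(3) unfolding S_def by force
  qed
  ultimately have "relaxed_limsup X V v" unfolding relaxed_limsup_def by blast
  moreover have "\<bar>v x\<bar> \<le> R" if "x \<in> X" for x
  proof -
    have "- R \<le> v x" unfolding v_def by (rule cINF_greatest[OF ne0]) (use Sb[OF that] in auto)
    moreover have "v x \<le> Sup (S x e0)" unfolding v_def by (rule cINF_lower[OF bdb[OF that]]) (use e0 in auto)
    ultimately show ?thesis using Sb(2)[OF that e0] by simp
  qed
  ultimately show ?thesis by blast
qed

section \<open>Upper semicontinuous functions\<close>

definition usc_on :: "'a::metric_space set \<Rightarrow> ('a \<Rightarrow> real) \<Rightarrow> bool" where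
  "usc_on S v \<longleftrightarrow> (\<forall>x\<in>S. \<forall>c>v x. \<exists>\<rho>>0. \<forall>y\<in>S. dist y x < \<rho> \<longrightarrow> v y < c)"

lemma usc_onD: "usc_on S v \<Longrightarrow> x \<in> S \<Longrightarrow> v x < c \<Longrightarrow> \<exists>\<rho>>0. \<forall>y\<in>S. dist y x < \<rho> \<longrightarrow> v y < c"
  unfolding usc_on_def by blast

lemma usc_on_subset: "usc_on S v \<Longrightarrow> T \<subseteq> S \<Longrightarrow> usc_on T v"
  unfolding usc_on_def by (meson subsetD)

lemma usc_relaxed_limsup:
  assumes "relaxed_limsup X V v"
  shows "usc_on X v"
  unfolding usc_on_def
proof (intro ballI allI impI)
  fix x c assume x: "x \<in> X" and c: "v x < c"
  obtain \<rho> where \<rho>: "0 < \<rho>" "\<And>y e. y \<in> X \<Longrightarrow> dist y x < \<rho> \<Longrightarrow> 0 < e \<Longrightarrow> e < \<rho> \<Longrightarrow> V e y < (v x + c) / 2"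
    using relaxed_limsup_less[OF assms x, of "(v x + c) / 2"] c by auto
  have "v y < c" if y: "y \<in> X" "dist y x < \<rho> / 2" for y
  proof (rule ccontr)
    assume "\<not> v y < c"
    then have "(v x + c) / 2 < v y" using c by (simp add: field_simps)
    then obtain z e where z: "z \<in> X" "dist z y < \<rho> / 2" "0 < e" "e < \<rho> / 2" "(v x + c) / 2 < V e z"
      using relaxed_limsup_greater[OF assms y(1), of "(v x + c) / 2" "\<rho> / 2"] \<rho>(1) by auto
    have "dist z x < \<rho>" using dist_triangle[of z x y] y(2) z(2) by simp
    then show False using \<rho>(2)[of z e] z \<rho>(1) by simp
  qed
  then show "\<exists>\<rho>>0. \<forall>y\<in>X. dist y x < \<rho> \<longrightarrow> v y < c" using \<rho>(1) by (intro exI[of _ "\<rho> / 2"]) auto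
qed

lemma usc_on_continuous: "continuous_on S v \<Longrightarrow> usc_on S v" for v :: "'a::metric_space \<Rightarrow> real"
  unfolding usc_on_def
proof (intro ballI allI impI)
  fix x c assume "continuous_on S v" "x \<in> S" "v x < c"
  then obtain d where d: "0 < d" "\<forall>y\<in>S. dist y x < d \<longrightarrow> dist (v y) (v x) < c - v x"
    unfolding continuous_on_iff by (metis diff_gt_0_iff_gt)
  have "v y < c" if "y \<in> S" "dist y x < d" for y
  proof -
    have "dist (v y) (v x) < c - v x" using d(2) that by blast
    then show ?thesis unfolding dist_real_def by linarith
  qed
  then show "\<exists>\<rho>>0. \<forall>y\<in>S. dist y x < \<rho> \<longrightarrow> v y < c" using d(1) by blast
qed

lemma usc_on_add_continuous:
  fixes v w :: "'a::metric_space \<Rightarrow> real"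
  assumes "usc_on S v" "continuous_on S w"
  shows "usc_on S (\<lambda>x. v x + w x)"
  unfolding usc_on_def
proof (intro ballI allI impI)
  fix x c assume x: "x \<in> S" and c: "v x + w x < c"
  define d where "d = (c - (v x + w x)) / 2"
  have d: "0 < d" "v x + d + (w x + d) = c" using c by (auto simp: d_def field_simps)
  obtain \<rho> where \<rho>: "0 < \<rho>" "\<And>y. y \<in> S \<Longrightarrow> dist y x < \<rho> \<Longrightarrow> v y < v x + d"
    using usc_onD[OF assms(1) x, of "v x + d"] d(1) by auto
  obtain \<rho>' where \<rho>': "0 < \<rho>'" "\<And>y. y \<in> S \<Longrightarrow> dist y x < \<rho>' \<Longrightarrow> w y < w x + d"
    using usc_onD[OF usc_on_continuous[OF assms(2)] x, of "w x + d"] d(1) by auto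
  have "v y + w y < c" if "y \<in> S" "dist y x < min \<rho> \<rho>'" for y
    using \<rho>(2)[of y] \<rho>'(2)[of y] that d(2) by simp
  then show "\<exists>\<rho>>0. \<forall>y\<in>S. dist y x < \<rho> \<longrightarrow> v y + w y < c"
    using \<rho>(1) \<rho>'(1) by (intro exI[of _ "min \<rho> \<rho>'"]) simp
qed

text \<open>Otherwise each \<open>x\<close> has some \<open>y x\<close> of larger value, and
  finitely many balls on which \<open>v\<close> is below \<open>v (y x)\<close> cover
  \<open>S\<close>. The largest of these finitely many values \<open>v (y x)\<close> is then below
  another one.\<close>

lemma usc_attains_sup:
  fixes v :: "'a::metric_space \<Rightarrow> real"
  assumes S: "compact S" "S \<noteq> {}" and v: "usc_on S v"
  obtains x where "x \<in> S" "\<And>y. y \<in> S \<Longrightarrow> v y \<le> v x"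
proof -
  have "\<exists>x\<in>S. \<forall>y\<in>S. v y \<le> v x"
  proof (rule ccontr)
    assume "\<not> ?thesis"
    then have "\<forall>x\<in>S. \<exists>y\<in>S. v x < v y" by (meson not_le)
    then obtain y where y: "\<And>x. x \<in> S \<Longrightarrow> y x \<in> S \<and> v x < v (y x)" by metis
    have "\<forall>x\<in>S. \<exists>\<rho>>0. \<forall>z\<in>S. dist z x < \<rho> \<longrightarrow> v z < v (y x)"
      using v y unfolding usc_on_def by blast
    then obtain \<rho> where \<rho>: "\<And>x. x \<in> S \<Longrightarrow> 0 < \<rho> x" "\<And>x z. x \<in> S \<Longrightarrow> z \<in> S \<Longrightarrow> dist z x < \<rho> x \<Longrightarrow> v z < v (y x)"
      by metis
    have "S \<subseteq> (\<Union>x\<in>S. ball x (\<rho> x))" using \<rho>(1) by force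
    then obtain C where C: "C \<subseteq> S" "finite C" "S \<subseteq> (\<Union>x\<in>C. ball x (\<rho> x))"
      using compactE_image[OF S(1), of S "\<lambda>x. ball x (\<rho> x)"] by auto
    have "C \<noteq> {}" using C S by auto
    then obtain x where x: "x \<in> C" "v (y x) = Max ((\<lambda>x. v (y x)) ` C)"
      using Max_in[of "(\<lambda>x. v (y x)) ` C"] C by fastforce
    have "y x \<in> S" using x C y by blast
    then obtain x' where x': "x' \<in> C" "dist (y x) x' < \<rho> x'" using C by (force simp: dist_commute)
    then have "v (y x) < v (y x')" using \<rho>(2) C \<open>y x \<in> S\<close> by blast
    moreover have "v (y x') \<le> v (y x)" using x x' C by simp
    ultimately show False by simp
  qed
  then show thesis using that by blast
qed

lemma usc_attains_sup_cball:
  fixes v :: "'a::euclidean_space \<Rightarrow> real"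
  assumes "usc_on (cball x r) v" "0 \<le> r"
  shows "\<exists>w0\<in>cball x r. \<forall>w\<in>cball x r. v w \<le> v w0"
proof (rule usc_attains_sup[OF compact_cball _ assms(1)])
  show "cball x r \<noteq> {}" using assms(2) by simp
qed blast

context bounded_domain
begin

text \<open>Strict contact leaves a gap \<open>\<mu>\<close> between \<open>V e\<close> and
  \<open>Q\<close> on the annulus \<open>A\<close>, uniformly for small \<open>e\<close> by
  compactness. Discrete comparison carries the gap into the inner ball, but close to
  \<open>x0\<close> some \<open>V e\<close> comes nearer to \<open>Q\<close> than
  \<open>\<mu>\<close>.\<close>

lemma touching_contradiction:
  fixes V :: "real \<Rightarrow> 'a \<Rightarrow> real"
  assumes e0: "0 < e0" and VR: "\<And>e x. 0 < e \<Longrightarrow> e < e0 \<Longrightarrow> x \<in> closure U \<Longrightarrow> \<bar>V e x\<bar> \<le> R"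
    and sub: "\<And>e x. 0 < e \<Longrightarrow> e < e0 \<Longrightarrow> x \<in> U \<Longrightarrow> V e x \<le> midrange (closure U) e (V e) x + e\<^sup>2 * g x"
    and lim: "relaxed_limsup (closure U) V v"
    and Q: "continuous_on (cball x0 \<rho>) Q" and \<rho>: "0 < \<rho>" "cball x0 \<rho> \<subseteq> U"
    and touch: "v x0 = Q x0" "\<And>x. x \<in> cball x0 \<rho> \<Longrightarrow> x \<noteq> x0 \<Longrightarrow> v x < Q x"
    and \<kappa>: "0 < \<kappa>" and super: "\<And>x e. x \<in> cball x0 \<rho> \<Longrightarrow> 0 < e \<Longrightarrow> e < \<rho> \<Longrightarrow> ball x e \<subseteq> cball x0 \<rho> \<Longrightarrow>
      midrange UNIV e Q x + e\<^sup>2 * (g x + \<kappa>) \<le> Q x"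
  shows False
proof -
  define A where "A = cball x0 \<rho> - ball x0 (\<rho> / 2)"
  have A: "compact A" unfolding A_def by (intro compact_diff) auto
  have "\<exists>\<mu>>0. \<exists>e1>0. \<forall>x\<in>A. \<forall>e. 0 < e \<longrightarrow> e < e1 \<longrightarrow> V e x \<le> Q x - \<mu>"
  proof (cases "A = {}")
    case False
    have "\<forall>a\<in>A. \<exists>r>0. \<forall>y\<in>A. \<forall>e. dist y a < r \<longrightarrow> 0 < e \<longrightarrow> e < r \<longrightarrow> V e y \<le> Q y - (Q a - v a) / 4"
    proof
      fix a assume a: "a \<in> A"
      then have aa: "a \<in> cball x0 \<rho>" "a \<noteq> x0" "a \<in> closure U" using \<rho> U_sub by (auto simp: A_def)
      define d where "d = (Q a - v a) / 4"
      have d: "0 < d" "Q a = v a + 4 * d" using touch(2)[OF aa(1,2)] unfolding d_def by (auto simp: field_simps)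
      obtain r where r: "0 < r" "\<And>y e. y \<in> closure U \<Longrightarrow> dist y a < r \<Longrightarrow> 0 < e \<Longrightarrow> e < r \<Longrightarrow> V e y < v a + d"
        using relaxed_limsup_less[OF lim aa(3), of "v a + d"] d(1) by auto
      obtain r' where r': "0 < r'" "\<And>y. y \<in> cball x0 \<rho> \<Longrightarrow> dist y a < r' \<Longrightarrow> dist (Q y) (Q a) < d"
        using Q aa(1) d(1) unfolding continuous_on_iff by metis
      have "V e y \<le> Q y - d" if y: "y \<in> A" "dist y a < min r r'" "0 < e" "e < min r r'" for y e
      proof -
        have "y \<in> cball x0 \<rho>" "y \<in> closure U" using y(1) \<rho>(2) U_sub by (auto simp: A_def)
        then have "V e y < v a + d" "dist (Q y) (Q a) < d" using r(2)[of y e] r'(2)[of y] y by auto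
        then show ?thesis using d(2) unfolding dist_real_def by linarith
      qed
      then show "\<exists>r>0. \<forall>y\<in>A. \<forall>e. dist y a < r \<longrightarrow> 0 < e \<longrightarrow> e < r \<longrightarrow> V e y \<le> Q y - (Q a - v a) / 4"
        using r(1) r'(1) unfolding d_def by (intro exI[of _ "min r r'"]) simp
    qed
    then obtain r where r: "\<And>a. a \<in> A \<Longrightarrow> 0 < r a"
      "\<And>a y e. a \<in> A \<Longrightarrow> y \<in> A \<Longrightarrow> dist y a < r a \<Longrightarrow> 0 < e \<Longrightarrow> e < r a \<Longrightarrow> V e y \<le> Q y - (Q a - v a) / 4"
      by metis
    have "A \<subseteq> (\<Union>a\<in>A. ball a (r a))" using r(1) by force
    then obtain C where C: "C \<subseteq> A" "finite C" "A \<subseteq> (\<Union>a\<in>C. ball a (r a))"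
      using compactE_image[OF A, of A "\<lambda>x. ball x (r x)"] by auto
    have C0: "C \<noteq> {}" using C False by auto
    define \<mu> where "\<mu> = Min ((\<lambda>a. (Q a - v a) / 4) ` C)"
    define e1 where "e1 = Min (r ` C)"
    have "0 < (Q a - v a) / 4" if "a \<in> C" for a
    proof -
      have "a \<in> cball x0 \<rho>" "a \<noteq> x0" using that C(1) \<rho>(1) by (auto simp: A_def)
      then show ?thesis using touch(2)[of a] by simp
    qed
    then have \<mu>: "0 < \<mu>" using C(2) C0 by (simp add: \<mu>_def)
    have e1: "0 < e1" using C C0 r(1) by (auto simp: e1_def)
    have "V e x \<le> Q x - \<mu>" if x: "x \<in> A" and e: "0 < e" "e < e1" for x e
    proof -
      obtain a where a: "a \<in> C" "dist x a < r a" using C(3) x by (force simp: dist_commute)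
      have "e1 \<le> r a" using a C by (simp add: e1_def)
      then have "e < r a" using e(2) by simp
      then have "V e x \<le> Q x - (Q a - v a) / 4" using r(2)[of a x e] a C x e by blast
      moreover have "\<mu> \<le> (Q a - v a) / 4" unfolding \<mu>_def by (rule Min_le) (use a C in auto)
      ultimately show ?thesis by linarith
    qed
    then show ?thesis using \<mu> e1 by blast
  qed (auto intro!: exI[of _ "1::real"])
  then obtain \<mu> e1 where \<mu>: "0 < \<mu>" and e1: "0 < e1" "\<And>x e. x \<in> A \<Longrightarrow> 0 < e \<Longrightarrow> e < e1 \<Longrightarrow> V e x \<le> Q x - \<mu>" by blast
  have x0: "x0 \<in> cball x0 \<rho>" using \<rho>(1) by simp
  then have x0': "x0 \<in> closure U" using \<rho>(2) U_sub by blast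
  obtain r where r: "0 < r" "\<And>y. y \<in> cball x0 \<rho> \<Longrightarrow> dist y x0 < r \<Longrightarrow> dist (Q y) (Q x0) < \<mu> / 2"
    using Q x0 \<mu> unfolding continuous_on_iff by (metis half_gt_zero)
  define s where "s = min (min r e0) (min e1 (\<rho> / 2))"
  have s: "0 < s" "s \<le> r" "s \<le> e0" "s \<le> e1" "s \<le> \<rho> / 2" using r e0 e1 \<rho> by (auto simp: s_def)
  have "v x0 - \<mu> / 2 < v x0" using \<mu> by simp
  then obtain y e where y: "y \<in> closure U" "dist y x0 < s" "0 < e" "e < s" "v x0 - \<mu> / 2 < V e y"
    using relaxed_limsup_greater[OF lim x0' _ s(1)] by blast
  have yc: "y \<in> cball x0 \<rho>" "y \<in> ball x0 (\<rho> / 2)" using y s \<rho> by (auto simp: dist_commute)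
  have "Q y - \<mu> < V e y" 
  proof -
    have "dist (Q y) (Q x0) < \<mu> / 2" using r(2)[OF yc(1)] y(2) s(2) by simp
    then show ?thesis using y(5) touch(1) unfolding dist_real_def by linarith
  qed
  \<comment> \<open>Moves from the half ball stay in \<open>cball x0 \<rho>\<close>, so
    \<open>w\<close> may be anything that dominates \<open>V e\<close> elsewhere. The comparison can
    thus be made on all of \<open>closure U\<close>, with the complement of the half ball as
    boundary.\<close>
  define w where "w x = (if x \<in> cball x0 \<rho> then Q x - \<mu> else R)" for x
  have "V e y \<le> w y"
  proof (rule strict_comparison[where X = "closure U" and Y = "- ball x0 (\<rho> / 2)" and e = e and k = "e\<^sup>2 * \<kappa>"
        and ?g1.0 = "\<lambda>x. e\<^sup>2 * g x" and ?g2.0 = "\<lambda>x. e\<^sup>2 * (g x + \<kappa>)"])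
    show "bounded (V e ` closure U)" by (rule bounded_image_realI[of _ _ R]) (use VR y s in auto)
    have "compact (Q ` cball x0 \<rho>)" by (rule compact_continuous_image[OF Q]) auto
    then obtain B where B: "\<And>x. x \<in> cball x0 \<rho> \<Longrightarrow> \<bar>Q x\<bar> \<le> B"
      by (fastforce simp: compact_eq_bounded_closed bounded_iff)
    show "bounded (w ` closure U)"
    proof (rule bounded_image_realI)
      fix x show "\<bar>w x\<bar> \<le> max (B + \<mu>) \<bar>R\<bar>" using B[of x] \<mu> by (auto simp: w_def)
    qed
    show "0 < e" by (rule y(3))
    show "V e x \<le> midrange (closure U) e (V e) x + e\<^sup>2 * g x" if "x \<in> closure U - - ball x0 (\<rho> / 2)" for x
    proof (rule sub)
      have "x \<in> cball x0 \<rho>" using that \<rho> by auto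
      then show "x \<in> U" using \<rho> by blast
    qed (use y s in auto)
    show "midrange (closure U) e w x + e\<^sup>2 * (g x + \<kappa>) \<le> w x" if "x \<in> closure U - - ball x0 (\<rho> / 2)" for x
    proof -
      have x: "x \<in> ball x0 (\<rho> / 2)" "x \<in> cball x0 \<rho>" using that \<rho> by auto
      have sub: "ball x e \<subseteq> cball x0 \<rho>"
      proof
        fix t assume "t \<in> ball x e"
        then show "t \<in> cball x0 \<rho>" using dist_triangle[of x0 t x] x y s by simp
      qed
      then have "ball x e \<subseteq> closure U" using \<rho>(2) U_sub by blast
      then have nbe: "nb (closure U) e x = nb UNIV e x" by (simp add: nb_eq_ball nb_UNIV)
      have "compact (Q ` cball x0 \<rho>)" by (rule compact_continuous_image[OF Q]) auto
      then have "bounded (Q ` cball x0 \<rho>)" by (rule compact_imp_bounded)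
      then have bQ: "bounded (Q ` nb (cball x0 \<rho>) e x)"
        using nb_sub[of "cball x0 \<rho>" e x] by (meson bounded_subset image_mono)
      have nbe': "nb (cball x0 \<rho>) e x = nb UNIV e x" using sub by (simp add: nb_eq_ball nb_UNIV)
      have "midrange (closure U) e w x = midrange (cball x0 \<rho>) e (\<lambda>t. Q t + - \<mu>) x"
        by (rule midrange_cong) (use nbe nbe' sub in \<open>auto simp: w_def nb_UNIV\<close>)
      also have "\<dots> = midrange (cball x0 \<rho>) e Q x + - \<mu>"
        by (rule midrange_add_const[OF y(3) x(2)]) fact
      also have "midrange (cball x0 \<rho>) e Q x = midrange UNIV e Q x" by (rule midrange_cong) (use nbe' in auto)
      finally have "midrange (closure U) e w x = midrange UNIV e Q x + - \<mu>" .
      moreover have "w x = Q x - \<mu>" using x(2) unfolding w_def by simp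
      moreover have "midrange UNIV e Q x + e\<^sup>2 * (g x + \<kappa>) \<le> Q x"
        by (rule super[OF x(2) y(3) _ sub]) (use y(4) s(5) \<rho>(1) in linarith)
      ultimately show ?thesis by linarith
    qed
    show "V e x \<le> w x" if "x \<in> - ball x0 (\<rho> / 2) \<inter> closure U" for x
      using that e1(2)[of x e] VR[of e x] y s by (auto simp: w_def A_def abs_le_iff)
    show "0 < e\<^sup>2 * \<kappa>" using \<kappa> y by simp
    show "e\<^sup>2 * g x + e\<^sup>2 * \<kappa> \<le> e\<^sup>2 * (g x + \<kappa>)" for x by (simp add: distrib_left)
  qed (use y in auto)
  then show False using \<open>Q y - \<mu> < V e y\<close> yc(1) by (simp add: w_def)
qed

end

section \<open>Test functions\<close>

lemma has_derivative_grad: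
  assumes "\<phi> differentiable (at y)"
  shows "(\<phi> has_derivative (\<lambda>h. grad \<phi> y \<bullet> h)) (at y)"
proof -
  let ?D = "frechet_derivative \<phi> (at y)"
  have D: "(\<phi> has_derivative ?D) (at y)" using assms by (simp add: frechet_derivative_works)
  then interpret linear ?D by (rule has_derivative_linear)
  have "?D h = grad \<phi> y \<bullet> h" for h
  proof -
    have "?D h = ?D (\<Sum>i\<in>UNIV. h $ i *s axis i 1)" by (simp add: basis_expansion)
    also have "\<dots> = (\<Sum>i\<in>UNIV. h $ i * ?D (axis i 1))" by (simp add: sum scale scalar_mult_eq_scaleR)
    finally show ?thesis by (simp add: grad_def inner_vec_def mult.commute)
  qed
  then show ?thesis using D by presburger
qed

lemma has_derivative_hess:
  assumes "grad \<phi> differentiable (at y)"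
  shows "(grad \<phi> has_derivative (\<lambda>h. hess \<phi> y *v h)) (at y)"
proof -
  let ?D = "frechet_derivative (grad \<phi>) (at y)"
  have D: "(grad \<phi> has_derivative ?D) (at y)" using assms by (simp add: frechet_derivative_works)
  then interpret linear ?D by (rule has_derivative_linear)
  have c: "((\<lambda>z. grad \<phi> z $ i) has_derivative (\<lambda>h. ?D h $ i)) (at y)" for i
    by (rule bounded_linear.has_derivative[OF bounded_linear_vec_nth D])
  have H: "hess \<phi> y $ i $ j = ?D (axis j 1) $ i" for i j
    by (simp add: hess_def frechet_derivative_at[OF c, symmetric])
  have "?D h = hess \<phi> y *v h" for h
  proof -
    have "?D h = ?D (\<Sum>j\<in>UNIV. h $ j *s axis j 1)" by (simp add: basis_expansion)
    also have "\<dots> = (\<Sum>j\<in>UNIV. h $ j *s ?D (axis j 1))" by (simp add: sum scale scalar_mult_eq_scaleR)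
    finally show ?thesis
      by (simp add: vec_eq_iff H matrix_vector_mult_def sum_component mult.commute)
  qed
  then show ?thesis using D by presburger
qed

lemma grad_eqI:
  assumes "(\<phi> has_derivative (\<lambda>h. g \<bullet> h)) (at y)"
  shows "grad \<phi> y = g"
  by (simp add: grad_def frechet_derivative_at[OF assms, symmetric] inner_axis vec_eq_iff)

lemma C2_nearI:
  fixes \<phi> :: "real^'n \<Rightarrow> real"
  assumes N: "open N" "x \<in> N" and \<phi>: "\<And>y. y \<in> N \<Longrightarrow> (\<phi> has_derivative (\<lambda>h. G y \<bullet> h)) (at y)"
    and G: "\<And>y. y \<in> N \<Longrightarrow> (G has_derivative (\<lambda>h. H y *v h)) (at y)" and H: "continuous_on N H"
  shows "C2_near \<phi> x" "grad \<phi> x = G x" "hess \<phi> x = H x"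
proof -
  have g: "grad \<phi> y = G y" if "y \<in> N" for y by (rule grad_eqI[OF \<phi>[OF that]])
  have dg: "(grad \<phi> has_derivative (\<lambda>h. H y *v h)) (at y)" if "y \<in> N" for y
    by (rule has_derivative_transform_within_open[OF G[OF that] N(1) that]) (simp add: g)
  have h: "hess \<phi> y = H y" if "y \<in> N" for y
  proof -
    have "(\<lambda>h. hess \<phi> y *v h) = (\<lambda>h. H y *v h)"
      using has_derivative_unique[OF has_derivative_hess dg[OF that]] dg[OF that] by (auto simp: differentiable_def)
    then show ?thesis by (metis matrix_eq)
  qed
  show "grad \<phi> x = G x" "hess \<phi> x = H x" using g h N by auto
  have "continuous_on N (hess \<phi>)" using H by (simp add: h cong: continuous_on_cong)
  then show "C2_near \<phi> x"
    unfolding C2_near_def using N \<phi> dg by (auto simp: differentiable_def)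
qed

text \<open>The mean value theorem along the segment from \<open>x\<close> to \<open>x + h\<close>,
  applied to \<open>\<phi>\<close> minus its quadratic part, reduces the remainder to the first
  order remainder of the gradient at \<open>x\<close>.\<close>

lemma second_order_expansion:
  fixes \<phi> :: "real^'n \<Rightarrow> real"
  assumes \<phi>: "C2_near \<phi> x" and \<delta>: "0 < \<delta>"
  obtains \<rho> where "0 < \<rho>" "\<And>h. norm h < \<rho> \<Longrightarrow>
    \<bar>\<phi> (x + h) - \<phi> x - grad \<phi> x \<bullet> h - (h \<bullet> (hess \<phi> x *v h)) / 2\<bar> \<le> \<delta> * (norm h)\<^sup>2"
proof -
  obtain N where N: "open N" "x \<in> N" "\<And>y. y \<in> N \<Longrightarrow> \<phi> differentiable (at y)" "\<And>y. y \<in> N \<Longrightarrow> grad \<phi> differentiable (at y)"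
    using \<phi> unfolding C2_near_def by blast
  obtain r where r: "0 < r" "ball x r \<subseteq> N" using N(1,2) open_contains_ball by blast
  have dg: "(grad \<phi> has_derivative (\<lambda>h. hess \<phi> x *v h)) (at x)" by (rule has_derivative_hess[OF N(4)[OF N(2)]])
  obtain s where s: "0 < s" "\<And>y. norm (y - x) < s \<Longrightarrow>
      norm (grad \<phi> y - grad \<phi> x - hess \<phi> x *v (y - x)) \<le> \<delta> * norm (y - x)"
    using dg \<delta> unfolding has_derivative_at_alt by blast
  show thesis
  proof (rule that[of "min r s"])
    show "0 < min r s" using r s by simp
    fix h :: "real^'n" assume h: "norm h < min r s"
    define q where "q = h \<bullet> (hess \<phi> x *v h)"
    define \<psi> where "\<psi> t = \<phi> (x + t *\<^sub>R h) - t * (grad \<phi> x \<bullet> h) - t\<^sup>2 * q / 2" for t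
    define \<psi>' where "\<psi>' t = (grad \<phi> (x + t *\<^sub>R h) - grad \<phi> x - hess \<phi> x *v (t *\<^sub>R h)) \<bullet> h" for t
    have le: "norm (t *\<^sub>R h) \<le> norm h" if "0 \<le> t" "t \<le> 1" for t
      using that mult_right_mono[of t 1 "norm h"] by simp
    have d: "(\<psi> has_derivative (\<lambda>s. s * \<psi>' t)) (at t within {0..1})" if t: "0 \<le> t" "t \<le> 1" for t
    proof -
      have "x + t *\<^sub>R h \<in> ball x r" using le[OF t] h by (simp add: dist_norm)
      then have 1: "(\<phi> has_derivative (\<lambda>k. grad \<phi> (x + t *\<^sub>R h) \<bullet> k)) (at (x + t *\<^sub>R h))"
        using r N(3) by (intro has_derivative_grad) auto
      have 2: "((\<lambda>t. x + t *\<^sub>R h) has_derivative (\<lambda>s. s *\<^sub>R h)) (at t within {0..1})"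
        by (auto intro!: derivative_eq_intros)
      have 3: "((\<lambda>t. \<phi> (x + t *\<^sub>R h)) has_derivative (\<lambda>s. grad \<phi> (x + t *\<^sub>R h) \<bullet> (s *\<^sub>R h))) (at t within {0..1})"
        by (rule has_derivative_compose[OF 2 1])
      have 4: "((\<lambda>t. t * (grad \<phi> x \<bullet> h)) has_derivative (\<lambda>s. s * (grad \<phi> x \<bullet> h))) (at t within {0..1})"
        by (auto intro!: derivative_eq_intros)
      have 5: "((\<lambda>t. t\<^sup>2 * q / 2) has_derivative (\<lambda>s. s * (t * q))) (at t within {0..1})"
        by (auto intro!: derivative_eq_intros simp: fun_eq_iff)
      have "s * \<psi>' t = grad \<phi> (x + t *\<^sub>R h) \<bullet> (s *\<^sub>R h) - s * (grad \<phi> x \<bullet> h) - s * (t * q)" for s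
        by (simp add: \<psi>'_def q_def inner_diff_left inner_commute[of h] matrix_vector_mult_scaleR algebra_simps)
      then show ?thesis
        using has_derivative_diff[OF has_derivative_diff[OF 3 4] 5] unfolding \<psi>_def by presburger
    qed
    obtain t where t: "t \<in> {0<..<1}" "\<psi> 1 - \<psi> 0 = (1 - 0) * \<psi>' t"
      using mvt_simple[of 0 1 \<psi> "\<lambda>t s. s * \<psi>' t"] d by auto
    have "\<bar>\<psi>' t\<bar> \<le> norm (grad \<phi> (x + t *\<^sub>R h) - grad \<phi> x - hess \<phi> x *v (t *\<^sub>R h)) * norm h"
      unfolding \<psi>'_def by (rule Cauchy_Schwarz_ineq2)
    also have "\<dots> \<le> (\<delta> * norm (t *\<^sub>R h)) * norm h"
      using s(2)[of "x + t *\<^sub>R h"] le[of t] t h by (intro mult_right_mono) auto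
    also have "\<dots> \<le> (\<delta> * norm h) * norm h"
      using le[of t] t \<delta> by (intro mult_right_mono mult_left_mono) auto
    finally have "\<bar>\<psi>' t\<bar> \<le> \<delta> * (norm h)\<^sup>2" by (simp add: power2_eq_square)
    moreover have "\<psi>' t = \<phi> (x + h) - \<phi> x - grad \<phi> x \<bullet> h - (h \<bullet> (hess \<phi> x *v h)) / 2"
      using t(2) by (simp add: \<psi>_def q_def)
    ultimately show "\<bar>\<phi> (x + h) - \<phi> x - grad \<phi> x \<bullet> h - (h \<bullet> (hess \<phi> x *v h)) / 2\<bar> \<le> \<delta> * (norm h)\<^sup>2" by simp
  qed
qed

lemma inf_lap_nonzero:
  assumes "grad \<phi> x \<noteq> 0"
  shows "inf_lap \<phi> x = (grad \<phi> x \<bullet> (hess \<phi> x *v grad \<phi> x)) / (norm (grad \<phi> x))\<^sup>2"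
  using assms by (simp add: inf_lap_def inner_vec_def matrix_vector_mult_def sum_distrib_left mult.assoc)

lemma inf_lap_zero:
  fixes \<phi> :: "real^'n \<Rightarrow> real"
  assumes "grad \<phi> x = 0" "((\<lambda>x'. 2 * (\<phi> x' - \<phi> x) / (dist x' x)\<^sup>2) \<longlongrightarrow> L) (at x)"
  shows "inf_lap \<phi> x = L"
  using assms by (simp add: inf_lap_def tendsto_Lim)

lemma C2_near_uminus:
  fixes \<phi> :: "real^'n \<Rightarrow> real"
  assumes "C2_near \<phi> x"
  shows "C2_near (\<lambda>y. - \<phi> y) x" "grad (\<lambda>y. - \<phi> y) x = - grad \<phi> x" "hess (\<lambda>y. - \<phi> y) x = - hess \<phi> x"
proof -
  obtain N where N: "open N" "x \<in> N" "\<And>y. y \<in> N \<Longrightarrow> \<phi> differentiable (at y)" "\<And>y. y \<in> N \<Longrightarrow> grad \<phi> differentiable (at y)"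
    "continuous_on N (hess \<phi>)"
    using assms unfolding C2_near_def by blast
  have m: "(- A) *v h = - (A *v h)" for A :: "real^'n^'n" and h
    by (simp add: vec_eq_iff matrix_vector_mult_def sum_negf)
  have 1: "((\<lambda>y. - \<phi> y) has_derivative (\<lambda>h. (- grad \<phi> y) \<bullet> h)) (at y)" if "y \<in> N" for y
    using has_derivative_minus[OF has_derivative_grad[OF N(3)[OF that]]] by simp
  have 2: "((\<lambda>y. - grad \<phi> y) has_derivative (\<lambda>h. (- hess \<phi> y) *v h)) (at y)" if "y \<in> N" for y
    using has_derivative_minus[OF has_derivative_hess[OF N(4)[OF that]]] by (simp add: m)
  have 3: "continuous_on N (\<lambda>y. - hess \<phi> y)" using N(5) by (intro continuous_intros)
  show "C2_near (\<lambda>y. - \<phi> y) x" "grad (\<lambda>y. - \<phi> y) x = - grad \<phi> x" "hess (\<lambda>y. - \<phi> y) x = - hess \<phi> x"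
    using C2_nearI[OF N(1,2) 1 2 3] by auto
qed

lemma test_functions_uminus:
  fixes \<phi> :: "real^'n \<Rightarrow> real"
  assumes "\<phi> \<in> test_functions x"
  shows "(\<lambda>y. - \<phi> y) \<in> test_functions x" "inf_lap (\<lambda>y. - \<phi> y) x = - inf_lap \<phi> x"
proof -
  have c: "C2_near \<phi> x" and d: "inf_lap_defined \<phi> x" using assms by (auto simp: test_functions_def)
  have "inf_lap_defined (\<lambda>y. - \<phi> y) x \<and> inf_lap (\<lambda>y. - \<phi> y) x = - inf_lap \<phi> x"
  proof (cases "grad \<phi> x = 0")
    case True
    then obtain L where L: "((\<lambda>x'. 2 * (\<phi> x' - \<phi> x) / (dist x' x)\<^sup>2) \<longlongrightarrow> L) (at x)"
      using d by (auto simp: inf_lap_defined_def)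
    have e: "2 * (- \<phi> x' - - \<phi> x) / (dist x' x)\<^sup>2 = - (2 * (\<phi> x' - \<phi> x) / (dist x' x)\<^sup>2)" for x'
    proof -
      have "2 * (- \<phi> x' - - \<phi> x) = - (2 * (\<phi> x' - \<phi> x))" by simp
      then show ?thesis by (simp only: minus_divide_left)
    qed
    have L': "((\<lambda>x'. 2 * (- \<phi> x' - - \<phi> x) / (dist x' x)\<^sup>2) \<longlongrightarrow> - L) (at x)"
      unfolding e by (rule tendsto_minus[OF L])
    show ?thesis
      using inf_lap_zero[OF True L] inf_lap_zero[OF _ L'] L' True C2_near_uminus(2)[OF c]
      by (auto simp: inf_lap_defined_def)
  next
    case False
    have m: "(- A) *v h = - (A *v h)" "A *v (- h) = - (A *v h)" for A :: "real^'n^'n" and h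
      by (simp_all add: vec_eq_iff matrix_vector_mult_def sum_negf)
    show ?thesis using False C2_near_uminus[OF c]
      by (simp add: inf_lap_defined_def inf_lap_nonzero m)
  qed
  then show "(\<lambda>y. - \<phi> y) \<in> test_functions x" "inf_lap (\<lambda>y. - \<phi> y) x = - inf_lap \<phi> x"
    using C2_near_uminus(1)[OF c] by (auto simp: test_functions_def)
qed

text \<open>The half of the notion that concerns contact from above: the infinity Laplacian of
  \<open>v\<close> is at least \<open>- 2 * g\<close>, with \<open>g\<close> in the role of a
  running payoff. No continuity of \<open>v\<close> is demanded, as a relaxed limit is only known to
  be semicontinuous.\<close>

definition viscosity_sub :: "(real^'n) set \<Rightarrow> (real^'n \<Rightarrow> real) \<Rightarrow> (real^'n \<Rightarrow> real) \<Rightarrow> bool" where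
  "viscosity_sub U g v \<longleftrightarrow> (\<forall>x\<in>U. \<forall>\<phi>\<in>test_functions x.
     local_min_at (\<lambda>y. \<phi> y - v y) x \<longrightarrow> - 2 * g x \<le> inf_lap \<phi> x)"

lemma local_min_max_uminus: "local_max_at (\<lambda>y. \<phi> y - v y) x \<longleftrightarrow> local_min_at (\<lambda>y. - \<phi> y - - v y) x"
  for v \<phi> :: "'a::topological_space \<Rightarrow> real"
proof -
  have "\<phi> y - v y \<le> \<phi> x - v x \<longleftrightarrow> - \<phi> x - - v x \<le> - \<phi> y - - v y" for y by auto
  then show ?thesis by (simp only: local_max_at_def local_min_at_def)
qed

text \<open>The infinity Laplacian is odd, and negation turns contact from below into contact from
  above. So the other half is the subsolution property of \<open>- v\<close> with running payoff
  \<open>- f\<close>.\<close>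

lemma viscosity_solution_iff_sub:
  fixes v :: "real^'n \<Rightarrow> real"
  shows "viscosity_solution U (\<lambda>x. - 2 * f x) v \<longleftrightarrow>
    viscosity_sub U f v \<and> viscosity_sub U (\<lambda>x. - f x) (\<lambda>x. - v x)"
proof -
  have 1: "ereal (- 2 * f x) \<le> inf_lap_plus v x \<longleftrightarrow>
      (\<forall>\<phi>\<in>test_functions x. local_min_at (\<lambda>y. \<phi> y - v y) x \<longrightarrow> - 2 * f x \<le> inf_lap \<phi> x)" for x
    by (auto simp: inf_lap_plus_def le_INF_iff)
  have "inf_lap_minus v x \<le> ereal (- 2 * f x) \<longleftrightarrow>
      (\<forall>\<phi>\<in>test_functions x. local_max_at (\<lambda>y. \<phi> y - v y) x \<longrightarrow> inf_lap \<phi> x \<le> - 2 * f x)" for x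
    by (auto simp: inf_lap_minus_def SUP_le_iff)
  moreover have "(\<forall>\<phi>\<in>test_functions x. local_max_at (\<lambda>y. \<phi> y - v y) x \<longrightarrow> inf_lap \<phi> x \<le> - 2 * f x) \<longleftrightarrow>
      (\<forall>\<phi>\<in>test_functions x. local_min_at (\<lambda>y. \<phi> y - - v y) x \<longrightarrow> - 2 * - f x \<le> inf_lap \<phi> x)" for x
  proof (intro iffI ballI impI)
    fix \<phi> assume H: "\<forall>\<phi>\<in>test_functions x. local_max_at (\<lambda>y. \<phi> y - v y) x \<longrightarrow> inf_lap \<phi> x \<le> - 2 * f x"
      and \<phi>: "\<phi> \<in> test_functions x" "local_min_at (\<lambda>y. \<phi> y - - v y) x"
    have "local_max_at (\<lambda>y. - \<phi> y - v y) x" using \<phi>(2) by (simp add: local_min_max_uminus)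
    then show "- 2 * - f x \<le> inf_lap \<phi> x"
      using bspec[OF H test_functions_uminus(1)[OF \<phi>(1)]] test_functions_uminus(2)[OF \<phi>(1)] by simp
  next
    fix \<phi> assume H: "\<forall>\<phi>\<in>test_functions x. local_min_at (\<lambda>y. \<phi> y - - v y) x \<longrightarrow> - 2 * - f x \<le> inf_lap \<phi> x"
      and \<phi>: "\<phi> \<in> test_functions x" "local_max_at (\<lambda>y. \<phi> y - v y) x"
    have "local_min_at (\<lambda>y. - \<phi> y - - v y) x" using \<phi>(2) by (simp only: local_min_max_uminus)
    then show "inf_lap \<phi> x \<le> - 2 * f x"
      using bspec[OF H test_functions_uminus(1)[OF \<phi>(1)]] test_functions_uminus(2)[OF \<phi>(1)] by simp
  qed
  ultimately show ?thesis unfolding viscosity_solution_def viscosity_sub_def 1 by blast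
qed

section \<open>Radial test functions\<close>

lemma scaled_identity_minus_outer:
  fixes d h :: "real^'n"
  shows "(\<chi> i j. k * (if i = j then 1 else 0) - B * d $ i * d $ j) *v h = k *\<^sub>R h - (B * (d \<bullet> h)) *\<^sub>R d"
proof -
  have "(\<Sum>j\<in>UNIV. (k * (if i = j then 1 else 0) - B * d $ i * d $ j) * h $ j)
      = k * h $ i - (\<Sum>j\<in>UNIV. B * d $ i * (d $ j * h $ j))" for i
  proof -
    have "(k * (if i = j then 1 else 0) - B * d $ i * d $ j) * h $ j
        = (if i = j then k * h $ j else 0) - B * d $ i * (d $ j * h $ j)" for j
      by (simp add: algebra_simps)
    then show ?thesis by (simp add: sum_subtractf)
  qed
  then show ?thesis
    by (simp add: vec_eq_iff matrix_vector_mult_def inner_vec_def sum_distrib_left sum_distrib_right mult_ac)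
qed

text \<open>The gradient is radial, so only the second radial derivative \<open>2 * c\<close>
  counts, to which the term linear in the distance contributes nothing. The condition on
  \<open>b\<close> says that the gradient at \<open>w0\<close> is not zero.\<close>

lemma inf_lap_radial:
  fixes z w0 :: "real^'n" and a b c :: real
  defines "\<phi> \<equiv> \<lambda>w. a + b * norm (w - z) + c * (norm (w - z))\<^sup>2"
  assumes w0: "w0 \<noteq> z" and nz: "b / norm (w0 - z) + 2 * c \<noteq> 0"
  shows "\<phi> \<in> test_functions w0" "inf_lap \<phi> w0 = 2 * c"
proof -
  define k where "k w = b / norm (w - z) + 2 * c" for w
  define G where "G w = k w *\<^sub>R (w - z)" for w
  define H :: "real^'n \<Rightarrow> real^'n^'n" where
    "H w = (\<chi> i j. k w * (if i = j then 1 else 0) - b / (norm (w - z)) ^ 3 * (w - z) $ i * (w - z) $ j)" for w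
  have Hv: "H w *v h = k w *\<^sub>R h - (b / (norm (w - z)) ^ 3 * ((w - z) \<bullet> h)) *\<^sub>R (w - z)" for w h
    unfolding H_def by (rule scaled_identity_minus_outer)
  have dn: "((\<lambda>w. norm (w - z)) has_derivative (\<lambda>h. ((w - z) \<bullet> h) / norm (w - z))) (at w)" if "w \<noteq> z" for w
  proof -
    have "((\<lambda>w. w - z) has_derivative (\<lambda>h. h)) (at w)" by (auto intro!: derivative_eq_intros)
    moreover have "(norm has_derivative (\<lambda>h. h \<bullet> sgn (w - z))) (at (w - z))"
      using that by (intro has_derivative_norm) simp
    ultimately have "((\<lambda>w. norm (w - z)) has_derivative (\<lambda>h. h \<bullet> sgn (w - z))) (at w)"
      by (rule has_derivative_compose)
    then show ?thesis by (simp add: sgn_div_norm inner_commute divide_inverse mult.commute)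
  qed
  have d\<phi>: "(\<phi> has_derivative (\<lambda>h. G w \<bullet> h)) (at w)" if "w \<in> - {z}" for w
  proof -
    have r: "norm (w - z) \<noteq> 0" using that by simp
    note d = dn[of w]
    have 1: "(\<phi> has_derivative (\<lambda>h. 0 + b * (((w - z) \<bullet> h) / norm (w - z)) +
        c * (norm (w - z) * (((w - z) \<bullet> h) / norm (w - z)) + ((w - z) \<bullet> h) / norm (w - z) * norm (w - z)))) (at w)"
      unfolding \<phi>_def power2_eq_square
      by (intro has_derivative_add has_derivative_const has_derivative_mult_right has_derivative_mult d) (use that in auto)
    have 2: "0 + b * (((w - z) \<bullet> h) / norm (w - z)) +
        c * (norm (w - z) * (((w - z) \<bullet> h) / norm (w - z)) + ((w - z) \<bullet> h) / norm (w - z) * norm (w - z)) = G w \<bullet> h" for h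
      unfolding G_def k_def inner_scaleR_left using r by (simp add: distrib_right)
    show ?thesis by (rule has_derivative_eq_rhs[OF 1]) (rule ext, rule 2)
  qed
  have dG: "(G has_derivative (\<lambda>h. H w *v h)) (at w)" if "w \<in> - {z}" for w
  proof -
    have r: "norm (w - z) \<noteq> 0" using that by simp
    note d = dn[of w]
    have 1: "(k has_derivative (\<lambda>h. b * - (inverse (norm (w - z)) * (((w - z) \<bullet> h) / norm (w - z)) * inverse (norm (w - z))) + 0)) (at w)"
      unfolding k_def divide_inverse[of b]
      by (intro has_derivative_add has_derivative_const has_derivative_mult_right Deriv.has_derivative_inverse d) (use that in auto)
    have 2: "b * - (inverse (norm (w - z)) * (((w - z) \<bullet> h) / norm (w - z)) * inverse (norm (w - z))) + 0
        = - (b / (norm (w - z)) ^ 3 * ((w - z) \<bullet> h))" for h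
      using r by (simp add: divide_inverse power3_eq_cube)
    have k: "(k has_derivative (\<lambda>h. - (b / (norm (w - z)) ^ 3 * ((w - z) \<bullet> h)))) (at w)" by (rule has_derivative_eq_rhs[OF 1]) (rule ext, rule 2)
    have "((\<lambda>w. w - z) has_derivative (\<lambda>h. h)) (at w)" by (auto intro!: derivative_eq_intros)
    from has_derivative_scaleR[OF k this] show ?thesis unfolding G_def Hv by simp
  qed
  have cH: "continuous_on (- {z}) H"
    unfolding H_def k_def by (intro continuous_intros) auto
  note C = C2_nearI[where \<phi> = \<phi>, OF _ _ d\<phi> dG cH, of w0]
  have g: "C2_near \<phi> w0" "grad \<phi> w0 = G w0" "hess \<phi> w0 = H w0" using C w0 by auto
  have G0: "G w0 \<noteq> 0" using w0 nz by (simp add: G_def k_def)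
  then show "\<phi> \<in> test_functions w0" using g by (simp add: test_functions_def inf_lap_defined_def)
  define r where "r = norm (w0 - z)"
  have r: "r \<noteq> 0" using w0 by (simp add: r_def)
  have nk: "k w0 \<noteq> 0" using nz by (simp add: k_def)
  have rr: "(w0 - z) \<bullet> (w0 - z) = r\<^sup>2" by (simp add: r_def power2_norm_eq_inner)
  have "G w0 \<bullet> (H w0 *v G w0) = (k w0)\<^sup>2 * (k w0 * r\<^sup>2 - b / r ^ 3 * r\<^sup>2 * r\<^sup>2)"
  proof -
    obtain d where d: "d = w0 - z" by blast
    have "d \<bullet> d = r\<^sup>2" "norm d = r" using rr by (simp_all add: d r_def)
    then show ?thesis
      unfolding Hv G_def d[symmetric]
      by (simp add: inner_diff_right power2_eq_square algebra_simps)
  qed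
  also have "\<dots> = (k w0)\<^sup>2 * r\<^sup>2 * (k w0 - b / r)"
    using r by (simp add: field_simps power2_eq_square power3_eq_cube)
  also have "k w0 - b / r = 2 * c" by (simp add: k_def r_def)
  finally have "G w0 \<bullet> (H w0 *v G w0) = (k w0)\<^sup>2 * r\<^sup>2 * (2 * c)" .
  moreover have "(norm (G w0))\<^sup>2 = (k w0)\<^sup>2 * r\<^sup>2" by (simp add: G_def r_def power_mult_distrib)
  ultimately show "inf_lap \<phi> w0 = 2 * c"
    using g G0 r nk by (simp add: inf_lap_nonzero)
qed

text \<open>At the centre the gradient vanishes, but the difference quotient is constantly
  \<open>2 * c\<close>.\<close>

lemma inf_lap_square:
  fixes z :: "real^'n" and a c :: real
  defines "\<phi> \<equiv> \<lambda>w. a + c * (norm (w - z))\<^sup>2"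
  shows "\<phi> \<in> test_functions z" "inf_lap \<phi> z = 2 * c"
proof -
  have d\<phi>: "(\<phi> has_derivative (\<lambda>h. ((2 * c) *\<^sub>R (w - z)) \<bullet> h)) (at w)" for w
    unfolding \<phi>_def power2_norm_eq_inner
    by (rule derivative_eq_intros refl)+ (simp add: fun_eq_iff inner_commute algebra_simps)
  have m: "(\<chi> i j. 2 * c * (if i = j then 1 else 0)) *v h = (2 * c) *\<^sub>R h" for h :: "real^'n"
    by (simp add: vec_eq_iff matrix_vector_mult_def if_distrib if_distribR cong: if_cong)
  have dG: "((\<lambda>w. (2 * c) *\<^sub>R (w - z)) has_derivative (\<lambda>h. (\<chi> i j. 2 * c * (if i = j then 1 else 0)) *v h)) (at w)" for w
    unfolding m by (auto intro!: derivative_eq_intros)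
  note C = C2_nearI[of UNIV z \<phi>, OF _ _ d\<phi> dG]
  have g: "C2_near \<phi> z" "grad \<phi> z = 0" using C by (auto simp: continuous_on_const)
  have "\<forall>\<^sub>F x' in at z. 2 * c = 2 * (\<phi> x' - \<phi> z) / (dist x' z)\<^sup>2"
    using eventually_neq_at_within[of z z UNIV]
    by eventually_elim (simp add: \<phi>_def dist_norm)
  then have L: "((\<lambda>x'. 2 * (\<phi> x' - \<phi> z) / (dist x' z)\<^sup>2) \<longlongrightarrow> 2 * c) (at z)"
    by (rule Lim_transform_eventually[OF tendsto_const])
  show "\<phi> \<in> test_functions z" using g L by (auto simp: test_functions_def inf_lap_defined_def)
  show "inf_lap \<phi> z = 2 * c" by (rule inf_lap_zero[OF g(2) L])
qed

section \<open>Relaxed limits are viscosity solutions\<close>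

lemma Sup_Inf_ball_le:
  fixes Q :: "'a::euclidean_space \<Rightarrow> real"
  assumes e: "0 < e" and Q: "continuous_on UNIV Q"
    and le: "\<And>y. y \<in> ball x e \<Longrightarrow> \<exists>y'\<in>ball x e. Q y + Q y' \<le> c"
  shows "2 * midrange UNIV e Q x \<le> c"
proof -
  have "compact (Q ` cball x e)" by (intro compact_continuous_image continuous_on_subset[OF Q]) auto
  then have "bounded (Q ` ball x e)"
    by (meson ball_subset_cball bounded_subset compact_imp_bounded image_mono)
  then have bb: "bdd_below (Q ` ball x e)" by (rule bounded_imp_bdd_below)
  have "Sup (Q ` ball x e) \<le> c - Inf (Q ` ball x e)"
  proof (rule cSUP_least)
    fix y assume "y \<in> ball x e"
    then obtain y' where "y' \<in> ball x e" "Q y + Q y' \<le> c" using le by blast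
    then show "Q y \<le> c - Inf (Q ` ball x e)" using cINF_lower[OF bb, of y'] by linarith
  qed (use e in auto)
  then show ?thesis using midrange_double[of UNIV e Q x] by (simp add: nb_UNIV)
qed

text \<open>Answer \<open>y\<close> by its reflection in \<open>x\<close>; the parallelogram law
  leaves only the second order term. This works at every \<open>x\<close>, also where the gradient
  vanishes.\<close>

lemma square_supersolution:
  fixes x x0 :: "'a::euclidean_space"
  assumes "0 < e" "0 \<le> c"
  shows "midrange UNIV e (\<lambda>y. c0 + c * (norm (y - x0))\<^sup>2) x \<le> c0 + c * (norm (x - x0))\<^sup>2 + c * e\<^sup>2"
proof -
  let ?Q = "\<lambda>y. c0 + c * (norm (y - x0))\<^sup>2"
  have "2 * midrange UNIV e ?Q x \<le> 2 * (c0 + c * (norm (x - x0))\<^sup>2 + c * e\<^sup>2)"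
  proof (rule Sup_Inf_ball_le[OF assms(1)])
    show "continuous_on UNIV ?Q" by (intro continuous_intros)
    fix y assume y: "y \<in> ball x e"
    define h where "h = y - x"
    have "norm h \<le> e" using y by (simp add: h_def dist_norm norm_minus_commute)
    then have "c * (norm h)\<^sup>2 \<le> c * e\<^sup>2" using assms by (intro mult_left_mono power_mono) auto
    moreover have "x - h \<in> ball x e" using y by (simp add: h_def dist_norm norm_minus_commute)
    moreover have "(norm (y - x0))\<^sup>2 + (norm (x - h - x0))\<^sup>2 = 2 * (norm (x - x0))\<^sup>2 + 2 * (norm h)\<^sup>2"
      by (simp add: h_def power2_norm_eq_inner inner_diff_left inner_diff_right inner_commute algebra_simps)
    then have "c * (norm (y - x0))\<^sup>2 + c * (norm (x - h - x0))\<^sup>2 = 2 * (c * (norm (x - x0))\<^sup>2) + 2 * (c * (norm h)\<^sup>2)"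
      by (metis (no_types, opaque_lifting) distrib_left mult.left_commute)
    ultimately show "\<exists>y'\<in>ball x e. ?Q y + ?Q y' \<le> 2 * (c0 + c * (norm (x - x0))\<^sup>2 + c * e\<^sup>2)"
      by (intro bexI[of _ "x - h"]) (auto simp: distrib_left)
  qed
  then show ?thesis by simp
qed

text \<open>Near a point where the gradient does not vanish, a displacement \<open>e h\<close> is either almost parallel to the
  gradient, and then pairing it with \<open>- e h\<close> leaves only the second order term, or it gains so much
  less than steepest descent loses that first order terms decide.\<close>

lemma quadratic_supersolution:
  fixes p x0 :: "'a::euclidean_space" and A :: "'a \<Rightarrow> 'a" and c0 :: real
  assumes A: "bounded_linear A" and p: "p \<noteq> 0" and D: "(p \<bullet> A p) / (norm p)\<^sup>2 < - 2 * \<gamma>"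
  defines "Q \<equiv> \<lambda>y. c0 + p \<bullet> (y - x0) + ((y - x0) \<bullet> A (y - x0)) / 2"
  shows "\<exists>\<rho>>0. \<forall>x\<in>ball x0 \<rho>. \<forall>e. 0 < e \<longrightarrow> e < \<rho> \<longrightarrow> midrange UNIV e Q x + e\<^sup>2 * \<gamma> \<le> Q x"
proof -
  interpret A: bounded_linear A by (rule A)
  define n where "n = p /\<^sub>R norm p"
  have n: "norm n = 1" "p \<bullet> n = norm p" "p = norm p *\<^sub>R n"
    using p by (auto simp: n_def power2_norm_eq_inner[symmetric] power2_eq_square)
  have "n \<bullet> A n = (p \<bullet> A p) / (norm p)\<^sup>2" by (simp add: n_def A.scaleR power2_eq_square divide_inverse)
  then have Dn: "n \<bullet> A n < - 2 * \<gamma>" using D by simp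
  have cA: "continuous_on UNIV (\<lambda>h. h \<bullet> A h)"
    by (intro continuous_intros A.continuous_on)
  then obtain d where d: "0 < d" "\<And>h. dist h n < d \<Longrightarrow> dist (h \<bullet> A h) (n \<bullet> A n) < - 2 * \<gamma> - n \<bullet> A n"
    using Dn unfolding continuous_on_iff by (metis UNIV_I diff_gt_0_iff_gt)
  \<comment> \<open>For \<open>norm h \<le> 1\<close> and
    \<open>1 - \<sigma> < n \<bullet> h\<close> the square of \<open>norm (h - n)\<close> is below
    \<open>2 * \<sigma> < d\<^sup>2\<close>, so \<open>h\<close> is in the range where the strict
    inequality at \<open>n\<close> persists.\<close>
  define \<sigma> where "\<sigma> = min 1 (d\<^sup>2 / 4)"
  have \<sigma>: "0 < \<sigma>" "\<sigma> \<le> 1" "2 * \<sigma> < d\<^sup>2" using d(1) by (auto simp: \<sigma>_def min_def)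
  have near: "h \<bullet> A h < - 2 * \<gamma>" if h: "norm h \<le> 1" "1 - \<sigma> < n \<bullet> h" for h
  proof -
    have "(norm (h - n))\<^sup>2 = (norm h)\<^sup>2 + 1 - 2 * (n \<bullet> h)"
      using n(1) by (simp add: power2_norm_eq_inner[symmetric] dot_norm_neg inner_commute)
        (simp add: power2_norm_eq_inner inner_diff_left inner_diff_right inner_commute norm_eq_1)
    also have "\<dots> \<le> 2 - 2 * (n \<bullet> h)" using h power_le_one[of "norm h" 2] by simp
    also have "\<dots> < d\<^sup>2" using h \<sigma> by simp
    finally have "norm (h - n) < d" using d(1) by (rule power_less_imp_less_base[OF _ less_imp_le])
    then show ?thesis using d(2)[of h] by (simp add: dist_norm abs_less_iff)
  qed
  obtain B where B: "0 < B" "\<And>h. norm (A h) \<le> norm h * B" using A.pos_bounded by blast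
  have AB: "\<bar>h \<bullet> A k\<bar> \<le> norm h * norm k * B" for h k
  proof -
    have "\<bar>h \<bullet> A k\<bar> \<le> norm h * norm (A k)" by (rule Cauchy_Schwarz_ineq2)
    also have "\<dots> \<le> norm h * (norm k * B)" using B(2) by (intro mult_left_mono) auto
    finally show ?thesis by simp
  qed
  have Qh: "Q (x + h) = Q x + p \<bullet> h + ((x - x0) \<bullet> A h + h \<bullet> A (x - x0)) / 2 + (h \<bullet> A h) / 2" for x h
    by (simp add: Q_def A.add A.diff inner_add_left inner_add_right inner_diff_left inner_diff_right add_divide_distrib
        diff_divide_distrib)
  \<comment> \<open>Balances the second order errors, \<open>3 * B\<close> from the form
    \<open>A\<close> and \<open>2 * \<bar>\<gamma>\<bar>\<close> from the running term, against the
    first order gain \<open>norm p * \<sigma> / 2\<close>.\<close>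
  define \<rho> where "\<rho> = norm p * \<sigma> / 2 / (3 * B + 2 * \<bar>\<gamma>\<bar>)"
  have \<rho>: "0 < \<rho>" using p \<sigma> B by (simp add: \<rho>_def add_pos_nonneg)
  have "3 * B + 2 * \<bar>\<gamma>\<bar> \<noteq> 0" using B(1) by linarith
  then have "\<rho> * (3 * B + 2 * \<bar>\<gamma>\<bar>) = norm p * \<sigma> / 2" using nonzero_eq_divide_eq \<rho>_def by blast
  then have \<rho>': "3 * (B * \<rho>) + 2 * (\<bar>\<gamma>\<bar> * \<rho>) = norm p * \<sigma> / 2" by (simp add: algebra_simps)
  have Qb: "Q (x + h) \<le> Q x + p \<bullet> h + B * \<rho> * e + B * e\<^sup>2 / 2"
    if "norm (x - x0) \<le> \<rho>" "norm h \<le> e" "0 < e" for x h e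
  proof -
    have b: "s \<bullet> A t \<le> B * (\<sigma> * \<tau>)" if st: "norm s \<le> \<sigma>" "norm t \<le> \<tau>" "0 \<le> \<sigma>" for s t :: 'a and \<sigma> \<tau> :: real
    proof -
      have "s \<bullet> A t \<le> norm s * norm t * B" by (rule abs_le_D1[OF AB])
      also have "\<dots> \<le> \<sigma> * \<tau> * B" using st B(1) by (intro mult_right_mono mult_mono) auto
      finally show ?thesis by (simp only: mult.commute)
    qed
    have "(x - x0) \<bullet> A h \<le> B * \<rho> * e" "h \<bullet> A (x - x0) \<le> B * \<rho> * e" "h \<bullet> A h \<le> B * e\<^sup>2"
      using b[where s = "x - x0" and t = h and \<sigma> = \<rho> and \<tau> = e] b[where s = h and t = "x - x0" and \<sigma> = e and \<tau> = \<rho>]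
        b[where s = h and t = h and \<sigma> = e and \<tau> = e] that \<rho>
      by (simp_all add: power2_eq_square mult.assoc mult.commute[of e \<rho>])
    then show ?thesis unfolding Qh by (intro add_mono) auto
  qed
  have "midrange UNIV e Q x + e\<^sup>2 * \<gamma> \<le> Q x" if x: "x \<in> ball x0 \<rho>" and e: "0 < e" "e < \<rho>" for x e
  proof -
    have xn: "norm (x - x0) \<le> \<rho>" using x by (simp add: dist_norm norm_minus_commute)
    have "2 * midrange UNIV e Q x \<le> 2 * Q x - 2 * (e\<^sup>2 * \<gamma>)"
    proof (rule Sup_Inf_ball_le[OF e(1)])
      show "continuous_on UNIV Q" unfolding Q_def by (intro continuous_intros A.continuous_on) auto
      fix y assume y: "y \<in> ball x e"
      define h where "h = (y - x) /\<^sub>R e"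
      have h: "norm h < 1" "y = x + e *\<^sub>R h"
        using y e by (auto simp: h_def dist_norm norm_minus_commute divide_simps)
      show "\<exists>y'\<in>ball x e. Q y + Q y' \<le> 2 * Q x - 2 * (e\<^sup>2 * \<gamma>)"
      proof (cases "1 - \<sigma> < n \<bullet> h")
        case True
        have "Q y + Q (x + - (e *\<^sub>R h)) = 2 * Q x + e\<^sup>2 * (h \<bullet> A h)"
          unfolding h Qh by (simp add: A.scaleR A.neg power2_eq_square add_divide_distrib diff_divide_distrib)
        moreover have "e\<^sup>2 * (h \<bullet> A h) \<le> e\<^sup>2 * (- 2 * \<gamma>)" using near[OF _ True] h by (intro mult_left_mono) auto
        moreover have "x + - (e *\<^sub>R h) \<in> ball x e" using h e by (simp add: dist_norm)
        ultimately show ?thesis by (intro bexI[of _ "x + - (e *\<^sub>R h)"]) auto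
      next
        case False
        \<comment> \<open>Almost steepest descent, shortened to stay in the open ball: it loses
          \<open>1 - \<sigma> / 2\<close> times \<open>norm p\<close>, whereas \<open>h\<close>
          gains at most \<open>1 - \<sigma>\<close> times that.\<close>
        define k where "k = - ((1 - \<sigma> / 2) *\<^sub>R n)"
        have k: "norm (e *\<^sub>R k) < e" using \<sigma> e n by (simp add: k_def)
        have "p \<bullet> h = norm p * (n \<bullet> h)" by (subst n(3)) simp
        also have "\<dots> \<le> norm p * (1 - \<sigma>)" using False by (intro mult_left_mono) auto
        finally have "p \<bullet> h + p \<bullet> k \<le> - (norm p * \<sigma> / 2)"
          using n by (simp add: k_def algebra_simps)
        then have "e * (p \<bullet> h + p \<bullet> k) \<le> e * (- (norm p * \<sigma> / 2))" using e by (intro mult_left_mono) auto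
        moreover have "Q y \<le> Q x + e * (p \<bullet> h) + B * \<rho> * e + B * e\<^sup>2 / 2"
          using Qb[OF xn, of "e *\<^sub>R h" e] h e by simp
        moreover have "Q (x + e *\<^sub>R k) \<le> Q x + e * (p \<bullet> k) + B * \<rho> * e + B * e\<^sup>2 / 2"
          using Qb[OF xn, of "e *\<^sub>R k" e] k e by simp
        ultimately have 1: "Q y + Q (x + e *\<^sub>R k) \<le> 2 * Q x - e * (norm p * \<sigma> / 2) + 2 * (B * \<rho> * e) + B * e\<^sup>2"
          by (simp add: distrib_left)
        have "B * e\<^sup>2 \<le> B * \<rho> * e" using e B by (simp add: power2_eq_square)
        moreover have "e\<^sup>2 * \<gamma> \<le> e * (\<bar>\<gamma>\<bar> * \<rho>)"
        proof -
          have "e * \<gamma> \<le> e * \<bar>\<gamma>\<bar>" using e by (intro mult_left_mono) auto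
          also have "\<dots> \<le> \<rho> * \<bar>\<gamma>\<bar>" using e by (intro mult_right_mono) auto
          finally have "e * (e * \<gamma>) \<le> e * (\<rho> * \<bar>\<gamma>\<bar>)" using e(1) by (rule mult_left_mono[OF _ less_imp_le])
          then show ?thesis by (simp add: power2_eq_square mult_ac)
        qed
        moreover have "e * (norm p * \<sigma> / 2) = 3 * (B * \<rho> * e) + 2 * (e * (\<bar>\<gamma>\<bar> * \<rho>))"
          unfolding \<rho>'[symmetric] by (simp add: algebra_simps)
        ultimately have "Q y + Q (x + e *\<^sub>R k) \<le> 2 * Q x - 2 * (e\<^sup>2 * \<gamma>)" using 1 by linarith
        moreover have "x + e *\<^sub>R k \<in> ball x e" using k by (simp add: dist_norm)
        ultimately show ?thesis by blast
      qed
    qed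
    then show ?thesis by simp
  qed
  then show ?thesis using \<rho> by blast
qed

section \<open>Contact of test functions with a relaxed upper limit\<close>

locale relaxed_subsolution = bounded_domain U for U :: "'a::euclidean_space set" +
  fixes V :: "real \<Rightarrow> 'a \<Rightarrow> real" and g v :: "'a \<Rightarrow> real" and e0 R :: real
  assumes e0: "0 < e0" and V_bound: "\<And>e x. 0 < e \<Longrightarrow> e < e0 \<Longrightarrow> x \<in> closure U \<Longrightarrow> \<bar>V e x\<bar> \<le> R"
    and V_sub: "\<And>e x. 0 < e \<Longrightarrow> e < e0 \<Longrightarrow> x \<in> U \<Longrightarrow> V e x \<le> midrange (closure U) e (V e) x + e\<^sup>2 * g x"
    and lim: "relaxed_limsup (closure U) V v" and g: "continuous_on U g"
begin

lemma g_upper: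
  assumes "x \<in> U" "0 < d"
  obtains \<rho> where "0 < \<rho>" "cball x \<rho> \<subseteq> U" "\<And>y. y \<in> cball x \<rho> \<Longrightarrow> g y \<le> g x + d"
proof -
  obtain r where r: "0 < r" "cball x r \<subseteq> U" using open_U assms(1) open_contains_cball by blast
  obtain s where s: "0 < s" "\<And>y. y \<in> U \<Longrightarrow> dist y x < s \<Longrightarrow> dist (g y) (g x) < d"
    using g assms unfolding continuous_on_iff by metis
  show thesis
  proof (rule that[of "min r (s / 2)"])
    show "0 < min r (s / 2)" using r s by simp
    show sub: "cball x (min r (s / 2)) \<subseteq> U" using r by auto
    fix y assume y: "y \<in> cball x (min r (s / 2))"
    then have "dist (g y) (g x) < d" using sub s by (intro s) (auto simp: dist_commute)
    then show "g y \<le> g x + d" unfolding dist_real_def by linarith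
  qed
qed

lemma touch_quadratic:
  assumes x0: "x0 \<in> U" and A: "bounded_linear A" and p: "p \<noteq> 0" and \<rho>: "0 < \<rho>"
    and touch: "\<And>x. x \<in> ball x0 \<rho> \<Longrightarrow> v x \<le> v x0 + p \<bullet> (x - x0) + ((x - x0) \<bullet> A (x - x0)) / 2"
  shows "- 2 * g x0 \<le> (p \<bullet> A p) / (norm p)\<^sup>2"
proof (rule ccontr)
  assume n: "\<not> - 2 * g x0 \<le> (p \<bullet> A p) / (norm p)\<^sup>2"
  define D where "D = (p \<bullet> A p) / (norm p)\<^sup>2"
  define d where "d = (- 2 * g x0 - D) / 8"
  have d: "0 < d" "D = - 2 * g x0 - 8 * d" using n by (auto simp: d_def D_def field_simps)
  \<comment> \<open>The added \<open>2 * d\<close> makes the contact strict. The gap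
    \<open>8 * d\<close> between \<open>D\<close> and \<open>- 2 * g x0\<close> leaves enough for
    this, for the variation of \<open>g\<close> and for the strictness of the discrete
    inequality.\<close>
  define A' where "A' h = A h + (2 * d) *\<^sub>R h" for h
  have A': "bounded_linear A'" unfolding A'_def by (intro bounded_linear_add A bounded_linear_scaleR_right)
  define \<gamma> where "\<gamma> = g x0 + 2 * d"
  have "(p \<bullet> A' p) / (norm p)\<^sup>2 = D + 2 * d"
    using p by (simp add: A'_def D_def inner_add_right power2_norm_eq_inner add_divide_distrib)
  then have D': "(p \<bullet> A' p) / (norm p)\<^sup>2 < - 2 * \<gamma>" using d by (simp add: \<gamma>_def)
  define Q where "Q y = v x0 + p \<bullet> (y - x0) + ((y - x0) \<bullet> A' (y - x0)) / 2" for y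
  obtain r where r: "0 < r" "\<And>x e. x \<in> ball x0 r \<Longrightarrow> 0 < e \<Longrightarrow> e < r \<Longrightarrow> midrange UNIV e Q x + e\<^sup>2 * \<gamma> \<le> Q x"
    using quadratic_supersolution[OF A' p D', where ?c0.0 = "v x0" and ?x0.0 = x0] unfolding Q_def by blast
  obtain s where s: "0 < s" "cball x0 s \<subseteq> U" "\<And>y. y \<in> cball x0 s \<Longrightarrow> g y \<le> g x0 + d"
    using g_upper[OF x0 d(1)] by blast
  define t where "t = min s (min r \<rho>) / 2"
  have t: "0 < t" "t < s" "t < r" "t < \<rho>" using s r \<rho> by (auto simp: t_def)
  show False
  proof (rule touching_contradiction[OF e0 V_bound V_sub lim, of x0 t Q d])
    interpret A': bounded_linear A' by (rule A')
    show "continuous_on (cball x0 t) Q" unfolding Q_def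
      by (intro continuous_intros A'.continuous_on) auto
    show "v x0 = Q x0" by (simp add: Q_def)
    show "v x < Q x" if "x \<in> cball x0 t" "x \<noteq> x0" for x
    proof -
      have "v x \<le> v x0 + p \<bullet> (x - x0) + ((x - x0) \<bullet> A (x - x0)) / 2" using that t by (intro touch) auto
      moreover have "Q x = v x0 + p \<bullet> (x - x0) + ((x - x0) \<bullet> A (x - x0)) / 2 + d * ((x - x0) \<bullet> (x - x0))"
        by (simp add: Q_def A'_def inner_add_right add_divide_distrib)
      moreover have "0 < d * ((x - x0) \<bullet> (x - x0))" using d that by simp
      ultimately show ?thesis by linarith
    qed
    show "midrange UNIV e Q x + e\<^sup>2 * (g x + d) \<le> Q x" if "x \<in> cball x0 t" "0 < e" "e < t" for x e
    proof -
      have "g x \<le> g x0 + d" using that t by (intro s(3)) auto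
      then have "e\<^sup>2 * (g x + d) \<le> e\<^sup>2 * \<gamma>" by (intro mult_left_mono) (auto simp: \<gamma>_def)
      moreover have "midrange UNIV e Q x + e\<^sup>2 * \<gamma> \<le> Q x" using that t by (intro r(2)) auto
      ultimately show ?thesis by linarith
    qed
  qed (use t s d in auto)
qed

lemma touch_square:
  assumes x0: "x0 \<in> U" and c: "0 \<le> c" and \<rho>: "0 < \<rho>"
    and touch: "\<And>x. x \<in> ball x0 \<rho> \<Longrightarrow> v x \<le> v x0 + c * (norm (x - x0))\<^sup>2"
  shows "- g x0 \<le> c"
proof (rule ccontr)
  assume n: "\<not> - g x0 \<le> c"
  define d where "d = (- g x0 - c) / 4"
  have d: "0 < d" "c = - g x0 - 4 * d" using n by (auto simp: d_def field_simps)
  define Q where "Q y = v x0 + (c + d) * (norm (y - x0))\<^sup>2" for y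
  obtain s where s: "0 < s" "cball x0 s \<subseteq> U" "\<And>y. y \<in> cball x0 s \<Longrightarrow> g y \<le> g x0 + d"
    using g_upper[OF x0 d(1)] by blast
  define t where "t = min s \<rho> / 2"
  have t: "0 < t" "t < s" "t < \<rho>" using s \<rho> by (auto simp: t_def)
  show False
  proof (rule touching_contradiction[OF e0 V_bound V_sub lim, of x0 t Q d])
    show "continuous_on (cball x0 t) Q" unfolding Q_def by (intro continuous_intros)
    show "v x0 = Q x0" by (simp add: Q_def)
    show "v x < Q x" if "x \<in> cball x0 t" "x \<noteq> x0" for x
    proof -
      have "v x \<le> v x0 + c * (norm (x - x0))\<^sup>2" using that t by (intro touch) auto
      moreover have "0 < d * (norm (x - x0))\<^sup>2" using d that by simp
      ultimately show ?thesis by (simp add: Q_def distrib_right)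
    qed
    show "midrange UNIV e Q x + e\<^sup>2 * (g x + d) \<le> Q x" if "x \<in> cball x0 t" "0 < e" "e < t" for x e
    proof -
      have "g x \<le> g x0 + d" using that t by (intro s(3)) auto
      then have "e\<^sup>2 * (g x + d) \<le> e\<^sup>2 * (- (c + d))" using d by (intro mult_left_mono) auto
      moreover have "midrange UNIV e Q x \<le> Q x + (c + d) * e\<^sup>2"
        using square_supersolution[OF that(2), of "c + d" "v x0" x0 x] c d unfolding Q_def by simp
      moreover have "(c + d) * e\<^sup>2 = - (e\<^sup>2 * - (c + d))" by (simp add: algebra_simps)
      ultimately show ?thesis by linarith
    qed
  qed (use t s d in auto)
qed

text \<open>A concave paraboloid touching at its vertex gives no information in the discrete problem.
  Moving its centre slightly moves the contact point away from the vertex.\<close>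

lemma touch_concave:
  assumes x0: "x0 \<in> U" and q: "0 < q" and \<rho>: "0 < \<rho>"
    and touch: "\<And>x. x \<in> ball x0 \<rho> \<Longrightarrow> v x \<le> v x0 - q * (norm (x - x0))\<^sup>2"
  shows "q \<le> g x0"
proof (rule ccontr)
  assume n: "\<not> q \<le> g x0"
  \<comment> \<open>Strictly between \<open>max 0 (g x0)\<close> and \<open>q\<close>: flatter than
    the given paraboloid, which leaves room to move the centre, but still too curved for the values
    of \<open>g\<close> near \<open>x0\<close>.\<close>
  define q' where "q' = (q + max 0 (g x0)) / 2"
  have q': "0 < q'" "q' < q" "g x0 < q'" using n q by (auto simp: q'_def max_def field_simps)
  obtain s where s: "0 < s" "cball x0 s \<subseteq> U" "\<And>y. y \<in> cball x0 s \<Longrightarrow> g y \<le> g x0 + (q' - g x0) / 2"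
    using g_upper[OF x0, of "(q' - g x0) / 2"] q' by auto
  define t where "t = min s \<rho> / 2"
  have t: "0 < t" "t < s" "t < \<rho>" using s \<rho> by (auto simp: t_def)
  \<comment> \<open>A shift \<open>\<tau>\<close> this small keeps the maximum of
    \<open>v x + q' * (norm (x - p))\<^sup>2\<close> off the sphere of radius
    \<open>t\<close>.\<close>
  have "((\<lambda>\<tau>. q' * (t + \<tau>)\<^sup>2) \<longlongrightarrow> q' * (t + 0)\<^sup>2) (at_right 0)"
    by (intro tendsto_intros)
  moreover have "q' * (t + 0)\<^sup>2 < q * t\<^sup>2" using q' t by simp
  ultimately have "\<forall>\<^sub>F \<tau> in at_right 0. q' * (t + \<tau>)\<^sup>2 < q * t\<^sup>2" by (rule order_tendstoD(2))
  moreover have "\<forall>\<^sub>F \<tau> in at_right (0::real). \<tau> \<in> {0<..<t}" by (rule eventually_at_right_real[OF t(1)])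
  ultimately have "\<forall>\<^sub>F \<tau> in at_right 0. q' * (t + \<tau>)\<^sup>2 < q * t\<^sup>2 \<and> 0 < \<tau> \<and> \<tau> < t"
    by eventually_elim auto
  then obtain \<tau> where \<tau>: "q' * (t + \<tau>)\<^sup>2 < q * t\<^sup>2" "0 < \<tau>" "\<tau> < t"
    using eventually_happens' trivial_limit_at_right_real by blast
  obtain b :: 'a where b: "b \<in> Basis" using nonempty_Basis by blast
  define p where "p = x0 + \<tau> *\<^sub>R b"
  have p: "norm (x0 - p) = \<tau>" "norm (p - x0) = \<tau>" using b \<tau> by (simp_all add: p_def norm_Basis)
  have usc: "usc_on (cball x0 t) (\<lambda>x. v x + q' * (norm (x - p))\<^sup>2)"
  proof (rule usc_on_add_continuous)
    have "cball x0 t \<subseteq> cball x0 s" using t by auto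
    then have "cball x0 t \<subseteq> closure U" using s(2) U_sub by blast
    then show "usc_on (cball x0 t) v" by (rule usc_on_subset[OF usc_relaxed_limsup[OF lim]])
  qed (intro continuous_intros)
  obtain x1 where x1: "x1 \<in> cball x0 t" "\<And>x. x \<in> cball x0 t \<Longrightarrow> v x + q' * (norm (x - p))\<^sup>2 \<le> v x1 + q' * (norm (x1 - p))\<^sup>2"
    using usc_attains_sup_cball[OF usc] t(1) by auto
  have le: "v x1 \<le> v x0 - q * (norm (x1 - x0))\<^sup>2" using x1(1) t by (intro touch) auto
  have max0: "v x0 + q' * \<tau>\<^sup>2 \<le> v x1 + q' * (norm (x1 - p))\<^sup>2" using x1(2)[of x0] t p by simp
  \<comment> \<open>At the new centre \<open>p\<close> the given bound makes \<open>v\<close> drop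
    below \<open>v x0\<close>, whereas a maximum there would make it rise. So the moved paraboloid
    has a nonzero gradient at the contact point, and \<open>touch_quadratic\<close> applies.\<close>
  have x1p: "x1 \<noteq> p"
  proof
    assume "x1 = p"
    then have "q' * \<tau>\<^sup>2 \<le> - (q * \<tau>\<^sup>2)" using le max0 p by simp
    moreover have "0 < q' * \<tau>\<^sup>2" "0 < q * \<tau>\<^sup>2" using q' q \<tau> by auto
    ultimately show False by linarith
  qed
  have x1t: "norm (x1 - x0) < t"
  proof (rule ccontr)
    assume "\<not> norm (x1 - x0) < t"
    then have x1n: "norm (x1 - x0) = t" using x1(1) by (simp add: dist_norm norm_minus_commute)
    have "norm (x1 - p) \<le> t + \<tau>" using norm_triangle_ineq[of "x1 - x0" "x0 - p"] x1n p by simp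
    then have "q' * (norm (x1 - p))\<^sup>2 \<le> q' * (t + \<tau>)\<^sup>2" using q' by (intro mult_left_mono power_mono) auto
    moreover have "0 \<le> q' * \<tau>\<^sup>2" using q' by simp
    ultimately show False using le max0 \<tau>(1) x1n by simp
  qed
  define P where "P = - (2 * q') *\<^sub>R (x1 - p)"
  define A where "A h = - (2 * q') *\<^sub>R h" for h :: 'a
  have P: "P \<noteq> 0" using q' x1p by (simp add: P_def)
  have x1U: "x1 \<in> U" using x1(1) t s by auto
  have "- 2 * g x1 \<le> (P \<bullet> A P) / (norm P)\<^sup>2"
  proof (rule touch_quadratic[OF x1U _ P, of A "t - norm (x1 - x0)"])
    show "bounded_linear A" unfolding A_def by (rule bounded_linear_scaleR_right)
    show "0 < t - norm (x1 - x0)" using x1t by simp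
    fix x assume x: "x \<in> ball x1 (t - norm (x1 - x0))"
    have "norm (x - x0) \<le> norm (x - x1) + norm (x1 - x0)" using norm_triangle_ineq[of "x - x1" "x1 - x0"] by simp
    then have "x \<in> cball x0 t" using x by (simp add: dist_norm norm_minus_commute)
    then have "v x \<le> v x1 + q' * (norm (x1 - p))\<^sup>2 - q' * (norm (x - p))\<^sup>2" using x1(2)[of x] by simp
    also have "\<dots> = v x1 + q' * ((x1 - p) \<bullet> (x1 - p) - (x - p) \<bullet> (x - p))"
      by (simp add: power2_norm_eq_inner algebra_simps)
    also have "(x1 - p) \<bullet> (x1 - p) - (x - p) \<bullet> (x - p) = - 2 * ((x1 - p) \<bullet> (x - x1)) - (x - x1) \<bullet> (x - x1)"
      by (simp add: inner_diff_left inner_diff_right inner_commute)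
    also have "v x1 + q' * (- 2 * ((x1 - p) \<bullet> (x - x1)) - (x - x1) \<bullet> (x - x1))
        = v x1 + P \<bullet> (x - x1) + ((x - x1) \<bullet> A (x - x1)) / 2"
    proof -
      have "v x1 + q' * (- 2 * (a \<bullet> k) - k \<bullet> k) = v x1 + (- (2 * q') *\<^sub>R a) \<bullet> k + (k \<bullet> (- (2 * q') *\<^sub>R k)) / 2" for a k :: 'a
        by (simp add: right_diff_distrib)
      then show ?thesis unfolding P_def A_def .
    qed
    finally show "v x \<le> v x1 + P \<bullet> (x - x1) + ((x - x1) \<bullet> A (x - x1)) / 2" .
  qed
  also have "(P \<bullet> A P) / (norm P)\<^sup>2 = - 2 * q'" using P by (simp add: A_def power2_norm_eq_inner)
  finally have "q' \<le> g x1" by simp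
  moreover have "g x1 \<le> g x0 + (q' - g x0) / 2" using x1(1) t by (intro s(3)) auto
  ultimately show False using q'(3) by (simp add: field_simps)
qed

end

text \<open>With nonzero gradient, Taylor's formula replaces the test function by a quadratic one.
  With zero gradient the limit \<open>L\<close> bounds \<open>v\<close> by paraboloids with
  coefficient slightly above \<open>L / 2\<close>, convex or concave according to the sign of
  \<open>L\<close>.\<close>

theorem viscosity_sub_relaxed_limsup:
  fixes U :: "(real^'n) set"
  assumes "relaxed_subsolution U V g v e0 R"
  shows "viscosity_sub U g v"
proof -
  interpret relaxed_subsolution U V g v e0 R by (rule assms)
  show ?thesis unfolding viscosity_sub_def
  proof (intro ballI impI)
    fix x0 \<phi> assume x0: "x0 \<in> U" and \<phi>: "\<phi> \<in> test_functions x0" and "local_min_at (\<lambda>y. \<phi> y - v y) x0"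
    then obtain r where r: "0 < r" "\<And>x. dist x x0 < r \<Longrightarrow> \<phi> x0 - v x0 \<le> \<phi> x - v x"
      unfolding local_min_at_def eventually_nhds_metric by blast
    have C: "C2_near \<phi> x0" using \<phi> by (simp add: test_functions_def)
    show "- 2 * g x0 \<le> inf_lap \<phi> x0"
    proof (cases "grad \<phi> x0 = 0")
      case False
      define p where "p = grad \<phi> x0"
      have p: "p \<noteq> 0" using False by (simp add: p_def)
      have key: "- 2 * g x0 \<le> inf_lap \<phi> x0 + 2 * d" if d: "0 < d" for d
      proof -
        obtain s where s: "0 < s" "\<And>h. norm h < s \<Longrightarrow>
            \<bar>\<phi> (x0 + h) - \<phi> x0 - p \<bullet> h - (h \<bullet> (hess \<phi> x0 *v h)) / 2\<bar> \<le> d * (norm h)\<^sup>2"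
          using second_order_expansion[OF C d] unfolding p_def by blast
        \<comment> \<open>The multiple of the identity absorbs the Taylor remainder; its price
          \<open>2 * d\<close> is arbitrarily small.\<close>
        define A where "A h = hess \<phi> x0 *v h + (2 * d) *\<^sub>R h" for h
        have "- 2 * g x0 \<le> (p \<bullet> A p) / (norm p)\<^sup>2"
        proof (rule touch_quadratic[OF x0 _ p, of A "min r s"])
          show "bounded_linear A" unfolding A_def
            by (intro bounded_linear_add matrix_vector_mul_bounded_linear bounded_linear_scaleR_right)
          show "0 < min r s" using r s by simp
          fix x assume x: "x \<in> ball x0 (min r s)"
          have "\<phi> x - \<phi> x0 - p \<bullet> (x - x0) - ((x - x0) \<bullet> (hess \<phi> x0 *v (x - x0))) / 2 \<le> d * (norm (x - x0))\<^sup>2"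
            using s(2)[of "x - x0"] x by (simp add: dist_norm norm_minus_commute)
          moreover have "((x - x0) \<bullet> A (x - x0)) / 2 = ((x - x0) \<bullet> (hess \<phi> x0 *v (x - x0))) / 2 + d * (norm (x - x0))\<^sup>2"
            by (simp add: A_def inner_add_right power2_norm_eq_inner add_divide_distrib)
          moreover have "\<phi> x0 - v x0 \<le> \<phi> x - v x" using r(2)[of x] x by (simp add: dist_commute)
          ultimately show "v x \<le> v x0 + p \<bullet> (x - x0) + ((x - x0) \<bullet> A (x - x0)) / 2"
            by linarith
        qed
        also have "(p \<bullet> A p) / (norm p)\<^sup>2 = inf_lap \<phi> x0 + 2 * d"
          using p by (simp add: A_def p_def inf_lap_nonzero[OF False] inner_add_right power2_norm_eq_inner add_divide_distrib)
        finally show ?thesis .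
      qed
      have "- 2 * g x0 \<le> inf_lap \<phi> x0 + d" if "0 < d" for d using key[of "d / 2"] that by simp
      then show ?thesis by (rule field_le_epsilon)
    next
      case True
      then obtain L where L: "((\<lambda>x'. 2 * (\<phi> x' - \<phi> x0) / (dist x' x0)\<^sup>2) \<longlongrightarrow> L) (at x0)"
        using \<phi> by (auto simp: test_functions_def inf_lap_defined_def)
      have touch: "\<exists>s>0. \<forall>x\<in>ball x0 s. v x \<le> v x0 + c * (norm (x - x0))\<^sup>2" if c: "L / 2 < c" for c
      proof -
        have "\<forall>\<^sub>F x in at x0. 2 * (\<phi> x - \<phi> x0) / (dist x x0)\<^sup>2 < 2 * c"
          using c by (intro order_tendstoD(2)[OF L]) simp
        then obtain s where s: "0 < s" "\<And>x. x \<noteq> x0 \<Longrightarrow> dist x x0 < s \<Longrightarrow> 2 * (\<phi> x - \<phi> x0) / (dist x x0)\<^sup>2 < 2 * c"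
          unfolding eventually_at by blast
        have "v x \<le> v x0 + c * (norm (x - x0))\<^sup>2" if x: "x \<in> ball x0 (min r s)" for x
        proof (cases "x = x0")
          case False
          then have "\<phi> x - \<phi> x0 < c * (norm (x - x0))\<^sup>2"
            using s(2)[of x] x by (simp add: dist_commute dist_norm norm_minus_commute pos_divide_less_eq)
          moreover have "\<phi> x0 - v x0 \<le> \<phi> x - v x" using r(2)[of x] x by (simp add: dist_commute)
          ultimately show ?thesis by simp
        qed simp
        then show ?thesis using r s by (intro exI[of _ "min r s"]) auto
      qed
      have "- 2 * g x0 \<le> L"
      proof (rule ccontr)
        assume n: "\<not> - 2 * g x0 \<le> L"
        show False
        proof (cases "0 \<le> L")
          case True
          define c where "c = (L / 2 - g x0) / 2"
          have c: "L / 2 < c" "c < - g x0" using n by (auto simp: c_def field_simps)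
          then obtain s where "0 < s" "\<forall>x\<in>ball x0 s. v x \<le> v x0 + c * (norm (x - x0))\<^sup>2" using touch by blast
          then have "- g x0 \<le> c" using c True by (intro touch_square[OF x0, of c s]) auto
          then show False using c by simp
        next
          case False
          define q where "q = (max 0 (g x0) - L / 2) / 2"
          have q: "L / 2 < - q" "0 < q" "g x0 < q" using n False by (auto simp: q_def max_def field_simps)
          then obtain s where "0 < s" "\<forall>x\<in>ball x0 s. v x \<le> v x0 + - q * (norm (x - x0))\<^sup>2" using touch by blast
          then have "q \<le> g x0" using q by (intro touch_concave[OF x0, of q s]) auto
          then show False using q by simp
        qed
      qed
      then show ?thesis using inf_lap_zero[OF True L] by simp
    qed
  qed
qed

section \<open>Comparison of viscosity solutions with the game\<close>

lemma viscosity_sub_interior_max: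
  fixes U :: "(real^'n) set"
  assumes U: "viscosity_sub U g v" and \<phi>: "\<phi> \<in> test_functions w0" and r: "w0 \<in> U" "0 < r"
    and max: "\<And>w. w \<in> ball w0 r \<Longrightarrow> v w - \<phi> w \<le> v w0 - \<phi> w0"
  shows "- 2 * g w0 \<le> inf_lap \<phi> w0"
proof -
  have "\<forall>\<^sub>F y in nhds w0. \<phi> w0 - v w0 \<le> \<phi> y - v y"
    unfolding eventually_nhds_metric
    using r(2) max by (intro exI[of _ r]) (force simp: dist_commute)
  then show ?thesis using U \<phi> r(1) by (simp add: viscosity_sub_def local_min_at_def)
qed

text \<open>At an interior maximum of \<open>v - \<phi>\<close> off the centre,
  \<open>\<phi>\<close> would be a test function with infinity Laplacian \<open>- 2 * q\<close>,
  which is less than \<open>- 2 * g\<close>. At the centre and on the sphere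
  \<open>v \<le> \<phi>\<close> holds anyway; the condition on \<open>b\<close> keeps the gradient
  from vanishing in between.\<close>

lemma radial_comparison:
  fixes U :: "(real^'n) set" and b q r1 :: real
  assumes v: "viscosity_sub U g v" "usc_on U v" and r1: "0 < r1" "cball x r1 \<subseteq> U"
    and g: "\<And>w. w \<in> cball x r1 \<Longrightarrow> g w < q"
    and b: "\<And>r. 0 < r \<Longrightarrow> r < r1 \<Longrightarrow> b - 2 * q * r \<noteq> 0"
    and bd: "\<And>w. norm (w - x) = r1 \<Longrightarrow> v w \<le> v x + b * r1 - q * r1\<^sup>2"
    and w: "w \<in> cball x r1"
  shows "v w \<le> v x + b * norm (w - x) - q * (norm (w - x))\<^sup>2"
proof -
  define \<phi> where "\<phi> = (\<lambda>w. v x + b * norm (w - x) + (- q) * (norm (w - x))\<^sup>2)"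
  have "usc_on (cball x r1) (\<lambda>w. v w + - \<phi> w)"
    unfolding \<phi>_def by (intro usc_on_add_continuous usc_on_subset[OF v(2) r1(2)] continuous_intros)
  then have "\<exists>w0\<in>cball x r1. \<forall>w\<in>cball x r1. v w + - \<phi> w \<le> v w0 + - \<phi> w0"
    using r1(1) by (intro usc_attains_sup_cball) simp_all
  then obtain w0 where w0: "w0 \<in> cball x r1" "\<And>w. w \<in> cball x r1 \<Longrightarrow> v w + - \<phi> w \<le> v w0 + - \<phi> w0"
    by blast
  have "v w0 - \<phi> w0 \<le> 0"
  proof (rule ccontr)
    assume n: "\<not> v w0 - \<phi> w0 \<le> 0"
    have "w0 \<noteq> x" using n by (auto simp: \<phi>_def)
    moreover have "norm (w0 - x) \<noteq> r1" using n bd[of w0] by (auto simp: \<phi>_def)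
    ultimately have r: "0 < norm (w0 - x)" "norm (w0 - x) < r1" using w0(1) by (auto simp: dist_norm norm_minus_commute)
    have "b / norm (w0 - x) + 2 * - q \<noteq> 0" using b[OF r] r(1) by (simp add: field_simps)
    then have \<phi>: "\<phi> \<in> test_functions w0" "inf_lap \<phi> w0 = 2 * - q"
      using inf_lap_radial[OF \<open>w0 \<noteq> x\<close>] unfolding \<phi>_def by blast+
    have "- 2 * g w0 \<le> inf_lap \<phi> w0"
    proof (rule viscosity_sub_interior_max[OF v(1) \<phi>(1), of "r1 - norm (w0 - x)"])
      fix w assume w: "w \<in> ball w0 (r1 - norm (w0 - x))"
      have "norm (w - x) \<le> norm (w - w0) + norm (w0 - x)" using norm_triangle_ineq[of "w - w0" "w0 - x"] by simp
      then have "w \<in> cball x r1" using w by (simp add: dist_norm norm_minus_commute)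
      then show "v w - \<phi> w \<le> v w0 - \<phi> w0" using w0(2)[of w] by simp
    qed (use w0(1) r1 r in auto)
    then show False using \<phi>(2) g[OF w0(1)] by simp
  qed
  then show ?thesis using w0(2)[OF w] by (simp add: \<phi>_def)
qed

text \<open>The paraboloid \<open>v x + p * r\<^sup>2\<close> has infinity Laplacian
  \<open>2 * p < - 2 * g\<close> at all points, its vertex included, so its difference to
  \<open>v\<close> has no interior maximum. The lemma supplies the nonnegative slope
  \<open>b\<close> needed for negative \<open>q\<close> below.\<close>

lemma viscosity_sub_growth:
  fixes U :: "(real^'n) set" and p R :: real
  assumes v: "viscosity_sub U g v" "usc_on U v" and R: "0 < R" "cball x R \<subseteq> U" and p: "0 < p"
    and g: "\<And>w. w \<in> cball x R \<Longrightarrow> g w < - p" and S: "\<And>w. w \<in> cball x R \<Longrightarrow> v w \<le> S"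
  shows "v x + p * R\<^sup>2 \<le> S"
proof (rule ccontr)
  assume n: "\<not> v x + p * R\<^sup>2 \<le> S"
  define \<phi> where "\<phi> = (\<lambda>w. v x + p * (norm (w - x))\<^sup>2)"
  have "usc_on (cball x R) (\<lambda>w. v w + - \<phi> w)"
    unfolding \<phi>_def by (intro usc_on_add_continuous usc_on_subset[OF v(2) R(2)] continuous_intros)
  then have "\<exists>w0\<in>cball x R. \<forall>w\<in>cball x R. v w + - \<phi> w \<le> v w0 + - \<phi> w0"
    using R(1) by (intro usc_attains_sup_cball) simp_all
  then obtain w0 where w0: "w0 \<in> cball x R" "\<And>w. w \<in> cball x R \<Longrightarrow> v w + - \<phi> w \<le> v w0 + - \<phi> w0"
    by blast
  have "v x + - \<phi> x \<le> v w0 + - \<phi> w0" using w0(2)[of x] R(1) by simp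
  then have "\<phi> w0 \<le> S" using S[OF w0(1)] by (simp add: \<phi>_def)
  then have "norm (w0 - x) \<noteq> R" using n by (auto simp: \<phi>_def)
  then have r: "norm (w0 - x) < R" using w0(1) by (simp add: dist_norm norm_minus_commute)
  have \<phi>: "\<phi> \<in> test_functions w0 \<and> inf_lap \<phi> w0 = 2 * p"
  proof (cases "w0 = x")
    case True
    then show ?thesis using inf_lap_square[of "v x" p x] by (simp add: \<phi>_def)
  next
    case False
    then show ?thesis using inf_lap_radial[OF False, of 0 p "v x"] p by (simp add: \<phi>_def)
  qed
  have "- 2 * g w0 \<le> inf_lap \<phi> w0"
  proof (rule viscosity_sub_interior_max[OF v(1), of \<phi> _ "R - norm (w0 - x)"])
    fix w assume w: "w \<in> ball w0 (R - norm (w0 - x))"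
    have "norm (w - x) \<le> norm (w - w0) + norm (w0 - x)" using norm_triangle_ineq[of "w - w0" "w0 - x"] by simp
    then have "w \<in> cball x R" using w by (simp add: dist_norm norm_minus_commute)
    then show "v w - \<phi> w \<le> v w0 - \<phi> w0" using w0(2)[of w] by simp
  qed (use w0(1) R r \<phi> in auto)
  then show False using \<phi> g[OF w0(1)] by simp
qed

text \<open>Comparison with \<open>v x + b r - q r\<^sup>2\<close>, where \<open>b\<close> is chosen so that the bound \<open>S\<close> is attained at \<open>r = 2 e\<close>, or,
  if this parabola is not monotone there, at its vertex.\<close>

lemma viscosity_sub_mean_value_closed:
  fixes U :: "(real^'n) set" and q e :: real
  assumes v: "viscosity_sub U g v" "usc_on U v" and e: "0 < e" "cball x (2 * e) \<subseteq> U" and q: "q \<noteq> 0"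
    and g: "\<And>w. w \<in> cball x (2 * e) \<Longrightarrow> g w < q" and S: "\<And>w. w \<in> cball x (2 * e) \<Longrightarrow> v w \<le> S"
    and w: "w \<in> cball x e"
  shows "v w \<le> (S + v x) / 2 + e\<^sup>2 * q"
proof -
  define T where "T = S - v x"
  have T: "0 \<le> T" using S[of x] e by (simp add: T_def)
  define r where "r = norm (w - x)"
  have r: "0 \<le> r" "r \<le> e" using w by (auto simp: r_def dist_norm norm_minus_commute)
  have wc: "w \<in> cball x (2 * e)" using w e by auto
  have "v w - v x \<le> T / 2 + e\<^sup>2 * q"
  proof (cases "4 * q * e\<^sup>2 \<le> T")
    case True
    define b where "b = T / (2 * e) + 2 * q * e"
    have be: "b * e = T / 2 + 2 * (q * e\<^sup>2)" using e by (simp add: b_def power2_eq_square field_simps)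
    \<comment> \<open>The parabola increases strictly on \<open>(0, 2 * e)\<close>. For
      \<open>q > 0\<close> this comes from the case assumption, for \<open>q < 0\<close> from
      \<open>T \<ge> - 4 * q * e\<^sup>2\<close>, which is the growth lemma and gives
      \<open>b \<ge> 0\<close>.\<close>
    have bpos: "b - 2 * q * s \<noteq> 0 \<and> q * (2 * s) \<le> b" if "0 < s" "s < 2 * e" for s
    proof (cases "0 < q")
      case True
      have "T / (2 * e) \<ge> 4 * q * e\<^sup>2 / (2 * e)" using \<open>4 * q * e\<^sup>2 \<le> T\<close> e by (intro divide_right_mono) auto
      then have "4 * q * e \<le> b" using e by (simp add: b_def power2_eq_square)
      moreover have "q * (2 * s) < q * (2 * (2 * e))" using True that by (intro mult_strict_left_mono) auto
      moreover have "q * (2 * (2 * e)) = 4 * q * e" "2 * q * s = q * (2 * s)" by simp_all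
      ultimately show ?thesis by linarith
    next
      case False
      then have q0: "0 < - q" using q by simp
      have "v x + (- q) * (2 * e)\<^sup>2 \<le> S"
        by (rule viscosity_sub_growth[OF v _ e(2) q0 _ S]) (use e g in auto)
      then have "(- q) * (2 * e)\<^sup>2 / (2 * e) \<le> T / (2 * e)" using e by (intro divide_right_mono) (auto simp: T_def)
      moreover have "(- q) * (2 * e)\<^sup>2 / (2 * e) = - (2 * q * e)" using e by (simp add: power2_eq_square)
      ultimately have "0 \<le> b" unfolding b_def by linarith
      moreover have "0 < (- q) * (2 * s)" using q0 that by (intro mult_pos_pos) auto
      moreover have "(- q) * (2 * s) = - (q * (2 * s))" "2 * q * s = q * (2 * s)" by simp_all
      ultimately show ?thesis by linarith
    qed
    have "v w \<le> v x + b * norm (w - x) - q * (norm (w - x))\<^sup>2"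
    proof (rule radial_comparison[OF v _ e(2) g _ _ wc])
      show "b - 2 * q * s \<noteq> 0" if "0 < s" "s < 2 * e" for s using bpos[OF that] by blast
      show "v y \<le> v x + b * (2 * e) - q * (2 * e)\<^sup>2" if "norm (y - x) = 2 * e" for y
      proof -
        have "v y \<le> S" using that by (intro S) (simp add: dist_norm norm_minus_commute)
        moreover have "b * (2 * e) = 2 * (b * e)" "q * (2 * e)\<^sup>2 = 4 * (q * e\<^sup>2)" "S = v x + T"
          by (simp_all add: power2_eq_square T_def)
        ultimately show ?thesis using be by linarith
      qed
    qed (use e in auto)
    then have 1: "v w - v x \<le> b * r - q * r\<^sup>2" by (simp add: r_def)
    have "0 \<le> (b - q * (e + r)) * (e - r)"
    proof (cases "r = e")
      case False
      then have "q * (2 * ((e + r) / 2)) \<le> b" using bpos[of "(e + r) / 2"] r e by auto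
      moreover have "2 * ((e + r) / 2) = e + r" by simp
      ultimately have "q * (e + r) \<le> b" by (simp only:)
      then show ?thesis using r by (intro mult_nonneg_nonneg) auto
    qed simp
    then have "b * r - q * r\<^sup>2 \<le> b * e - q * e\<^sup>2" by (simp add: power2_eq_square algebra_simps)
    also have "\<dots> = T / 2 + e\<^sup>2 * q" unfolding be by simp
    finally show ?thesis using 1 by simp
  next
    case False
    have q0: "0 < q"
    proof (rule ccontr)
      assume "\<not> 0 < q"
      then have "q * (4 * e\<^sup>2) \<le> 0" by (intro mult_nonpos_nonneg) auto
      moreover have "4 * q * e\<^sup>2 = q * (4 * e\<^sup>2)" by simp
      ultimately show False using False T by linarith
    qed
    \<comment> \<open>The parabola \<open>2 * q * r0 * r - q * r\<^sup>2\<close> has its vertex at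
      \<open>r0\<close>, with value \<open>T\<close>, so that it reaches the bound \<open>S\<close>
      on the sphere of radius \<open>r0 < 2 * e\<close>.\<close>
    define r0 where "r0 = sqrt (T / q)"
    have r0: "0 \<le> r0" "q * r0\<^sup>2 = T" using T q0 by (auto simp: r0_def)
    have "q * r0\<^sup>2 < q * (2 * e)\<^sup>2" using False r0 by (simp add: power2_eq_square)
    then have "r0\<^sup>2 < (2 * e)\<^sup>2" using q0 by simp
    then have r0e: "r0 < 2 * e" using e by (intro power_less_imp_less_base[of r0 2 "2 * e"]) auto
    show ?thesis
    proof (cases "r \<le> r0 \<and> 0 < r0")
      case True
      have sub: "cball x r0 \<subseteq> cball x (2 * e)" using r0e by auto
      have "v w \<le> v x + (2 * q * r0) * norm (w - x) - q * (norm (w - x))\<^sup>2"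
      proof (rule radial_comparison[OF v, of r0])
        show "cball x r0 \<subseteq> U" using sub e by blast
        show "g y < q" if "y \<in> cball x r0" for y using g that sub by blast
        show "2 * q * r0 - 2 * q * s \<noteq> 0" if "0 < s" "s < r0" for s using that q0 by simp
        show "v y \<le> v x + 2 * q * r0 * r0 - q * r0\<^sup>2" if "norm (y - x) = r0" for y
        proof -
          have "v y \<le> S" using that r0e by (intro S) (simp add: dist_norm norm_minus_commute)
          then show ?thesis using r0 by (simp add: T_def power2_eq_square)
        qed
        show "w \<in> cball x r0" using True by (simp add: r_def dist_norm norm_minus_commute)
      qed (use True in auto)
      then have 1: "v w - v x \<le> q * (2 * r0 * r - r\<^sup>2)" by (simp add: r_def algebra_simps)
      have "r\<^sup>2 \<le> e\<^sup>2" using r by (intro power_mono) auto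
      \<comment> \<open>Equivalent to
        \<open>2 * r0 * r - r\<^sup>2 \<le> r0\<^sup>2 / 2 + r\<^sup>2\<close>; with
        \<open>r \<le> e\<close> this is the claim divided by \<open>q\<close>.\<close>
      moreover have "0 \<le> (r0 - 2 * r)\<^sup>2" by simp
      ultimately have "2 * r0 * r - r\<^sup>2 \<le> r0\<^sup>2 / 2 + e\<^sup>2" by (simp add: power2_eq_square algebra_simps)
      then have "q * (2 * r0 * r - r\<^sup>2) \<le> q * (r0\<^sup>2 / 2 + e\<^sup>2)" using q0 by (intro mult_left_mono) auto
      also have "\<dots> = T / 2 + e\<^sup>2 * q" using r0(2) by (simp add: distrib_left mult.commute)
      finally show ?thesis using 1 by simp
    next
      case False
      \<comment> \<open>Then \<open>T \<le> q * e\<^sup>2\<close>, and the trivial bound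
        \<open>v w - v x \<le> T\<close> is good enough.\<close>
      have "r0 \<le> e" using False r r0(1) e by auto
      then have "q * r0\<^sup>2 \<le> q * e\<^sup>2" using q0 r0 by (intro mult_left_mono power_mono) auto
      then have "T \<le> q * e\<^sup>2" using r0(2) by simp
      moreover have "v w - v x \<le> T" using S[OF wc] by (simp add: T_def)
      ultimately show ?thesis using T by (simp add: mult.commute)
    qed
  qed
  then show ?thesis by (simp add: T_def field_simps)
qed

text \<open>Moves range over open balls; the inequality for closed balls of radius
  \<open>s < e\<close> passes to the limit as \<open>s\<close> increases to
  \<open>e\<close>.\<close>

lemma viscosity_sub_mean_value:
  fixes U :: "(real^'n) set" and q e :: real
  assumes v: "viscosity_sub U g v" "usc_on U v" and e: "0 < e" "ball x (2 * e) \<subseteq> U" and q: "q \<noteq> 0"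
    and g: "\<And>w. w \<in> ball x (2 * e) \<Longrightarrow> g w < q" and S: "\<And>w. w \<in> ball x (2 * e) \<Longrightarrow> v w \<le> S"
    and w: "w \<in> ball x e"
  shows "v w \<le> (S + v x) / 2 + e\<^sup>2 * q"
proof -
  have le: "v w \<le> (S + v x) / 2 + s\<^sup>2 * q" if s: "dist x w < s" "s < e" for s
  proof -
    have "0 < s" using s(1) zero_le_dist[of x w] by linarith
    moreover have "cball x (2 * s) \<subseteq> ball x (2 * e)" using s by auto
    ultimately show ?thesis
      using e g S s by (intro viscosity_sub_mean_value_closed[OF v _ _ q]) auto
  qed
  have "((\<lambda>s. (S + v x) / 2 + s\<^sup>2 * q) \<longlongrightarrow> (S + v x) / 2 + e\<^sup>2 * q) (at_left e)"
    by (intro tendsto_intros)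
  moreover have "\<forall>\<^sub>F s in at_left e. v w \<le> (S + v x) / 2 + s\<^sup>2 * q"
    using eventually_at_left_real[of "dist x w" e] w by (auto elim!: eventually_mono intro: le)
  ultimately show ?thesis by (rule tendsto_lowerbound) simp
qed

lemma viscosity_sub_le_dpp:
  fixes U :: "(real^'n) set" and F g v :: "real^'n \<Rightarrow> real" and W :: "real \<Rightarrow> real^'n \<Rightarrow> real"
  assumes dom: "bounded_domain U" and v: "viscosity_sub U g v" "usc_on U v"
    and vR: "\<And>x. x \<in> closure U \<Longrightarrow> \<bar>v x\<bar> \<le> R"
    and g: "uniformly_continuous_on U g"
      "(\<forall>x\<in>U. g x = 0) \<or> (\<exists>c>0. (\<forall>x\<in>U. c \<le> g x) \<or> (\<forall>x\<in>U. g x \<le> - c))"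
    and vF: "\<And>\<eta>. 0 < \<eta> \<Longrightarrow> \<exists>\<rho>>0. \<forall>z\<in>frontier U. \<forall>x\<in>closure U. dist x z < \<rho> \<longrightarrow> v x \<le> F z + \<eta>"
    and e0: "0 < e0" and WR: "\<And>e x. 0 < e \<Longrightarrow> e < e0 \<Longrightarrow> x \<in> closure U \<Longrightarrow> \<bar>W e x\<bar> \<le> R"
    and W: "\<And>e x. 0 < e \<Longrightarrow> e < e0 \<Longrightarrow> x \<in> U \<Longrightarrow> midrange (closure U) e (W e) x + e\<^sup>2 * g x \<le> W e x"
    and WF: "\<And>\<eta>. 0 < \<eta> \<Longrightarrow> \<exists>\<rho>>0. \<forall>e. 0 < e \<longrightarrow> e < \<rho> \<longrightarrow>
        (\<forall>z\<in>frontier U. \<forall>x\<in>closure U. dist x z < \<rho> \<longrightarrow> F z - \<eta> \<le> W e x)"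
    and \<eta>: "0 < \<eta>"
  shows "\<exists>e1>0. \<forall>e. 0 < e \<longrightarrow> e < e1 \<longrightarrow> (\<forall>x\<in>closure U. v x \<le> W e x + \<eta>)"
proof -
  interpret bounded_domain U by (rule dom)
  let ?X = "closure U" and ?Y = "frontier U"
  define ve where "ve e x = Sup (v ` nb ?X e x)" for e x
  define Y' where "Y' e = {x. \<not> ball x (2 * e) \<subseteq> U}" for e
  have bv: "bounded (v ` ?X)" by (rule bounded_image_realI) (rule vR)
  have v_ve: "v y \<le> ve e x" if "y \<in> nb ?X e x" for e x y unfolding ve_def by (rule Sup_nb_ge[OF bv that])
  have ve_le: "ve e x \<le> c" if "0 < e" "x \<in> ?X" "\<And>y. y \<in> nb ?X e x \<Longrightarrow> v y \<le> c" for e x c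
    unfolding ve_def by (rule Sup_nb_le[OF that])
  have veR: "\<bar>ve e x\<bar> \<le> R" if "0 < e" "x \<in> ?X" for e x
  proof -
    have "ve e x \<le> R" by (rule ve_le[OF that]) (use vR nb_sub[of ?X e x] in \<open>auto simp: abs_le_iff\<close>)
    moreover have "- R \<le> ve e x" using v_ve[OF nb_self[OF that]] vR[OF that(2)] by (simp add: abs_le_iff)
    ultimately show ?thesis by (simp add: abs_le_iff)
  qed
  have bve: "bounded (ve e ` ?X)" if "0 < e" for e by (rule bounded_image_realI) (rule veR[OF that])
  have Y_Y': "?Y \<subseteq> Y' e" if "0 < e" for e
    using that U_frontier_disjoint by (auto simp: Y'_def intro!: centre_in_ball[THEN iffD2])
      (meson centre_in_ball mult_pos_pos subsetD zero_less_numeral)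
  have inside: "x \<in> U" if "x \<notin> Y' e" "0 < e" for x e
    using that centre_in_ball[of x "2 * e"] by (auto simp: Y'_def)
  obtain \<rho>1 where \<rho>1: "0 < \<rho>1" "\<And>z x. z \<in> ?Y \<Longrightarrow> x \<in> ?X \<Longrightarrow> dist x z < \<rho>1 \<Longrightarrow> v x \<le> F z + \<eta> / 8"
    using vF[of "\<eta> / 8"] \<eta> by auto
  obtain \<rho>2 where \<rho>2: "0 < \<rho>2" "\<And>e z x. 0 < e \<Longrightarrow> e < \<rho>2 \<Longrightarrow> z \<in> ?Y \<Longrightarrow> x \<in> ?X \<Longrightarrow> dist x z < \<rho>2 \<Longrightarrow> F z - \<eta> / 8 \<le> W e x"
    using WF[of "\<eta> / 8"] \<eta> by auto
  \<comment> \<open>A point of the layer is within \<open>2 * e\<close> of the frontier and its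
    neighbours are within \<open>3 * e\<close>, whence the two fractions.\<close>
  define e2 where "e2 = min e0 (min (\<rho>1 / 3) (\<rho>2 / 2))"
  have e2: "0 < e2" "e2 \<le> e0" "3 * e2 \<le> \<rho>1" "2 * e2 \<le> \<rho>2" using e0 \<rho>1 \<rho>2 by (auto simp: e2_def)
  have bdry: "ve e x \<le> W e x + \<eta> / 4" if e: "0 < e" "e < e2" and x: "x \<in> Y' e" "x \<in> ?X" for e x
  proof -
    have "\<exists>z\<in>?Y. dist x z < 2 * e"
    proof (cases "x \<in> U")
      case True
      obtain y where "y \<in> ball x (2 * e)" and y': "y \<notin> U" using x(1) unfolding Y'_def by blast
      then have y: "dist x y < 2 * e" "y \<notin> U" by simp_all
      obtain z where z: "z \<in> closed_segment x y" "z \<in> ?Y" using segment_meets_frontier[OF True y(2)] by blast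
      have "dist x z < 2 * e" using closed_segment_dist[OF z(1)] y(1) zero_le_dist[of z y] by linarith
      then show ?thesis using z by blast
    next
      case False
      then have "x \<in> ?Y" using x(2) closure_minus_frontier by blast
      then show ?thesis using e by (intro bexI[of _ x]) auto
    qed
    then obtain z where z: "z \<in> ?Y" "dist x z < 2 * e" by blast
    have "ve e x \<le> F z + \<eta> / 8"
    proof (rule ve_le[OF e(1) x(2)])
      fix y assume y: "y \<in> nb ?X e x"
      have "dist y z < \<rho>1" using dist_triangle[of y z x] y z e e2 by (simp add: nb_def)
      then show "v y \<le> F z + \<eta> / 8" using \<rho>1(2)[OF z(1)] y by (simp add: nb_def)
    qed
    moreover have "F z - \<eta> / 8 \<le> W e x" using z e e2 x by (intro \<rho>2(2)) auto
    ultimately show ?thesis by simp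
  qed
  have mean: "ve e x \<le> midrange ?X e (ve e) x + e\<^sup>2 * q"
    if e: "0 < e" and x: "x \<in> ?X" "x \<notin> Y' e" and q: "q \<noteq> 0" "\<And>w. w \<in> ball x (2 * e) \<Longrightarrow> g w < q" for e x q
  proof -
    have ball: "ball x (2 * e) \<subseteq> U" using x(2) by (simp add: Y'_def)
    then have ball': "ball x (2 * e) \<subseteq> ?X" using U_sub by blast
    have "ball x e \<subseteq> ball x (2 * e)" using e by auto
    then have nbx: "nb ?X e x = ball x e" using ball' by (intro nb_eq_ball) blast
    define S where "S = Sup (ve e ` nb ?X e x)"
    \<comment> \<open>Each \<open>w\<close> in the large ball is a neighbour of the midpoint of
      \<open>x\<close> and \<open>w\<close>, which is itself a neighbour of \<open>x\<close>. So the
      supremum of \<open>ve\<close> around \<open>x\<close> bounds \<open>v\<close> on the ball of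
      radius \<open>2 * e\<close>.\<close>
    have S: "v w \<le> S" if w: "w \<in> ball x (2 * e)" for w
    proof -
      define y where "y = midpoint x w"
      have "y \<in> ball x e" using w by (simp add: y_def dist_midpoint)
      moreover have "w \<in> nb ?X e y" using w ball' by (auto simp: nb_def y_def dist_midpoint dist_commute)
      ultimately show ?thesis
        using v_ve[of w e y] Sup_nb_ge[OF bve[OF e], of y e x] nbx unfolding S_def by force
    qed
    have I: "v x \<le> Inf (ve e ` nb ?X e x)"
      by (rule Inf_nb_ge[OF e x(1)]) (rule v_ve[OF nb_sym[OF _ x(1)]])
    have "ve e x \<le> (S + v x) / 2 + e\<^sup>2 * q"
    proof (rule ve_le[OF e x(1)])
      fix y assume "y \<in> nb ?X e x"
      then show "v y \<le> (S + v x) / 2 + e\<^sup>2 * q"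
        using viscosity_sub_mean_value[OF v e ball q S, of y] nbx by simp
    qed
    moreover have "(S + v x) / 2 \<le> midrange ?X e (ve e) x" unfolding midrange_def S_def using I by (intro divide_right_mono) auto
    ultimately show ?thesis by linarith
  qed
  have "\<exists>e1>0. \<forall>e. 0 < e \<longrightarrow> e < e1 \<longrightarrow> (\<forall>x\<in>?X. ve e x \<le> W e x + \<eta>)"
    using g(2)
  proof
    assume g0: "\<forall>x\<in>U. g x = 0"
    have "ve e x \<le> W e x + \<eta>" if e: "0 < e" "e < e2" and x: "x \<in> ?X" for e x
    proof -
      obtain N K where "tug_of_war ?X ?Y e N K" using tug_instance[OF e(1)] by blast
      then interpret tug_of_war ?X ?Y e N K .
      have ee: "0 < e" "e < e0" using e e2 by auto
      have R0: "0 \<le> R" using vR[OF x] by linarith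
      have \<eta>4: "0 < \<eta> / 4" using \<eta> by simp
      obtain d where d: "0 < d" and comp: "\<And>s Y' x. \<And>u v :: real^'n \<Rightarrow> real.
         \<lbrakk>\<And>x. x \<in> ?X \<Longrightarrow> \<bar>u x\<bar> \<le> R; bounded (v ` ?X); ?Y \<subseteq> Y';
          \<And>x. x \<in> ?X - Y' \<Longrightarrow> u x \<le> midrange ?X e u x + s; \<And>x. x \<in> ?X - Y' \<Longrightarrow> midrange ?X e v x \<le> v x;
          \<And>x. x \<in> Y' \<inter> ?X \<Longrightarrow> u x \<le> v x; s \<le> d; x \<in> ?X\<rbrakk> \<Longrightarrow> u x \<le> v x + \<eta> / 4"
        using weak_comparison[OF \<eta>4 R0] by blast
      have bW: "bounded (W e ` ?X)" by (rule bounded_image_realI) (rule WR[OF ee])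
      have "ve e x \<le> (W e x + \<eta> / 4) + \<eta> / 4"
      proof (rule comp[of "ve e" "\<lambda>x. W e x + \<eta> / 4" "Y' e" 0])
        show "\<bar>ve e y\<bar> \<le> R" if "y \<in> ?X" for y by (rule veR[OF e(1) that])
        show "bounded ((\<lambda>x. W e x + \<eta> / 4) ` ?X)" by (rule bounded_add_const_image[OF bW])
        show "?Y \<subseteq> Y' e" by (rule Y_Y'[OF e(1)])
        show "ve e y \<le> midrange ?X e (ve e) y + 0" if y: "y \<in> ?X - Y' e" for y
        \<comment> \<open>For \<open>g = 0\<close> every \<open>q > 0\<close> is allowed at the same
          \<open>e\<close>, so the error can be sent to 0. What remains is not strict and calls for
          \<open>weak_comparison\<close>.\<close>
        proof (rule field_le_epsilon)
          fix s :: real assume s: "0 < s"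
          have "ve e y \<le> midrange ?X e (ve e) y + e\<^sup>2 * (s / e\<^sup>2)"
            using y s e g0 by (intro mean) (auto simp: Y'_def)
          then show "ve e y \<le> midrange ?X e (ve e) y + 0 + s" using e by simp
        qed
        show "midrange ?X e (\<lambda>x. W e x + \<eta> / 4) y \<le> W e y + \<eta> / 4" if y: "y \<in> ?X - Y' e" for y
        proof -
          have yU: "y \<in> U" using inside[of y e] y e by auto
          show ?thesis using W[OF ee yU] g0 yU midrange_add_const[OF e(1) _ bW, of y] y by simp
        qed
        show "ve e y \<le> W e y + \<eta> / 4" if "y \<in> Y' e \<inter> ?X" for y using bdry[OF e] that by auto
      qed (use d x in auto)
      then show ?thesis using \<eta> by simp
    qed
    then show ?thesis using e2(1) by blast
  next
    assume "\<exists>c>0. (\<forall>x\<in>U. c \<le> g x) \<or> (\<forall>x\<in>U. g x \<le> - c)"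
    then obtain c \<sigma> :: real where c: "0 < c" and \<sigma>: "\<bar>\<sigma>\<bar> = 1" "\<And>x. x \<in> U \<Longrightarrow> c \<le> \<sigma> * g x"
    proof (elim exE conjE disjE)
      fix c :: real assume "0 < c" "\<forall>x\<in>U. c \<le> g x" then show thesis using that[of c 1] by auto
    next
      fix c :: real assume "0 < c" "\<forall>x\<in>U. g x \<le> - c" then show thesis using that[of c "- 1"] by force
    qed
    have R0: "0 \<le> R" using vR nonempty_U U_sub by force
    define \<kappa> where "\<kappa> = min (c / 4) (\<eta> * c / (16 * (R + 1)))"
    have \<kappa>: "0 < \<kappa>" "\<kappa> \<le> c / 4" "2 * \<kappa> / c * R \<le> \<eta> / 8"
    proof -
      show "0 < \<kappa>" using c \<eta> R0 by (simp add: \<kappa>_def)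
      have "\<kappa> \<le> \<eta> * c / (16 * (R + 1))" by (simp add: \<kappa>_def)
      then have "\<kappa> * (16 * (R + 1)) \<le> \<eta> * c" using R0 by (simp add: pos_le_divide_eq)
      then have "\<kappa> * 16 * R \<le> \<eta> * c" using \<open>0 < \<kappa>\<close> by (simp add: algebra_simps)
      then show "2 * \<kappa> / c * R \<le> \<eta> / 8" using c by (simp add: field_simps)
      show "\<kappa> \<le> c / 4" unfolding \<kappa>_def by (rule min.cobounded1)
    qed
    \<comment> \<open>\<open>\<sigma>\<close> is the sign of \<open>g\<close>, so
      \<open>\<sigma> * g \<ge> c\<close> gives \<open>l * g \<ge> g + 2 * \<kappa>\<close>. One
      \<open>\<kappa>\<close> pays for the error in \<open>mean\<close>, the other makes the
      comparison strict.\<close>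
    define l where "l = 1 + \<sigma> * (2 * \<kappa> / c)"
    have l2: "\<bar>\<sigma> * (2 * \<kappa> / c)\<bar> = 2 * \<kappa> / c" using \<sigma>(1) \<kappa> c by (simp add: abs_mult)
    have "2 * \<kappa> / c \<le> 1 / 2" using \<kappa> c by (simp add: field_simps)
    then have l: "0 < l" using l2 unfolding l_def by linarith
    obtain d where d: "0 < d" "\<And>x y. x \<in> U \<Longrightarrow> y \<in> U \<Longrightarrow> dist y x < d \<Longrightarrow> dist (g y) (g x) < \<kappa>"
      using g(1) \<kappa>(1) unfolding uniformly_continuous_on_def by metis
    define e1 where "e1 = min e2 (d / 2)"
    have "ve e x \<le> W e x + \<eta>" if e': "0 < e" "e < e1" and x: "x \<in> ?X" for e x
    proof -
      have e: "0 < e" "e < e2" "2 * e \<le> d" using e' by (auto simp: e1_def)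
      have ee: "0 < e" "e < e0" using e e2 by auto
      have bW: "bounded (W e ` ?X)" by (rule bounded_image_realI) (rule WR[OF ee])
      have lW: "\<bar>l * W e y - W e y\<bar> \<le> \<eta> / 8" if "y \<in> ?X" for y
      proof -
        have "l * W e y - W e y = (\<sigma> * (2 * \<kappa> / c)) * W e y" by (simp add: l_def algebra_simps)
        then have "\<bar>l * W e y - W e y\<bar> = \<bar>\<sigma> * (2 * \<kappa> / c)\<bar> * \<bar>W e y\<bar>" by (simp only: abs_mult)
        then have "\<bar>l * W e y - W e y\<bar> = 2 * \<kappa> / c * \<bar>W e y\<bar>" unfolding l2 .
        also have "\<dots> \<le> 2 * \<kappa> / c * R" using WR[OF ee that] \<kappa> c by (intro mult_left_mono) auto
        finally show ?thesis using \<kappa>(3) by simp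
      qed
      \<comment> \<open>The offset is \<open>\<eta> / 4\<close> for the boundary layer plus
        \<open>\<eta> / 8\<close> for the scaling.\<close>
      define w where "w y = l * W e y + 3 * \<eta> / 8" for y
      have "ve e x \<le> w x"
      proof (rule strict_comparison[OF e(1) bve[OF e(1)], where Y = "Y' e" and k = "e\<^sup>2 * \<kappa>" and
            ?g1.0 = "\<lambda>x. e\<^sup>2 * (g x + \<kappa>)" and ?g2.0 = "\<lambda>x. e\<^sup>2 * (l * g x)"])
        show "bounded (w ` ?X)" unfolding w_def by (intro bounded_add_const_image bounded_cmult_image bW)
        fix y assume y: "y \<in> ?X - Y' e"
        then have yU: "y \<in> U" "y \<in> ?X" using inside[of y e] e by auto
        have sg: "c \<le> \<sigma> * g y" by (rule \<sigma>(2)[OF yU(1)])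
        show "ve e y \<le> midrange ?X e (ve e) y + e\<^sup>2 * (g y + \<kappa>)"
        proof (rule mean[OF e(1)])
          have "\<bar>g y\<bar> = \<bar>\<sigma> * g y\<bar>" using \<sigma>(1) by (simp add: abs_mult)
          then show "g y + \<kappa> \<noteq> 0" using sg \<kappa>(1,2) c by linarith
          fix t assume t: "t \<in> ball y (2 * e)"
          then have "t \<in> U" "dist t y < d" using y e by (auto simp: Y'_def dist_commute)
          then have "dist (g t) (g y) < \<kappa>" using d(2) yU by blast
          then show "g t < g y + \<kappa>" unfolding dist_real_def by linarith
        qed (use y in auto)
        have "midrange ?X e w y = l * midrange ?X e (W e) y + 3 * \<eta> / 8"
          unfolding w_def using midrange_add_const[OF e(1) yU(2) bounded_cmult_image[OF bW]] midrange_cmult[OF e(1) yU(2) bW l] by simp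
        moreover have "l * (midrange ?X e (W e) y + e\<^sup>2 * g y) \<le> l * W e y" using W[OF ee yU(1)] l by (intro mult_left_mono) auto
        ultimately show "midrange ?X e w y + e\<^sup>2 * (l * g y) \<le> w y" by (simp add: w_def algebra_simps)
        have "(2 * \<kappa> / c) * c \<le> (2 * \<kappa> / c) * (\<sigma> * g y)" using sg \<kappa> c by (intro mult_left_mono) auto
        then have "g y + 2 * \<kappa> \<le> l * g y" using c by (simp add: l_def algebra_simps)
        then have "e\<^sup>2 * (g y + 2 * \<kappa>) \<le> e\<^sup>2 * (l * g y)" by (intro mult_left_mono) auto
        then show "e\<^sup>2 * (g y + \<kappa>) + e\<^sup>2 * \<kappa> \<le> e\<^sup>2 * (l * g y)" by (simp add: algebra_simps)
      next
        fix y assume y: "y \<in> Y' e \<inter> ?X"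
        then have "ve e y \<le> W e y + \<eta> / 4" using bdry[OF e(1,2)] by auto
        moreover have "\<bar>l * W e y - W e y\<bar> \<le> \<eta> / 8" using lW y by blast
        ultimately show "ve e y \<le> w y" unfolding w_def by linarith
      qed (use e \<kappa> x in auto)
      then show ?thesis using lW[OF x] \<eta> unfolding w_def by linarith
    qed
    moreover have "0 < e1" using e2 d by (simp add: e1_def)
    ultimately show ?thesis by blast
  qed
  then obtain e1 where e1: "0 < e1" "\<And>e x. 0 < e \<Longrightarrow> e < e1 \<Longrightarrow> x \<in> ?X \<Longrightarrow> ve e x \<le> W e x + \<eta>" by blast
  have "v x \<le> W e x + \<eta>" if "0 < e" "e < e1" "x \<in> ?X" for e x
    using e1(2)[OF that] v_ve[OF nb_self[OF that(1,3)]] by simp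
  then show ?thesis using e1(1) by blast
qed

section \<open>Families of discrete solutions and their limits\<close>

lemma relaxed_limsup_cong:
  "relaxed_limsup X V v \<Longrightarrow> (\<And>x. x \<in> X \<Longrightarrow> v x = w x) \<Longrightarrow> relaxed_limsup X V w"
  unfolding relaxed_limsup_def by simp

lemma relaxed_limsup_le:
  assumes lim: "relaxed_limsup X V v" and x: "x \<in> X" and \<rho>: "0 < \<rho>"
    and le: "\<And>y e. y \<in> X \<Longrightarrow> dist y x < \<rho> \<Longrightarrow> 0 < e \<Longrightarrow> e < \<rho> \<Longrightarrow> V e y \<le> c"
  shows "v x \<le> c"
proof (rule ccontr)
  assume "\<not> v x \<le> c"
  then have "c < v x" by simp
  then obtain y e where "y \<in> X" "dist y x < \<rho>" "0 < e" "e < \<rho>" "c < V e y"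
    using relaxed_limsup_greater[OF lim x _ \<rho>] by blast
  then show False using le by fastforce
qed

text \<open>\<open>- w\<close> is the relaxed lower limit; it cannot exceed the upper one, since at
  \<open>x\<close> itself both bounds apply to the same \<open>V e x\<close> for small
  \<open>e\<close>.\<close>

lemma relaxed_limsup_uminus:
  assumes v: "relaxed_limsup X V v" and w: "relaxed_limsup X (\<lambda>e y. - V e y) w" and x: "x \<in> X"
  shows "- w x \<le> v x"
proof (rule ccontr)
  assume "\<not> - w x \<le> v x"
  then have n: "v x + w x < 0" by simp
  define d where "d = - (v x + w x) / 2"
  have d: "0 < d" "v x + d = - (w x + d)" using n by (auto simp: d_def field_simps)
  obtain r where r: "0 < r" "\<And>y e. y \<in> X \<Longrightarrow> dist y x < r \<Longrightarrow> 0 < e \<Longrightarrow> e < r \<Longrightarrow> V e y < v x + d"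
    using relaxed_limsup_less[OF v x, of "v x + d"] d(1) by auto
  obtain s where s: "0 < s" "\<And>y e. y \<in> X \<Longrightarrow> dist y x < s \<Longrightarrow> 0 < e \<Longrightarrow> e < s \<Longrightarrow> - V e y < w x + d"
    using relaxed_limsup_less[OF w x, of "w x + d"] d(1) by auto
  have "V (min r s / 2) x < v x + d" using r(1) s(1) x by (intro r(2)) (auto simp: min_def)
  moreover have "- V (min r s / 2) x < w x + d" using r(1) s(1) x by (intro s(2)) (auto simp: min_def)
  ultimately show False using d(2) by linarith
qed

lemma continuous_on_usc:
  fixes v :: "'a::metric_space \<Rightarrow> real"
  assumes "usc_on S v" "usc_on S (\<lambda>x. - v x)"
  shows "continuous_on S v"
  unfolding continuous_on_iff
proof (intro ballI allI impI)
  fix x and d :: real assume x: "x \<in> S" and d: "0 < d"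
  obtain r where r: "0 < r" "\<And>y. y \<in> S \<Longrightarrow> dist y x < r \<Longrightarrow> v y < v x + d"
    using usc_onD[OF assms(1) x, of "v x + d"] d by auto
  obtain s where s: "0 < s" "\<And>y. y \<in> S \<Longrightarrow> dist y x < s \<Longrightarrow> - v y < - v x + d"
    using usc_onD[OF assms(2) x, of "- v x + d"] d by auto
  have "dist (v y) (v x) < d" if "y \<in> S" "dist y x < min r s" for y
    using r(2)[of y] s(2)[of y] that unfolding dist_real_def by auto
  then show "\<exists>r>0. \<forall>y\<in>S. dist y x < r \<longrightarrow> dist (v y) (v x) < d"
    using r(1) s(1) by (intro exI[of _ "min r s"]) auto
qed

text \<open>The sign condition includes \<open>f \<le> - c\<close>, so that the assumptions survive
  negation of \<open>u\<close>, \<open>F\<close> and \<open>f\<close>. Each one-sided result is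
  thereby available for both sides.\<close>

locale dpp_family = bounded_domain U for U :: "(real^'n) set" +
  fixes F f :: "real^'n \<Rightarrow> real" and u :: "real \<Rightarrow> real^'n \<Rightarrow> real"
  assumes F: "uniformly_continuous_on (frontier U) F" and f: "uniformly_continuous_on U f"
    and sign: "(\<forall>x\<in>U. f x = 0) \<or> (\<exists>c>0. (\<forall>x\<in>U. c \<le> f x) \<or> (\<forall>x\<in>U. f x \<le> - c))"
    and u_bounded: "\<And>e. 0 < e \<Longrightarrow> bounded (u e ` closure U)"
    and u_frontier: "\<And>e x. 0 < e \<Longrightarrow> x \<in> frontier U \<Longrightarrow> u e x = F x"
    and u_dpp: "\<And>e x. 0 < e \<Longrightarrow> x \<in> U \<Longrightarrow> u e x = midrange (closure U) e (u e) x + e\<^sup>2 * f x"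
begin

lemma uminus: "dpp_family U (\<lambda>x. - F x) (\<lambda>x. - f x) (\<lambda>e x. - u e x)"
proof
  show "uniformly_continuous_on (frontier U) (\<lambda>x. - F x)" by (rule uniformly_continuous_on_minus[OF F])
  show "uniformly_continuous_on U (\<lambda>x. - f x)" by (rule uniformly_continuous_on_minus[OF f])
  show "(\<forall>x\<in>U. - f x = 0) \<or> (\<exists>c>0. (\<forall>x\<in>U. c \<le> - f x) \<or> (\<forall>x\<in>U. - f x \<le> - c))"
    using sign by (auto simp: le_minus_iff)
  show "- u e x = midrange (closure U) e (\<lambda>x. - u e x) x + e\<^sup>2 * - f x" if "0 < e" "x \<in> U" for e x
    using u_dpp[OF that] by (simp add: midrange_uminus)
qed (use u_frontier u_bounded bounded_uminus_image in auto)

lemma F_bounded: "\<exists>R. \<forall>y\<in>frontier U. \<bar>F y\<bar> \<le> R"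
proof -
  have "compact (F ` frontier U)"
    by (rule compact_continuous_image[OF uniformly_continuous_imp_continuous[OF F] compact_frontier'])
  then have "bounded (F ` frontier U)" by (rule compact_imp_bounded)
  then show ?thesis by (auto simp: bounded_iff)
qed

lemma f_bounded: "\<exists>G\<ge>0. \<forall>x\<in>U. \<bar>f x\<bar> \<le> G"
proof -
  have "bounded (f ` U)" by (rule bounded_uniformly_continuous_image[OF f bounded_U])
  then obtain G where "\<forall>x\<in>U. \<bar>f x\<bar> \<le> G" by (auto simp: bounded_iff)
  then show ?thesis by (intro exI[of _ "max 0 G"]) auto
qed

lemma upper_barrier:
  assumes \<eta>: "0 < \<eta>"
  shows "\<exists>a>0. \<exists>e0>0. \<forall>e z x. 0 < e \<longrightarrow> e < e0 \<longrightarrow> z \<in> frontier U \<longrightarrow> x \<in> closure U \<longrightarrow>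
    u e x \<le> F z + \<eta> + a * dist x z"
proof -
  obtain R where R: "\<And>y. y \<in> frontier U \<Longrightarrow> \<bar>F y\<bar> \<le> R" using F_bounded by blast
  obtain G where G: "0 \<le> G" "\<And>x. x \<in> U \<Longrightarrow> \<bar>f x\<bar> \<le> G" using f_bounded by blast
  have "\<exists>a>0. \<exists>e0>0. \<forall>e w. 0 < e \<longrightarrow> e < e0 \<longrightarrow> bounded (w ` closure U) \<longrightarrow> (\<forall>y\<in>frontier U. w y \<le> F y) \<longrightarrow>
    (\<forall>x\<in>U. w x \<le> midrange (closure U) e w x + e\<^sup>2 * G) \<longrightarrow>
    (\<forall>z\<in>frontier U. \<forall>x\<in>closure U. w x \<le> F z + \<eta> + a * dist x z)"
    by (rule boundary_barrier[OF F R \<eta> G(1)])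
  then obtain a e0 where a: "0 < a" "0 < e0" and barrier: "\<forall>e w. 0 < e \<longrightarrow> e < e0 \<longrightarrow> bounded (w ` closure U) \<longrightarrow>
    (\<forall>y\<in>frontier U. w y \<le> F y) \<longrightarrow> (\<forall>x\<in>U. w x \<le> midrange (closure U) e w x + e\<^sup>2 * G) \<longrightarrow>
    (\<forall>z\<in>frontier U. \<forall>x\<in>closure U. w x \<le> F z + \<eta> + a * dist x z)"
    by (elim exE conjE)
  have "u e x \<le> F z + \<eta> + a * dist x z" if e: "0 < e" "e < e0" and z: "z \<in> frontier U" "x \<in> closure U" for e z x
  proof (rule barrier[rule_format, OF e u_bounded[OF e(1)] _ _ z])
    show "u e x \<le> midrange (closure U) e (u e) x + e\<^sup>2 * G" if x: "x \<in> U" for x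
    proof -
      have "e\<^sup>2 * f x \<le> e\<^sup>2 * G" using G(2)[OF x] by (intro mult_left_mono) auto
      then show ?thesis using u_dpp[OF e(1) x] by linarith
    qed
  qed (use u_frontier e in auto)
  then show ?thesis using a by blast
qed

lemma upper_near_frontier:
  assumes \<eta>: "0 < \<eta>"
  shows "\<exists>\<rho>>0. \<forall>e. 0 < e \<longrightarrow> e < \<rho> \<longrightarrow> (\<forall>z\<in>frontier U. \<forall>x\<in>closure U. dist x z < \<rho> \<longrightarrow> u e x \<le> F z + \<eta>)"
proof -
  have "0 < \<eta> / 2" using \<eta> by simp
  from upper_barrier[OF this] obtain a e0 where a: "0 < a" "0 < e0"
    "\<And>e z x. 0 < e \<Longrightarrow> e < e0 \<Longrightarrow> z \<in> frontier U \<Longrightarrow> x \<in> closure U \<Longrightarrow> u e x \<le> F z + \<eta> / 2 + a * dist x z"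
    by blast
  define \<rho> where "\<rho> = min e0 (\<eta> / (2 * a))"
  have \<rho>: "0 < \<rho>" "\<rho> \<le> e0" "a * \<rho> \<le> \<eta> / 2"
  proof -
    have "\<rho> \<le> \<eta> / (2 * a)" by (simp add: \<rho>_def)
    then show "a * \<rho> \<le> \<eta> / 2" using a(1) by (simp add: field_simps)
  qed (use a \<eta> in \<open>auto simp: \<rho>_def\<close>)
  have "u e x \<le> F z + \<eta>" if "0 < e" "e < \<rho>" "z \<in> frontier U" "x \<in> closure U" "dist x z < \<rho>" for e z x
  proof -
    have "a * dist x z \<le> a * \<rho>" using that a by (intro mult_left_mono) auto
    moreover have "u e x \<le> F z + \<eta> / 2 + a * dist x z" using that \<rho> by (intro a(3)) auto
    ultimately show ?thesis using \<rho>(3) by linarith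
  qed
  then show ?thesis using \<rho>(1) by blast
qed

lemma upper_uniform: "\<exists>e0>0. \<exists>R. \<forall>e. 0 < e \<longrightarrow> e < e0 \<longrightarrow> (\<forall>x\<in>closure U. u e x \<le> R)"
proof -
  obtain a e0 where a: "0 < a" "0 < e0"
    "\<And>e z x. 0 < e \<Longrightarrow> e < e0 \<Longrightarrow> z \<in> frontier U \<Longrightarrow> x \<in> closure U \<Longrightarrow> u e x \<le> F z + 1 + a * dist x z"
    using upper_barrier[OF zero_less_one] by blast
  obtain D where D: "\<And>x y. x \<in> closure U \<Longrightarrow> y \<in> closure U \<Longrightarrow> dist x y \<le> D" using diameter_bound by blast
  obtain z where z: "z \<in> frontier U" using frontier_nonempty by blast
  have "u e x \<le> F z + 1 + a * D" if "0 < e" "e < e0" "x \<in> closure U" for e x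
  proof -
    have "a * dist x z \<le> a * D" using a D[OF that(3), of z] z frontier_sub by (intro mult_left_mono) auto
    then show ?thesis using a(3)[OF that(1,2) z that(3)] by linarith
  qed
  then show ?thesis using a(2) by blast
qed

lemma uniform_bound: "\<exists>e0>0. \<exists>R. \<forall>e. 0 < e \<longrightarrow> e < e0 \<longrightarrow> (\<forall>x\<in>closure U. \<bar>u e x\<bar> \<le> R)"
proof -
  interpret m: dpp_family U "\<lambda>x. - F x" "\<lambda>x. - f x" "\<lambda>e x. - u e x" by (rule uminus)
  obtain e1 R1 where 1: "0 < e1" "\<And>e x. 0 < e \<Longrightarrow> e < e1 \<Longrightarrow> x \<in> closure U \<Longrightarrow> u e x \<le> R1" using upper_uniform by blast
  obtain e2 R2 where 2: "0 < e2" "\<And>e x. 0 < e \<Longrightarrow> e < e2 \<Longrightarrow> x \<in> closure U \<Longrightarrow> - u e x \<le> R2" using m.upper_uniform by blast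
  have "\<bar>u e x\<bar> \<le> max R1 R2" if "0 < e" "e < min e1 e2" "x \<in> closure U" for e x
    using 1(2)[of e x] 2(2)[of e x] that by auto
  then show ?thesis using 1(1) 2(1) by (intro exI[of _ "min e1 e2"]) auto
qed

lemma sub_le_dpp:
  assumes v: "viscosity_sub U f v" "usc_on U v" "bounded (v ` closure U)"
    and vF: "\<And>\<eta>. 0 < \<eta> \<Longrightarrow> \<exists>\<rho>>0. \<forall>z\<in>frontier U. \<forall>x\<in>closure U. dist x z < \<rho> \<longrightarrow> v x \<le> F z + \<eta>"
    and \<eta>: "0 < \<eta>"
  shows "\<exists>e1>0. \<forall>e. 0 < e \<longrightarrow> e < e1 \<longrightarrow> (\<forall>x\<in>closure U. v x \<le> u e x + \<eta>)"
proof -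
  interpret m: dpp_family U "\<lambda>x. - F x" "\<lambda>x. - f x" "\<lambda>e x. - u e x" by (rule uminus)
  obtain e0 R where e0: "0 < e0" and R: "\<And>e x. 0 < e \<Longrightarrow> e < e0 \<Longrightarrow> x \<in> closure U \<Longrightarrow> \<bar>u e x\<bar> \<le> R"
    using uniform_bound by blast
  obtain R' where R': "\<And>x. x \<in> closure U \<Longrightarrow> \<bar>v x\<bar> \<le> R'" using v(3) by (auto simp: bounded_iff)
  have "\<exists>\<rho>>0. \<forall>e. 0 < e \<longrightarrow> e < \<rho> \<longrightarrow> (\<forall>z\<in>frontier U. \<forall>x\<in>closure U. dist x z < \<rho> \<longrightarrow> F z - s \<le> u e x)"
    if s: "0 < s" for s
  proof -
    have "- u e x \<le> - F z + s \<longleftrightarrow> F z - s \<le> u e x" for e x z by auto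
    then show ?thesis using m.upper_near_frontier[OF s] by simp
  qed
  then show ?thesis
  proof (intro viscosity_sub_le_dpp[OF bounded_domain_axioms v(1,2) _ f sign vF e0, of "max R R'"])
    show "\<bar>v x\<bar> \<le> max R R'" if "x \<in> closure U" for x using R'[OF that] by simp
    show "\<bar>u e x\<bar> \<le> max R R'" if "0 < e" "e < e0" "x \<in> closure U" for e x using R[OF that] by simp
    show "midrange (closure U) e (u e) x + e\<^sup>2 * f x \<le> u e x" if "0 < e" "e < e0" "x \<in> U" for e x
      using u_dpp[OF that(1,3)] by simp
  qed (use \<eta> in auto)
qed

lemma relaxed_limit:
  "\<exists>v. relaxed_limsup (closure U) u v \<and> bounded (v ` closure U) \<and> viscosity_sub U f v \<and>
    (\<forall>\<eta>>0. \<exists>\<rho>>0. \<forall>z\<in>frontier U. \<forall>x\<in>closure U. dist x z < \<rho> \<longrightarrow> v x \<le> F z + \<eta>)"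
proof -
  obtain e0 R where e0: "0 < e0" and R: "\<And>e x. 0 < e \<Longrightarrow> e < e0 \<Longrightarrow> x \<in> closure U \<Longrightarrow> \<bar>u e x\<bar> \<le> R"
    using uniform_bound by blast
  have "\<exists>v. relaxed_limsup (closure U) u v \<and> (\<forall>x\<in>closure U. \<bar>v x\<bar> \<le> R)"
    by (rule relaxed_limsup_exists[OF e0 R])
  then obtain v where v: "relaxed_limsup (closure U) u v" "\<And>x. x \<in> closure U \<Longrightarrow> \<bar>v x\<bar> \<le> R"
    by blast
  have "relaxed_subsolution U u f v e0 R"
  proof
    show "u e x \<le> midrange (closure U) e (u e) x + e\<^sup>2 * f x" if "0 < e" "e < e0" "x \<in> U" for e x
      using u_dpp[OF that(1,3)] by simp
    show "continuous_on U f" by (rule uniformly_continuous_imp_continuous[OF f])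
  qed (use e0 R v in auto)
  then have "viscosity_sub U f v" by (rule viscosity_sub_relaxed_limsup)
  moreover have "bounded (v ` closure U)" by (rule bounded_image_realI) (rule v(2))
  moreover have "\<exists>\<rho>>0. \<forall>z\<in>frontier U. \<forall>x\<in>closure U. dist x z < \<rho> \<longrightarrow> v x \<le> F z + \<eta>" if \<eta>: "0 < \<eta>" for \<eta>
  proof -
    obtain \<rho> where \<rho>: "0 < \<rho>" "\<And>e z x. 0 < e \<Longrightarrow> e < \<rho> \<Longrightarrow> z \<in> frontier U \<Longrightarrow> x \<in> closure U \<Longrightarrow> dist x z < \<rho> \<Longrightarrow> u e x \<le> F z + \<eta>"
      using upper_near_frontier[OF \<eta>] by blast
    have "v x \<le> F z + \<eta>" if z: "z \<in> frontier U" "x \<in> closure U" "dist x z < \<rho> / 2" for z x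
    proof (rule relaxed_limsup_le[OF v(1) z(2), of "\<rho> / 2"])
      fix y e assume y: "y \<in> closure U" "dist y x < \<rho> / 2" "0 < e" "e < \<rho> / 2"
      have "dist y z < \<rho>" using dist_triangle[of y z x] y(2) z(3) by simp
      then show "u e y \<le> F z + \<eta>" using y z \<rho>(1) by (intro \<rho>(2)) auto
    qed (use \<rho> in simp)
    then show ?thesis using \<rho>(1) by (intro exI[of _ "\<rho> / 2"]) auto
  qed
  ultimately show ?thesis using v(1) by blast
qed

text \<open>One-sided comparison for \<open>v\<close> and for \<open>- v\<close>. The boundary
  estimate that it requires follows from uniform continuity of \<open>v\<close> on the compact
  closure.\<close>

lemma limit_unique:
  assumes v: "solves_dirichlet U (\<lambda>x. - 2 * f x) F v" and \<eta>: "0 < \<eta>"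
  shows "\<exists>e1>0. \<forall>e. 0 < e \<longrightarrow> e < e1 \<longrightarrow> (\<forall>x\<in>closure U. \<bar>u e x - v x\<bar> \<le> \<eta>)"
proof -
  interpret m: dpp_family U "\<lambda>x. - F x" "\<lambda>x. - f x" "\<lambda>e x. - u e x" by (rule uminus)
  have c: "continuous_on (closure U) v" and vs: "viscosity_sub U f v" "viscosity_sub U (\<lambda>x. - f x) (\<lambda>x. - v x)"
    and vF: "\<And>z. z \<in> frontier U \<Longrightarrow> v z = F z"
    using v unfolding solves_dirichlet_def viscosity_solution_iff_sub by blast+
  have cc: "compact (closure U)" using bounded_U by (simp add: compact_closure)
  have cU: "continuous_on U v" by (rule continuous_on_subset[OF c U_sub])
  have usc: "usc_on U v" "usc_on U (\<lambda>x. - v x)"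
    by (intro usc_on_continuous cU continuous_on_minus)+
  have bv: "bounded (v ` closure U)" by (intro compact_imp_bounded compact_continuous_image c cc)
  have near: "(\<exists>\<rho>>0. \<forall>z\<in>frontier U. \<forall>x\<in>closure U. dist x z < \<rho> \<longrightarrow> v x \<le> F z + s) \<and>
      (\<exists>\<rho>>0. \<forall>z\<in>frontier U. \<forall>x\<in>closure U. dist x z < \<rho> \<longrightarrow> - v x \<le> - F z + s)" if s: "0 < s" for s
  proof -
    have "\<exists>\<rho>>0. \<forall>x\<in>closure U. \<forall>y\<in>closure U. dist y x < \<rho> \<longrightarrow> dist (v y) (v x) < s"
      using compact_uniformly_continuous[OF c cc] s unfolding uniformly_continuous_on_def by simp
    then obtain \<rho> where \<rho>: "0 < \<rho>" "\<forall>x\<in>closure U. \<forall>y\<in>closure U. dist y x < \<rho> \<longrightarrow> dist (v y) (v x) < s"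
      by (elim exE conjE)
    have "v x \<le> F z + s \<and> - v x \<le> - F z + s" if z: "z \<in> frontier U" "x \<in> closure U" "dist x z < \<rho>" for x z
    proof -
      have "dist (v x) (v z) < s" using z frontier_sub by (intro \<rho>(2)[rule_format]) auto
      then show ?thesis using vF[OF z(1)] unfolding dist_real_def by linarith
    qed
    then show ?thesis using \<rho>(1) by (intro conjI exI[of _ \<rho>]) simp_all
  qed
  have "\<exists>e1>0. \<forall>e. 0 < e \<longrightarrow> e < e1 \<longrightarrow> (\<forall>x\<in>closure U. v x \<le> u e x + \<eta>)"
    by (rule sub_le_dpp[OF vs(1) usc(1) bv _ \<eta>]) (rule near[THEN conjunct1])
  then obtain e1 where e1: "0 < e1" "\<forall>e. 0 < e \<longrightarrow> e < e1 \<longrightarrow> (\<forall>x\<in>closure U. v x \<le> u e x + \<eta>)"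
    by (elim exE conjE)
  have "\<exists>e1>0. \<forall>e. 0 < e \<longrightarrow> e < e1 \<longrightarrow> (\<forall>x\<in>closure U. - v x \<le> - u e x + \<eta>)"
    by (rule m.sub_le_dpp[OF vs(2) usc(2) bounded_uminus_image[OF bv] _ \<eta>]) (rule near[THEN conjunct2])
  then obtain e2 where e2: "0 < e2" "\<forall>e. 0 < e \<longrightarrow> e < e2 \<longrightarrow> (\<forall>x\<in>closure U. - v x \<le> - u e x + \<eta>)"
    by (elim exE conjE)
  have "\<bar>u e x - v x\<bar> \<le> \<eta>" if "0 < e" "e < min e1 e2" "x \<in> closure U" for e x
  proof -
    have "v x \<le> u e x + \<eta>" "- v x \<le> - u e x + \<eta>" using e1(2) e2(2) that by simp_all
    then show ?thesis unfolding abs_le_iff by linarith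
  qed
  then show ?thesis using e1(1) e2(1) by (intro exI[of _ "min e1 e2"]) auto
qed

lemma solution_exists: "\<exists>v. solves_dirichlet U (\<lambda>x. - 2 * f x) F v"
proof -
  interpret m: dpp_family U "\<lambda>x. - F x" "\<lambda>x. - f x" "\<lambda>e x. - u e x" by (rule uminus)
  obtain v where v: "relaxed_limsup (closure U) u v" "bounded (v ` closure U)" "viscosity_sub U f v"
    "\<And>\<eta>. 0 < \<eta> \<Longrightarrow> \<exists>\<rho>>0. \<forall>z\<in>frontier U. \<forall>x\<in>closure U. dist x z < \<rho> \<longrightarrow> v x \<le> F z + \<eta>"
    using relaxed_limit by blast
  obtain w where w: "relaxed_limsup (closure U) (\<lambda>e x. - u e x) w" "bounded (w ` closure U)" "viscosity_sub U (\<lambda>x. - f x) w"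
    "\<And>\<eta>. 0 < \<eta> \<Longrightarrow> \<exists>\<rho>>0. \<forall>z\<in>frontier U. \<forall>x\<in>closure U. dist x z < \<rho> \<longrightarrow> w x \<le> - F z + \<eta>"
    using m.relaxed_limit by blast
  have usc: "usc_on (closure U) v" "usc_on (closure U) w"
    using usc_relaxed_limsup v(1) w(1) by blast+
  have eq: "w x = - v x" if x: "x \<in> closure U" for x
  proof (rule antisym)
    show "w x \<le> - v x"
    proof (rule field_le_epsilon)
      fix s :: real assume "0 < s"
      then have s: "0 < s / 2" by simp
      obtain e1 where e1: "0 < e1" "\<And>e. 0 < e \<Longrightarrow> e < e1 \<Longrightarrow> v x \<le> u e x + s / 2"
        using sub_le_dpp[OF v(3) usc_on_subset[OF usc(1) U_sub] v(2) v(4) s] x by blast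
      obtain e2 where e2: "0 < e2" "\<And>e. 0 < e \<Longrightarrow> e < e2 \<Longrightarrow> w x \<le> - u e x + s / 2"
        using m.sub_le_dpp[OF w(3) usc_on_subset[OF usc(2) U_sub] w(2) w(4) s] x by blast
      have "0 < min e1 e2 / 2" "min e1 e2 / 2 < e1" "min e1 e2 / 2 < e2" using e1(1) e2(1) by auto
      \<comment> \<open>Both comparisons use the same discrete solution at one small step size, so
        adding them eliminates it.\<close>
      then have "v x \<le> u (min e1 e2 / 2) x + s / 2" "w x \<le> - u (min e1 e2 / 2) x + s / 2"
        using e1(2) e2(2) by blast+
      then show "w x \<le> - v x + s" by linarith
    qed
    show "- v x \<le> w x" using relaxed_limsup_uminus[OF v(1) w(1) x] by simp
  qed
  have v': "relaxed_limsup (closure U) (\<lambda>e x. - u e x) (\<lambda>x. - v x)"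
    by (rule relaxed_limsup_cong[OF w(1) eq])
  have "viscosity_sub U (\<lambda>x. - f x) (\<lambda>x. - v x)"
  proof -
    obtain e0 R where e0: "0 < e0" and R: "\<And>e x. 0 < e \<Longrightarrow> e < e0 \<Longrightarrow> x \<in> closure U \<Longrightarrow> \<bar>- u e x\<bar> \<le> R"
      using m.uniform_bound by blast
    have "relaxed_subsolution U (\<lambda>e x. - u e x) (\<lambda>x. - f x) (\<lambda>x. - v x) e0 R"
    proof
      show "- u e x \<le> midrange (closure U) e (\<lambda>x. - u e x) x + e\<^sup>2 * - f x" if "0 < e" "e < e0" "x \<in> U" for e x
        using m.u_dpp[OF that(1,3)] by simp
      show "continuous_on U (\<lambda>x. - f x)" by (rule uniformly_continuous_imp_continuous[OF m.f])
    qed (use e0 R v' in auto)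
    then show ?thesis by (rule viscosity_sub_relaxed_limsup)
  qed
  then have "viscosity_solution U (\<lambda>x. - 2 * f x) v" using v(3) unfolding viscosity_solution_iff_sub by blast
  \<comment> \<open>Since \<open>- v\<close> is a relaxed upper limit too, \<open>v\<close> is
    semicontinuous from both sides.\<close>
  moreover have "continuous_on (closure U) v"
    using usc_relaxed_limsup[OF v'] usc(1) by (intro continuous_on_usc)
  moreover have "v z = F z" if z: "z \<in> frontier U" for z
  proof (rule antisym; rule field_le_epsilon)
    fix s :: real assume s: "0 < s"
    have zz: "z \<in> closure U" using z frontier_sub by blast
    obtain \<rho> where "0 < \<rho>" "\<And>z x. z \<in> frontier U \<Longrightarrow> x \<in> closure U \<Longrightarrow> dist x z < \<rho> \<Longrightarrow> v x \<le> F z + s" using v(4)[OF s] by blast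
    then show "v z \<le> F z + s" using z zz by simp
    obtain \<rho> where "0 < \<rho>" "\<And>z x. z \<in> frontier U \<Longrightarrow> x \<in> closure U \<Longrightarrow> dist x z < \<rho> \<Longrightarrow> w x \<le> - F z + s" using w(4)[OF s] by blast
    then have "w z \<le> - F z + s" using z zz by simp
    then show "F z \<le> v z + s" using eq[OF zz] by simp
  qed
  ultimately show ?thesis unfolding solves_dirichlet_def by blast
qed

text \<open>The negated family never enters as a game, so the case \<open>f \<le> - c\<close> is
  left out of the alternatives for \<open>f\<close>.\<close>

lemma game_value_eq:
  assumes f0: "(\<forall>x\<in>U. f x = 0) \<or> (\<exists>c>0. \<forall>x\<in>U. c \<le> f x)" and e: "0 < e" and x: "x \<in> closure U"
  shows "value_I (closure U) (frontier U) F f e x = ereal (u e x)"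
    "value_II (closure U) (frontier U) F f e x = ereal (u e x)"
proof -
  obtain N K where "tug_of_war (closure U) (frontier U) e N K" using tug_instance[OF e] by blast
  then interpret tug_of_war "closure U" "frontier U" e N K .
  obtain R1 where R1: "\<forall>y\<in>frontier U. \<bar>F y\<bar> \<le> R1" using F_bounded by (elim exE)
  obtain R2 where R2: "\<forall>y\<in>closure U. \<bar>u e y\<bar> \<le> R2" using u_bounded[OF e] by (auto simp: bounded_iff)
  obtain G where G: "\<forall>x\<in>U. \<bar>f x\<bar> \<le> G" using f_bounded by (elim exE conjE)
  define R where "R = max 0 (max R1 R2)"
  have 1: "\<bar>u e y\<bar> \<le> R" if "y \<in> closure U" for y using R2 that by (fastforce simp: R_def)
  have 2: "\<bar>F y\<bar> \<le> R" if "y \<in> frontier U" for y using R1 that by (fastforce simp: R_def)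
  have 3: "0 \<le> R" by (simp add: R_def)
  have 4: "u e y = midrange (closure U) e (u e) y + e\<^sup>2 * f y" if "y \<in> closure U - frontier U" for y
    using u_dpp[OF e] that closure_minus_frontier by simp
  have 5: "(\<forall>x\<in>closure U - frontier U. f x = 0) \<or> (\<exists>c>0. \<forall>x\<in>closure U - frontier U. c \<le> f x \<and> f x \<le> G)"
    unfolding closure_minus_frontier using f0 G by (auto simp: abs_le_iff)
  show "value_I (closure U) (frontier U) F f e x = ereal (u e x)"
    "value_II (closure U) (frontier U) F f e x = ereal (u e x)"
    by (rule game_value[OF 1 2 3 u_frontier[OF e] 4 5 x]; assumption)+
qed

lemma continuum_value:
  assumes f0: "(\<forall>x\<in>U. f x = 0) \<or> (\<exists>c>0. \<forall>x\<in>U. c \<le> f x)"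
    and v: "solves_dirichlet U (\<lambda>x. - 2 * f x) F v"
  shows "is_continuum_value (closure U) (frontier U) F f v"
proof -
  have "((\<lambda>e. value_I (closure U) (frontier U) F f e x) \<longlongrightarrow> ereal (v x)) (at_right 0)" if x: "x \<in> closure U" for x
  proof -
    have "((\<lambda>e. u e x) \<longlongrightarrow> v x) (at_right 0)"
      unfolding tendsto_iff
    proof (intro allI impI)
      fix d :: real assume d: "0 < d"
      have "0 < d / 2" using d by simp
      from limit_unique[OF v this] obtain e1 where e1: "0 < e1"
        "\<forall>e. 0 < e \<longrightarrow> e < e1 \<longrightarrow> (\<forall>x\<in>closure U. \<bar>u e x - v x\<bar> \<le> d / 2)" by (elim exE conjE)
      have "\<forall>\<^sub>F e in at_right 0. e \<in> {0<..<e1}" by (rule eventually_at_right_real[OF e1(1)])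
      then show "\<forall>\<^sub>F e in at_right 0. dist (u e x) (v x) < d"
      proof eventually_elim
        case (elim e)
        then have "\<bar>u e x - v x\<bar> \<le> d / 2" using e1(2) x by simp
        then show ?case using d unfolding dist_real_def by linarith
      qed
    qed
    then have "((\<lambda>e. ereal (u e x)) \<longlongrightarrow> ereal (v x)) (at_right 0)" by (rule tendsto_ereal)
    moreover have "\<forall>\<^sub>F e in at_right 0. ereal (u e x) = value_I (closure U) (frontier U) F f e x"
      using eventually_at_right_less by eventually_elim (simp add: game_value_eq(1)[OF f0 _ x])
    ultimately show ?thesis by (rule Lim_transform_eventually)
  qed
  then show ?thesis unfolding is_continuum_value_def using game_value_eq[OF f0] by simp
qed

lemma solution_unique:
  assumes v: "solves_dirichlet U (\<lambda>x. - 2 * f x) F v" and w: "solves_dirichlet U (\<lambda>x. - 2 * f x) F w"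
    and x: "x \<in> closure U"
  shows "v x \<le> w x"
proof (rule field_le_epsilon)
  fix d :: real assume "0 < d"
  then have d: "0 < d / 2" by simp
  from limit_unique[OF v d] obtain e1 where e1: "0 < e1"
    "\<forall>e. 0 < e \<longrightarrow> e < e1 \<longrightarrow> (\<forall>x\<in>closure U. \<bar>u e x - v x\<bar> \<le> d / 2)" by (elim exE conjE)
  from limit_unique[OF w d] obtain e2 where e2: "0 < e2"
    "\<forall>e. 0 < e \<longrightarrow> e < e2 \<longrightarrow> (\<forall>x\<in>closure U. \<bar>u e x - w x\<bar> \<le> d / 2)" by (elim exE conjE)
  define e where "e = min e1 e2 / 2"
  have "0 < e" "e < e1" "e < e2" using e1(1) e2(1) by (auto simp: e_def)
  then have "\<bar>u e x - v x\<bar> \<le> d / 2" "\<bar>u e x - w x\<bar> \<le> d / 2" using e1(2) e2(2) x by blast+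
  then show "v x \<le> w x + d" by linarith
qed

end

lemma (in bounded_domain) dpp_solution:
  assumes F: "uniformly_continuous_on (frontier U) F" and f: "uniformly_continuous_on U f" and e: "0 < e"
  shows "\<exists>w. bounded (w ` closure U) \<and> (\<forall>x\<in>frontier U. w x = F x) \<and>
    (\<forall>x\<in>U. w x = midrange (closure U) e w x + e\<^sup>2 * f x)"
proof -
  obtain N K where "tug_of_war (closure U) (frontier U) e N K" using tug_instance[OF e] by blast
  then interpret tug_of_war "closure U" "frontier U" e N K .
  have "bounded (F ` frontier U)"
    by (intro compact_imp_bounded compact_continuous_image uniformly_continuous_imp_continuous[OF F] compact_frontier')
  then obtain R where R: "\<forall>y\<in>frontier U. \<bar>F y\<bar> \<le> R" by (auto simp: bounded_iff)
  have "bounded (f ` U)" by (rule bounded_uniformly_continuous_image[OF f bounded_U])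
  then obtain G where G: "\<forall>x\<in>U. \<bar>f x\<bar> \<le> G" by (auto simp: bounded_iff)
  have R': "\<bar>F y\<bar> \<le> max 0 R" if "y \<in> frontier U" for y using R that by fastforce
  have G': "\<bar>e\<^sup>2 * f x\<bar> \<le> e\<^sup>2 * max 0 G" if "x \<in> closure U - frontier U" for x
    using G that closure_minus_frontier by (auto simp: abs_mult intro!: mult_left_mono intro: max.coboundedI2)
  show ?thesis
  proof (rule dpp_exists[OF R' G'])
    fix w assume w: "\<And>x. x \<in> closure U \<Longrightarrow> \<bar>w x\<bar> \<le> max 0 R + e\<^sup>2 * max 0 G * 2 ^ (K + 1)"
      "\<And>x. x \<in> frontier U \<Longrightarrow> w x = F x"
      "\<And>x. x \<in> closure U - frontier U \<Longrightarrow> w x = midrange (closure U) e w x + e\<^sup>2 * f x"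
    have "bounded (w ` closure U)" by (rule bounded_image_realI) (rule w(1))
    then show ?thesis using w(2,3) unfolding closure_minus_frontier by blast
  qed auto
qed

theorem corollary1p9:
  fixes U :: "(real^'n) set" and F f :: "real^'n \<Rightarrow> real"
  assumes "U \<noteq> {}" and "bounded U" and "open U"
    and "uniformly_continuous_on (frontier U) F"
    and "(\<forall>x\<in>U. f x = 0) \<or> (0 < (INF x\<in>U. ereal (f x)) \<and> uniformly_continuous_on U f)"
  shows "\<exists>u. solves_dirichlet U (\<lambda>x. - 2 * f x) F u \<and>
             (\<forall>v. solves_dirichlet U (\<lambda>x. - 2 * f x) F v \<longrightarrow> (\<forall>x\<in>closure U. v x = u x)) \<and>
             is_continuum_value (closure U) (frontier U) F f u"
proof -
  interpret bounded_domain U using assms(1-3) by unfold_locales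
  have f: "uniformly_continuous_on U f" and f0: "(\<forall>x\<in>U. f x = 0) \<or> (\<exists>c>0. \<forall>x\<in>U. c \<le> f x)"
  proof -
    show "uniformly_continuous_on U f"
      using assms(5)
    proof
      assume "\<forall>x\<in>U. f x = 0"
      then show ?thesis by (simp add: uniformly_continuous_on_def)
    qed simp
    show "(\<forall>x\<in>U. f x = 0) \<or> (\<exists>c>0. \<forall>x\<in>U. c \<le> f x)"
      using assms(5)
    proof
      assume "0 < (INF x\<in>U. ereal (f x)) \<and> uniformly_continuous_on U f"
      \<comment> \<open>The infimum is taken in \<open>ereal\<close>; a real number strictly between
        0 and it serves as the lower bound.\<close>
      then obtain c where c: "0 < ereal c" "ereal c < (INF x\<in>U. ereal (f x))"
        using ereal_dense2[of 0 "INF x\<in>U. ereal (f x)"] by blast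
      have "c \<le> f x" if "x \<in> U" for x
        using order.strict_trans2[OF c(2) INF_lower[OF that]] by simp
      then show ?thesis using c(1) by auto
    qed simp
  qed
  \<comment> \<open>One bounded solution is chosen for each \<open>e\<close>; for
    \<open>e \<le> 0\<close> the choice is arbitrary.\<close>
  have "\<forall>e. \<exists>w. 0 < e \<longrightarrow> bounded (w ` closure U) \<and> (\<forall>x\<in>frontier U. w x = F x) \<and>
      (\<forall>x\<in>U. w x = midrange (closure U) e w x + e\<^sup>2 * f x)"
    using dpp_solution[OF assms(4) f] by blast
  then obtain w where w: "\<forall>e. 0 < e \<longrightarrow> bounded (w e ` closure U) \<and> (\<forall>x\<in>frontier U. w e x = F x) \<and>
      (\<forall>x\<in>U. w e x = midrange (closure U) e (w e) x + e\<^sup>2 * f x)"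
    by (rule choice[THEN exE])
  interpret dpp_family U F f w
  proof
    show "(\<forall>x\<in>U. f x = 0) \<or> (\<exists>c>0. (\<forall>x\<in>U. c \<le> f x) \<or> (\<forall>x\<in>U. f x \<le> - c))" using f0 by blast
  qed (use assms(4) f w in simp_all)
  obtain u where u: "solves_dirichlet U (\<lambda>x. - 2 * f x) F u" using solution_exists by blast
  have "v x = u x" if "solves_dirichlet U (\<lambda>x. - 2 * f x) F v" "x \<in> closure U" for v x
    using solution_unique that u by (meson order_antisym)
  then show ?thesis using u continuum_value[OF f0 u] by blast
qed

end
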